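(* (Positive mass theorem.) Let $n\geq 5$, $m\geq 1$, and let $M^n\subset\mathbb{R}^{n+m}$ be the graph of an asymptotically flat map $f:\mathbb{R}^n\to\mathbb{R}^m$ (of some order $\tau>(n-4)/3$), endowed with the induced metric $g_{ij}=\delta_{ij}+\sum_\alpha f^\alpha_i f^\alpha_j$, and assume $L_2$ is integrable. Then the second Gauss–Bonnet–Chern mass of $M$ satisfies $$m_2(g)=\frac12 c_2(n)\int_M\big(L_2+L_2^{\perp}\big)\frac{1}{\sqrt{G}}\,d\mu_M ,$$ where $G=\det(g_{ij})$, and $L_2^{\perp}$ vanishes provided $M$ has flat normal bundle. In particular, if $M$ has flat normal bundle and $L_2\geq 0$, then $m_2\geq 0$.
   Context: Notation: indices $1\le i,j,k,l,s\le n$, $1\le\alpha,\beta,\gamma\le m$, repeated indices summed. For $f=(f^1,\dots,f^m)$, $f^\alpha_i,f^\alpha_{ij},f^\alpha_{ijk}$ are its first, second, third partial derivatives. $f$ is asymptotically flat of order $\tau$ if $|f^\alpha_i(x)|+|f^\alpha_{ij}(x)||x|+|f^\alpha_{ijk}(x)||x|^2=O(|x|^{-\tau/2})$ as $|x|\to\infty$, for some $\tau>(n-4)/3$. $M=\{(x,f(x))\}$ is parametrized by $x\in\mathbb{R}^n$, with $\partial_i=(e_i,f^\alpha_i e_\alpha)$, metric $g_{ij}=\delta_{ij}+f^\alpha_if^\alpha_j$, inverse $g^{ij}$. Let $U_{\alpha\beta}=\delta_{\alpha\beta}+\langle Df^\alpha,Df^\beta\rangle$ with inverse $U^{\alpha\beta}$.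 Curvature convention: $R_{ijkl}$ is the Riemann tensor of $g$ with $R_{ijij}$ equal to the sectional curvature of an orthonormal pair, $R_{jl}=g^{ik}R_{ijkl}$, $R=g^{jl}R_{jl}$; indices are raised with $g$. Define $P^{ijkl}=R^{ijkl}+R^{jk}g^{il}-R^{jl}g^{ik}-R^{ik}g^{jl}+R^{il}g^{jk}+\tfrac12R(g^{ik}g^{jl}-g^{il}g^{jk})$ and the Gauss–Bonnet curvature $L_2=P^{ijkl}R_{ijkl}$. The second Gauss–Bonnet–Chern mass is $m_2(g)=c_2(n)\lim_{r\to\infty}\int_{S_r}P^{ijkl}\partial_lg_{jk}\,\nu_i\,dS$, where $c_2(n)=\frac{1}{2(n-1)(n-2)(n-3)\omega_{n-1}}$, $\omega_{n-1}$ is the area of the unit sphere $S^{n-1}$, $S_r=\{|x|=r\}\subset\mathbb{R}^n$ with Euclidean area element $dS$ and $\nu=x/r$. Define $T_{ijkl}=U^{\beta\gamma}f^\beta_sf^\alpha_k\big(f^\gamma_{js}f^\alpha_{il}-f^\gamma_{il}f^\alpha_{js}\big)$ and $L_2^{\perp}=2P^{ijkl}T_{ijkl}$. The normal bundle of $M$ is flat if its normal curvature vanishes, equivalently the shape operators $A^\alpha$ (defined by $A^\alpha\partial_i=f^\alpha_{ik}g^{kj}\partial_j$, i.e. with respect to the normals $\eta^\alpha=(-Df^\alpha,e_\alpha)$) pairwise commute. *)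

theory Defs
  imports "HOL-Analysis.Analysis"
begin

definition pd :: "'n::finite \<Rightarrow> (real^'n \<Rightarrow> real) \<Rightarrow> real^'n \<Rightarrow> real" where
  "pd i h x = deriv (\<lambda>t. h (x + t *\<^sub>R axis i 1)) 0"

primrec pds :: "'n::finite list \<Rightarrow> (real^'n \<Rightarrow> real) \<Rightarrow> real^'n \<Rightarrow> real" where
  "pds [] h = h"
| "pds (i # is) h = pd i (pds is h)"

definition smooth_fun :: "(real^'n::finite \<Rightarrow> real) \<Rightarrow> bool" where
  "smooth_fun h \<longleftrightarrow> (\<forall>is x. (pds is h) differentiable (at x))"

definition coordf :: "(real^'n::finite \<Rightarrow> real^'m::finite) \<Rightarrow> 'm \<Rightarrow> real^'n \<Rightarrow> real" where
  "coordf f a = (\<lambda>x. f x $ a)"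

definition asymp_flat :: "(real^'n::finite \<Rightarrow> real^'m::finite) \<Rightarrow> real \<Rightarrow> bool" where
  "asymp_flat f \<tau> \<longleftrightarrow> (\<exists>C R0. \<forall>x a i j k. norm x \<ge> R0 \<longrightarrow>
      \<bar>pd i (coordf f a) x\<bar> + \<bar>pd j (pd i (coordf f a)) x\<bar> * norm x
      + \<bar>pd k (pd j (pd i (coordf f a))) x\<bar> * (norm x)\<^sup>2 \<le> C * norm x powr (- \<tau> / 2))"

definition metric :: "(real^'n::finite \<Rightarrow> real^'m::finite) \<Rightarrow> real^'n \<Rightarrow> real^'n^'n" where
  "metric f x = (\<chi> i j. (if i = j then 1 else 0) + (\<Sum>a\<in>UNIV. pd i (coordf f a) x * pd j (coordf f a) x))"

definition gc :: "(real^'n::finite \<Rightarrow> real^'m::finite) \<Rightarrow> 'n \<Rightarrow> 'n \<Rightarrow> real^'n \<Rightarrow> real" where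
  "gc f i j = (\<lambda>x. metric f x $ i $ j)"

definition ginv :: "(real^'n::finite \<Rightarrow> real^'m::finite) \<Rightarrow> real^'n \<Rightarrow> real^'n^'n" where
  "ginv f x = matrix_inv (metric f x)"

definition Gdet :: "(real^'n::finite \<Rightarrow> real^'m::finite) \<Rightarrow> real^'n \<Rightarrow> real" where
  "Gdet f x = det (metric f x)"

definition Gam :: "(real^'n::finite \<Rightarrow> real^'m::finite) \<Rightarrow> 'n \<Rightarrow> 'n \<Rightarrow> 'n \<Rightarrow> real^'n \<Rightarrow> real" where
  "Gam f k i j = (\<lambda>x. 1/2 * (\<Sum>l\<in>UNIV. ginv f x $ k $ l *
      (pd i (gc f j l) x + pd j (gc f i l) x - pd l (gc f i j) x)))"

text \<open>R_{ijkl} = < R(d_i,d_j) d_l , d_k >, with R(X,Y) = [nabla_X,nabla_Y] - nabla_[X,Y];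
  so R_{ijij} is the sectional curvature of an orthonormal pair.\<close>
definition Rm :: "(real^'n::finite \<Rightarrow> real^'m::finite) \<Rightarrow> 'n \<Rightarrow> 'n \<Rightarrow> 'n \<Rightarrow> 'n \<Rightarrow> real^'n \<Rightarrow> real" where
  "Rm f i j k l x = (\<Sum>s\<in>UNIV. gc f k s x *
      (pd i (Gam f s j l) x - pd j (Gam f s i l) x
       + (\<Sum>p\<in>UNIV. Gam f p j l x * Gam f s i p x - Gam f p i l x * Gam f s j p x)))"

definition Ric :: "(real^'n::finite \<Rightarrow> real^'m::finite) \<Rightarrow> 'n \<Rightarrow> 'n \<Rightarrow> real^'n \<Rightarrow> real" where
  "Ric f j l x = (\<Sum>i\<in>UNIV. \<Sum>k\<in>UNIV. ginv f x $ i $ k * Rm f i j k l x)"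

definition Scal :: "(real^'n::finite \<Rightarrow> real^'m::finite) \<Rightarrow> real^'n \<Rightarrow> real" where
  "Scal f x = (\<Sum>j\<in>UNIV. \<Sum>l\<in>UNIV. ginv f x $ j $ l * Ric f j l x)"

definition Rmup :: "(real^'n::finite \<Rightarrow> real^'m::finite) \<Rightarrow> 'n \<Rightarrow> 'n \<Rightarrow> 'n \<Rightarrow> 'n \<Rightarrow> real^'n \<Rightarrow> real" where
  "Rmup f i j k l x = (\<Sum>a\<in>UNIV. \<Sum>b\<in>UNIV. \<Sum>c\<in>UNIV. \<Sum>d\<in>UNIV.
      ginv f x $ i $ a * ginv f x $ j $ b * ginv f x $ k $ c * ginv f x $ l $ d * Rm f a b c d x)"

definition Ricup :: "(real^'n::finite \<Rightarrow> real^'m::finite) \<Rightarrow> 'n \<Rightarrow> 'n \<Rightarrow> real^'n \<Rightarrow> real" where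
  "Ricup f j k x = (\<Sum>a\<in>UNIV. \<Sum>b\<in>UNIV. ginv f x $ j $ a * ginv f x $ k $ b * Ric f a b x)"

definition Ptens :: "(real^'n::finite \<Rightarrow> real^'m::finite) \<Rightarrow> 'n \<Rightarrow> 'n \<Rightarrow> 'n \<Rightarrow> 'n \<Rightarrow> real^'n \<Rightarrow> real" where
  "Ptens f i j k l x = (let gi = ginv f x in
      Rmup f i j k l x + Ricup f j k x * gi $ i $ l - Ricup f j l x * gi $ i $ k
      - Ricup f i k x * gi $ j $ l + Ricup f i l x * gi $ j $ k
      + 1/2 * Scal f x * (gi $ i $ k * gi $ j $ l - gi $ i $ l * gi $ j $ k))"

definition L2 :: "(real^'n::finite \<Rightarrow> real^'m::finite) \<Rightarrow> real^'n \<Rightarrow> real" where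
  "L2 f x = (\<Sum>i\<in>UNIV. \<Sum>j\<in>UNIV. \<Sum>k\<in>UNIV. \<Sum>l\<in>UNIV. Ptens f i j k l x * Rm f i j k l x)"

definition Umat :: "(real^'n::finite \<Rightarrow> real^'m::finite) \<Rightarrow> real^'n \<Rightarrow> real^'m^'m" where
  "Umat f x = (\<chi> a b. (if a = b then 1 else 0) + (\<Sum>i\<in>UNIV. pd i (coordf f a) x * pd i (coordf f b) x))"

definition Tt :: "(real^'n::finite \<Rightarrow> real^'m::finite) \<Rightarrow> 'n \<Rightarrow> 'n \<Rightarrow> 'n \<Rightarrow> 'n \<Rightarrow> real^'n \<Rightarrow> real" where
  "Tt f i j k l x = (\<Sum>b\<in>UNIV. \<Sum>c\<in>UNIV. \<Sum>s\<in>UNIV. \<Sum>a\<in>UNIV.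
      matrix_inv (Umat f x) $ b $ c * pd s (coordf f b) x * pd k (coordf f a) x *
      (pd s (pd j (coordf f c)) x * pd l (pd i (coordf f a)) x
       - pd l (pd i (coordf f c)) x * pd s (pd j (coordf f a)) x))"

definition L2perp :: "(real^'n::finite \<Rightarrow> real^'m::finite) \<Rightarrow> real^'n \<Rightarrow> real" where
  "L2perp f x = 2 * (\<Sum>i\<in>UNIV. \<Sum>j\<in>UNIV. \<Sum>k\<in>UNIV. \<Sum>l\<in>UNIV. Ptens f i j k l x * Tt f i j k l x)"

definition shape :: "(real^'n::finite \<Rightarrow> real^'m::finite) \<Rightarrow> 'm \<Rightarrow> real^'n \<Rightarrow> real^'n^'n" where
  "shape f a x = (\<chi> i j. \<Sum>k\<in>UNIV. pd k (pd i (coordf f a)) x * ginv f x $ k $ j)"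

definition flat_normal_bundle :: "(real^'n::finite \<Rightarrow> real^'m::finite) \<Rightarrow> bool" where
  "flat_normal_bundle f \<longleftrightarrow> (\<forall>x a b. shape f a x ** shape f b x = shape f b x ** shape f a x)"

text \<open>Surface integral over the Euclidean sphere S_r = {|x| = r} with respect to the
  (n-1)-dimensional area element, via the cone-measure formula
  int_{S_r} h dS = r^(n-1) * n * int_{B_1} h(r y/|y|) dy.\<close>
definition sphere_int :: "real \<Rightarrow> (real^'n::finite \<Rightarrow> real) \<Rightarrow> real" where
  "sphere_int r h = real CARD('n) * r ^ (CARD('n) - 1) *
      integral (ball 0 1) (\<lambda>y. h ((r / norm y) *\<^sub>R y))"

definition omega :: "'n::finite itself \<Rightarrow> real" where
  "omega _ = sphere_int 1 (\<lambda>_::real^'n. 1)"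

definition c2 :: "'n::finite itself \<Rightarrow> real" where
  "c2 T = 1 / (2 * (real CARD('n) - 1) * (real CARD('n) - 2) * (real CARD('n) - 3) * omega T)"

definition mass_flux :: "(real^'n::finite \<Rightarrow> real^'m::finite) \<Rightarrow> real \<Rightarrow> real" where
  "mass_flux f r = sphere_int r (\<lambda>x. \<Sum>i\<in>UNIV. \<Sum>j\<in>UNIV. \<Sum>k\<in>UNIV. \<Sum>l\<in>UNIV.
      Ptens f i j k l x * pd l (gc f j k) x * (x $ i / r))"

text \<open>Integration over M = graph(f) with respect to its Riemannian measure d mu_M = sqrt G dx.\<close>
definition M_integrable :: "(real^'n::finite \<Rightarrow> real^'m::finite) \<Rightarrow> (real^'n \<Rightarrow> real) \<Rightarrow> bool" where
  "M_integrable f h \<longleftrightarrow> (\<lambda>x. h x * sqrt (Gdet f x)) absolutely_integrable_on UNIV"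

definition M_integral :: "(real^'n::finite \<Rightarrow> real^'m::finite) \<Rightarrow> (real^'n \<Rightarrow> real) \<Rightarrow> real" where
  "M_integral f h = integral UNIV (\<lambda>x. h x * sqrt (Gdet f x))"

end

theory Submission
  imports Defs "HOL-Library.Landau_Symbols"
begin

text \<open>
  Writing \<open>h\<^sub>i\<^sub>j = (f\<^sup>\<alpha>\<^sub>i\<^sub>j)\<close> and \<open>b\<close> for the bilinear form of \<open>U\<^sup>-\<^sup>1\<close>, the graph has
  \<open>\<Gamma>\<^sup>k\<^sub>i\<^sub>j = U\<^sup>\<alpha>\<^sup>\<beta> f\<^sup>\<alpha>\<^sub>k f\<^sup>\<beta>\<^sub>i\<^sub>j\<close> and the Gauss equation
  \<open>R\<^sub>i\<^sub>j\<^sub>k\<^sub>l = b(h\<^sub>i\<^sub>k, h\<^sub>j\<^sub>l) - b(h\<^sub>i\<^sub>l, h\<^sub>j\<^sub>k)\<close>. The covariant derivative of \<open>h\<close> is totally symmetric, which gives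
  the second Bianchi identity and hence \<open>\<nabla>\<^sub>i P\<^sup>i\<^sup>j\<^sup>k\<^sup>l = 0\<close>. Therefore
  \<open>\<partial>\<^sub>i (P\<^sup>i\<^sup>j\<^sup>k\<^sup>l \<partial>\<^sub>l g\<^sub>j\<^sub>k) = (L\<^sub>2 + L\<^sub>2\<^sup>\<bottom>) / 2\<close> pointwise, where the Christoffel terms that do not cancel
  assemble to \<open>P\<^sup>i\<^sup>j\<^sup>k\<^sup>l T\<^sub>i\<^sub>j\<^sub>k\<^sub>l\<close>. The mass formula is then the divergence theorem on balls together with
  \<open>L\<^sub>2\<^sup>\<bottom> = O(|x|\<^sup>-\<^sup>3\<^sup>\<tau>\<^sup>-\<^sup>4)\<close>, which is integrable because \<open>3\<tau> + 4 > n\<close>.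
  If the shape operators commute, \<open>P\<^sup>i\<^sup>j\<^sup>k\<^sup>l f\<^sup>\<alpha>\<^sub>i\<^sub>l f\<^sup>\<gamma>\<^sub>j\<^sub>s g\<^sup>s\<^sup>q\<close> is symmetric in \<open>k\<close> and \<open>q\<close>, so that the
  antisymmetrization over \<open>\<alpha>\<close> and \<open>\<gamma>\<close> in \<open>L\<^sub>2\<^sup>\<bottom>\<close> vanishes.
\<close>

section \<open>Smooth functions and their partial derivatives\<close>

text \<open>No surface measure enters: \<open>sphere_int\<close> is a solid integral over the unit
  ball, so the divergence theorem has to be extracted from the way ball integrals vary with the
  radius. Once it is available, flux and ball integral agree at every radius, and existence of the
  mass reduces to integrability of \<open>L2 + L2perp\<close> on R^n. The decay hypothesis does not
  give this for \<open>L2\<close>: the curvature is O(|x|^(-tau-2)), so \<open>L2\<close> is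
  O(|x|^(-2 tau-4)), a rate that need not be integrable for tau just above (n-4)/3; hence the
  separate assumption on \<open>L2\<close>. The normal term carries two further first derivatives
  and gains tau. The assumption on \<open>L2\<close> concerns the measure of M; a lower bound for
  the volume density transfers it to Lebesgue measure. The Hessian vectors of f are not the second
  fundamental form. The form of U^{-1} measures their normal parts, and differentiating it produces
  the extra Christoffel term that makes the covariant derivative symmetric in all indices.\<close>

lemma pd_has_real_derivative:
  assumes "h differentiable (at x)"
  shows "((\<lambda>t. h (x + t *\<^sub>R axis i 1)) has_real_derivative pd i h x) (at 0)"
    and "pd i h x = frechet_derivative h (at x) (axis i 1)"
proof -
  have d: "(h has_derivative frechet_derivative h (at x)) (at x)"
    using assms frechet_derivative_works by blast
  have "((\<lambda>t::real. h (x + t *\<^sub>R axis i 1)) has_derivative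
      (\<lambda>t. frechet_derivative h (at x) (t *\<^sub>R axis i 1))) (at 0)"
  proof -
    have a: "((\<lambda>t::real. x + t *\<^sub>R axis i 1) has_derivative (\<lambda>t. t *\<^sub>R axis i 1)) (at 0)"
      by (auto intro!: derivative_eq_intros)
    show ?thesis
      using diff_chain_at[OF a, of h "frechet_derivative h (at x)"] d by (simp add: o_def)
  qed
  moreover have "frechet_derivative h (at x) (t *\<^sub>R axis i 1) = frechet_derivative h (at x) (axis i 1) * t" for t
    using has_derivative_linear[OF d] by (simp add: linear_cmul)
  ultimately have e: "((\<lambda>t. h (x + t *\<^sub>R axis i 1)) has_real_derivative frechet_derivative h (at x) (axis i 1)) (at 0)"
    by (simp add: has_field_derivative_def)
  show "pd i h x = frechet_derivative h (at x) (axis i 1)"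
    unfolding pd_def using e by (rule DERIV_imp_deriv)
  then show "((\<lambda>t. h (x + t *\<^sub>R axis i 1)) has_real_derivative pd i h x) (at 0)"
    using e by simp
qed

lemma pd_eqI:
  assumes "((\<lambda>t. h (x + t *\<^sub>R axis i 1)) has_real_derivative d) (at 0)"
  shows "pd i h x = d"
  unfolding pd_def using assms by (rule DERIV_imp_deriv)

lemma pd_eq_has_derivative:
  assumes "(h has_derivative h') (at x)"
  shows "pd i h x = h' (axis i 1)"
proof -
  have "h differentiable (at x)" using assms differentiable_def by blast
  then show ?thesis
    using pd_has_real_derivative(2)[of h x i] frechet_derivative_at[OF assms] by simp
qed

lemma pd_const [simp]: "pd i (\<lambda>x. c) = (\<lambda>x. 0)"
  by (auto simp: fun_eq_iff intro!: pd_eqI derivative_eq_intros)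

lemma pd_add:
  assumes "u differentiable (at x)" "v differentiable (at x)"
  shows "pd i (\<lambda>x. u x + v x) x = pd i u x + pd i v x"
  by (rule pd_eqI) (auto intro!: derivative_eq_intros pd_has_real_derivative assms)

lemma pd_diff:
  assumes "u differentiable (at x)" "v differentiable (at x)"
  shows "pd i (\<lambda>x. u x - v x) x = pd i u x - pd i v x"
  by (rule pd_eqI) (auto intro!: derivative_eq_intros pd_has_real_derivative assms)

lemma pd_mult:
  assumes "u differentiable (at x)" "v differentiable (at x)"
  shows "pd i (\<lambda>x. u x * v x) x = pd i u x * v x + u x * pd i v x"
  by (rule pd_eqI) (auto intro!: derivative_eq_intros pd_has_real_derivative assms)

lemma pd_cmult:
  assumes "u differentiable (at x)"
  shows "pd i (\<lambda>x. c * u x) x = c * pd i u x"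
  by (rule pd_eqI) (auto intro!: derivative_eq_intros pd_has_real_derivative assms)

lemma pd_inverse:
  assumes "u differentiable (at x)" "u x \<noteq> 0"
  shows "pd i (\<lambda>x. inverse (u x)) x = - (pd i u x * (inverse (u x) * inverse (u x)))"
  by (rule pd_eqI)
    (auto intro!: derivative_eq_intros pd_has_real_derivative assms simp: assms algebra_simps)

lemma pd_sum:
  assumes "finite A" "\<And>a. a \<in> A \<Longrightarrow> u a differentiable (at x)"
  shows "pd i (\<lambda>x. \<Sum>a\<in>A. u a x) x = (\<Sum>a\<in>A. pd i (u a) x)"
  by (rule pd_eqI) (auto intro!: derivative_eq_intros pd_has_real_derivative assms)

text \<open>Finite orders give an induction for products and reciprocals. Each level strips the
  innermost derivative, whereas \<open>pds\<close> adds the outermost one; a single product or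
  quotient rule then suffices per level, with no Leibniz sum over lists.\<close>

primrec diffk :: "nat \<Rightarrow> (real^'n::finite \<Rightarrow> real) \<Rightarrow> bool" where
  "diffk 0 h \<longleftrightarrow> (\<forall>x. h differentiable (at x))"
| "diffk (Suc k) h \<longleftrightarrow> (\<forall>x. h differentiable (at x)) \<and> (\<forall>i. diffk k (pd i h))"

lemma diffk_differentiable: "diffk k h \<Longrightarrow> h differentiable (at x)"
  by (cases k) auto

lemma diffk_mono: "diffk (Suc k) h \<Longrightarrow> diffk k h"
  by (induction k arbitrary: h) auto

lemma pds_append: "pds (xs @ ys) h = pds xs (pds ys h)"
  by (induction xs) auto

lemma diffk_iff_pds: "diffk k h \<longleftrightarrow> (\<forall>xs x. length xs \<le> k \<longrightarrow> pds xs h differentiable (at x))"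
proof (induction k arbitrary: h)
  case (Suc k)
  have "(\<forall>xs x. length xs \<le> Suc k \<longrightarrow> pds xs h differentiable (at x)) \<longleftrightarrow>
     (\<forall>x. h differentiable (at x)) \<and>
     (\<forall>i xs x. length xs \<le> k \<longrightarrow> pds xs (pd i h) differentiable (at x))" (is "?L \<longleftrightarrow> ?R")
  proof
    assume L: ?L
    have "pds xs (pd i h) differentiable (at x)" if "length xs \<le> k" for i xs x
      using L[rule_format, of "xs @ [i]" x] that by (simp add: pds_append)
    then show ?R using L[rule_format, of "[]"] by auto
  next
    assume R: ?R
    have "pds xs h differentiable (at x)" if "length xs \<le> Suc k" for xs x
    proof (cases xs rule: rev_cases)
      case (snoc ys y)
      then show ?thesis using R that by (simp add: pds_append)
    qed (use R in auto)
    then show ?L by blast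
  qed
  then show ?case by (simp add: Suc)
qed auto

lemma smooth_fun_iff_diffk: "smooth_fun h \<longleftrightarrow> (\<forall>k. diffk k h)"
  unfolding smooth_fun_def diffk_iff_pds by blast

lemma smooth_fun_differentiable: "smooth_fun h \<Longrightarrow> h differentiable (at x)"
  unfolding smooth_fun_iff_diffk using diffk_differentiable by blast

lemma smooth_fun_pd: "smooth_fun h \<Longrightarrow> smooth_fun (pd i h)"
  unfolding smooth_fun_iff_diffk using diffk.simps(2) by blast

lemma smooth_fun_continuous_on: "smooth_fun h \<Longrightarrow> continuous_on S h"
  by (meson continuous_at_imp_continuous_on differentiable_imp_continuous_within smooth_fun_differentiable)

lemma diffk_const: "diffk k (\<lambda>x. c)"
  by (induction k arbitrary: c) auto

lemma diffk_add: "diffk k u \<Longrightarrow> diffk k v \<Longrightarrow> diffk k (\<lambda>x. u x + v x)"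
proof (induction k arbitrary: u v)
  case (Suc k)
  have "pd i (\<lambda>x. u x + v x) = (\<lambda>x. pd i u x + pd i v x)" for i
    using Suc.prems by (auto simp: fun_eq_iff intro!: pd_add)
  then show ?case using Suc by (auto intro!: derivative_intros)
qed (auto intro!: derivative_intros)

lemma diffk_mult: "diffk k u \<Longrightarrow> diffk k v \<Longrightarrow> diffk k (\<lambda>x. u x * v x)"
proof (induction k arbitrary: u v)
  case (Suc k)
  have "pd i (\<lambda>x. u x * v x) = (\<lambda>x. pd i u x * v x + u x * pd i v x)" for i
    using Suc.prems by (auto simp: fun_eq_iff intro!: pd_mult)
  then show ?case
    using Suc.prems diffk_mono[OF Suc.prems(1)] diffk_mono[OF Suc.prems(2)]
    by (auto intro!: derivative_intros diffk_add Suc.IH)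
qed (auto intro!: derivative_intros)

lemma diffk_minus: "diffk k u \<Longrightarrow> diffk k (\<lambda>x. - u x)"
  using diffk_mult[OF diffk_const[of k "-1"], of u] by simp

lemma diffk_inverse:
  assumes nz: "\<And>x. u x \<noteq> 0"
  shows "diffk k u \<Longrightarrow> diffk k (\<lambda>x. inverse (u x))"
proof (induction k)
  case (Suc k)
  have "pd i (\<lambda>x. inverse (u x)) = (\<lambda>x. - (pd i u x * (inverse (u x) * inverse (u x))))" for i
    using Suc.prems nz by (auto simp: fun_eq_iff pd_inverse)
  then show ?case
    using Suc.prems Suc.IH[OF diffk_mono[OF Suc.prems]] nz
    by (auto intro!: derivative_intros diffk_mult diffk_minus)
qed (auto intro!: derivative_intros nz)

section \<open>Closure properties of smooth functions\<close>

named_theorems smooth_intros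

lemma smooth_fun_const [smooth_intros]: "smooth_fun (\<lambda>x. c)"
  by (simp add: smooth_fun_iff_diffk diffk_const)

lemma smooth_fun_add [smooth_intros]: "smooth_fun u \<Longrightarrow> smooth_fun v \<Longrightarrow> smooth_fun (\<lambda>x. u x + v x)"
  by (simp add: smooth_fun_iff_diffk diffk_add)

lemma smooth_fun_mult [smooth_intros]: "smooth_fun u \<Longrightarrow> smooth_fun v \<Longrightarrow> smooth_fun (\<lambda>x. u x * v x)"
  by (simp add: smooth_fun_iff_diffk diffk_mult)

lemma smooth_fun_inverse: "smooth_fun u \<Longrightarrow> (\<And>x. u x \<noteq> 0) \<Longrightarrow> smooth_fun (\<lambda>x. inverse (u x))"
  by (simp add: smooth_fun_iff_diffk diffk_inverse)

lemma smooth_fun_minus [smooth_intros]: "smooth_fun u \<Longrightarrow> smooth_fun (\<lambda>x. - u x)"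
  using smooth_fun_mult[OF smooth_fun_const[of "-1"], of u] by simp

lemma smooth_fun_diff [smooth_intros]: "smooth_fun u \<Longrightarrow> smooth_fun v \<Longrightarrow> smooth_fun (\<lambda>x. u x - v x)"
  using smooth_fun_add[OF _ smooth_fun_minus[of v], of u] by simp

lemma smooth_fun_sum [smooth_intros]:
  "(\<And>a. a \<in> A \<Longrightarrow> smooth_fun (u a)) \<Longrightarrow> smooth_fun (\<lambda>x. \<Sum>a\<in>A. u a x)"
  by (induction A rule: infinite_finite_induct) (auto intro!: smooth_intros)

lemma smooth_fun_prod [smooth_intros]:
  "(\<And>a. a \<in> A \<Longrightarrow> smooth_fun (u a)) \<Longrightarrow> smooth_fun (\<lambda>x. \<Prod>a\<in>A. u a x)"
  by (induction A rule: infinite_finite_induct) (auto intro!: smooth_intros)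

lemma smooth_fun_det:
  fixes M :: "real^'n::finite \<Rightarrow> real^'k::finite^'k"
  assumes "\<And>i j. smooth_fun (\<lambda>x. M x $ i $ j)"
  shows "smooth_fun (\<lambda>x. det (M x))"
  unfolding det_def by (intro smooth_intros assms)

text \<open>Cramer's rule writes each entry of the inverse as a determinant times a reciprocal,
  which reduces smoothness of \<open>matrix_inv\<close> to the rules for sums, products and
  reciprocals.\<close>

lemma matrix_inv_component_cramer:
  fixes M :: "real^'k::finite^'k"
  assumes "invertible M"
  shows "matrix_inv M $ i $ j =
    det (\<chi> r c. if c = i then (if r = j then 1 else 0) else M $ r $ c) * inverse (det M)"
proof -
  have d: "det M \<noteq> 0" using assms invertible_det_nz by blast
  have "M ** matrix_inv M = mat 1" using someI_ex[OF assms[unfolded invertible_def]]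
    by (simp add: matrix_inv_def)
  moreover have "M *v (column j (matrix_inv M)) = column j (M ** matrix_inv M)"
    by (simp add: vec_eq_iff column_def matrix_vector_mult_def matrix_matrix_mult_def)
  ultimately have "M *v (column j (matrix_inv M)) = axis j 1"
    by (simp add: column_def mat_def axis_def vec_eq_iff)
  then have "column j (matrix_inv M) = (\<chi> k. det (\<chi> r c. if c = k then axis j 1 $ r else M $ r $ c) / det M)"
    using cramer[OF d] by blast
  then have "matrix_inv M $ i $ j = det (\<chi> r c. if c = i then axis j 1 $ r else M $ r $ c) / det M"
    by (simp add: column_def vec_eq_iff)
  then show ?thesis by (simp add: axis_def divide_inverse cong: if_cong)
qed

lemma smooth_fun_matrix_inv:
  fixes M :: "real^'n::finite \<Rightarrow> real^'k::finite^'k"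
  assumes s: "\<And>i j. smooth_fun (\<lambda>x. M x $ i $ j)" and inv: "\<And>x. invertible (M x)"
  shows "smooth_fun (\<lambda>x. matrix_inv (M x) $ i $ j)"
proof -
  have "smooth_fun (\<lambda>x. det (\<chi> r c. if c = i then (if r = j then 1 else 0) else M x $ r $ c))"
  proof (rule smooth_fun_det)
    fix r c
    show "smooth_fun (\<lambda>x. (\<chi> r c. if c = i then (if r = j then 1 else 0) else M x $ r $ c) $ r $ c)"
      by (cases "c = i") (simp_all add: smooth_intros s)
  qed
  moreover have "smooth_fun (\<lambda>x. inverse (det (M x)))"
    using inv invertible_det_nz by (intro smooth_fun_inverse smooth_fun_det s) blast
  ultimately show ?thesis
    unfolding matrix_inv_component_cramer[OF inv] by (rule smooth_fun_mult)
qed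

section \<open>Symmetry of second partial derivatives\<close>

lemma DERIV_along_axis:
  assumes "\<And>y. h differentiable (at y)"
  shows "((\<lambda>t. h (x + t *\<^sub>R axis i 1)) has_real_derivative pd i h (x + s *\<^sub>R axis i 1)) (at s)"
proof -
  have "((\<lambda>t. h ((x + s *\<^sub>R axis i 1) + t *\<^sub>R axis i 1)) has_real_derivative pd i h (x + s *\<^sub>R axis i 1)) (at 0)"
    using pd_has_real_derivative(1) assms by blast
  then have "((\<lambda>t. h (x + (t + s) *\<^sub>R axis i 1)) has_real_derivative pd i h (x + s *\<^sub>R axis i 1)) (at 0)"
    by (simp add: algebra_simps)
  then show ?thesis
    using DERIV_shift[of "\<lambda>t. h (x + t *\<^sub>R axis i 1)" _ 0 s] by simp
qed

text \<open>Two applications of the mean value theorem. The double difference on the left is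
  symmetric in \<open>i\<close> and \<open>j\<close>, while the derivative on the right is taken in
  a fixed order; letting \<open>s\<close> tend to 0 in both orders gives
  \<open>pd_commute\<close>.\<close>

lemma second_difference_mean_value:
  fixes h :: "real^'n::finite \<Rightarrow> real"
  assumes h: "\<And>y. h differentiable (at y)" and hi: "\<And>y. pd i h differentiable (at y)" and s: "s > 0"
  shows "\<exists>y. dist y x \<le> 2 * s \<and>
    h (x + s *\<^sub>R axis i 1 + s *\<^sub>R axis j 1) - h (x + s *\<^sub>R axis i 1) - h (x + s *\<^sub>R axis j 1) + h x
      = s * s * pd j (pd i h) y"
proof -
  let ?u = "\<lambda>t. h (x + s *\<^sub>R axis j 1 + t *\<^sub>R axis i 1) - h (x + t *\<^sub>R axis i 1)"
  let ?u' = "\<lambda>t. pd i h (x + s *\<^sub>R axis j 1 + t *\<^sub>R axis i 1) - pd i h (x + t *\<^sub>R axis i 1)"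
  have "\<And>t. (?u has_real_derivative ?u' t) (at t)"
    by (intro derivative_intros DERIV_along_axis h)
  then obtain a where a: "0 < a" "a < s" "?u s - ?u 0 = (s - 0) * ?u' a"
    using MVT2[of 0 s ?u ?u'] s by blast
  let ?w = "\<lambda>t. pd i h ((x + a *\<^sub>R axis i 1) + t *\<^sub>R axis j 1)"
  let ?w' = "\<lambda>t. pd j (pd i h) ((x + a *\<^sub>R axis i 1) + t *\<^sub>R axis j 1)"
  have "\<And>t. (?w has_real_derivative ?w' t) (at t)"
    by (intro DERIV_along_axis hi)
  then obtain b where b: "0 < b" "b < s" "?w s - ?w 0 = (s - 0) * ?w' b"
    using MVT2[of 0 s ?w ?w'] s by blast
  let ?y = "(x + a *\<^sub>R axis i 1) + b *\<^sub>R axis j 1"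
  have "dist ?y x = norm (a *\<^sub>R axis i 1 + b *\<^sub>R axis j (1::real) :: real^'n)"
    by (simp add: dist_norm algebra_simps)
  also have "\<dots> \<le> a + b"
    using norm_triangle_ineq[of "a *\<^sub>R axis i 1 :: real^'n" "b *\<^sub>R axis j 1"] a b by simp
  finally have "dist ?y x \<le> 2 * s" using a b by linarith
  moreover have "?u' a = ?w s - ?w 0" by (simp add: algebra_simps)
  then have "?u s - ?u 0 = s * s * pd j (pd i h) ?y" using a(3) b(3) by simp
  ultimately show ?thesis
    by (intro exI[of _ ?y]) (simp add: algebra_simps)
qed

lemma pd_commute:
  assumes h: "smooth_fun h"
  shows "pd i (pd j h) = pd j (pd i h)"
proof
  fix x
  have lim: "((\<lambda>n. (h (x + s n *\<^sub>R axis i 1 + s n *\<^sub>R axis j 1) - h (x + s n *\<^sub>R axis i 1)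
       - h (x + s n *\<^sub>R axis j 1) + h x) / (s n * s n)) \<longlonglongrightarrow> pd j (pd i h) x)"
    if s: "s \<longlonglongrightarrow> 0" and pos: "\<And>n. s n > 0" for s :: "nat \<Rightarrow> real" and i j
  proof -
    have "\<exists>y. dist y x \<le> 2 * s n \<and>
      h (x + s n *\<^sub>R axis i 1 + s n *\<^sub>R axis j 1) - h (x + s n *\<^sub>R axis i 1)
       - h (x + s n *\<^sub>R axis j 1) + h x = s n * s n * pd j (pd i h) y" for n
      by (intro second_difference_mean_value smooth_fun_differentiable smooth_fun_pd h pos)
    then obtain y where y: "\<And>n. dist (y n) x \<le> 2 * s n"
      "\<And>n. h (x + s n *\<^sub>R axis i 1 + s n *\<^sub>R axis j 1) - h (x + s n *\<^sub>R axis i 1)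
       - h (x + s n *\<^sub>R axis j 1) + h x = s n * s n * pd j (pd i h) (y n)"
      by metis
    have "(\<lambda>n. dist (y n) x) \<longlonglongrightarrow> 0"
    proof (rule tendsto_sandwich[of "\<lambda>_. 0" _ _ "\<lambda>n. 2 * s n"])
      show "(\<lambda>n. 2 * s n) \<longlonglongrightarrow> 0" using tendsto_mult_right_zero[OF s] by blast
    qed (use y(1) in \<open>auto intro: always_eventually\<close>)
    then have "y \<longlonglongrightarrow> x" using tendsto_dist_iff by blast
    moreover have "isCont (pd j (pd i h)) x"
      by (intro differentiable_imp_continuous_within smooth_fun_differentiable smooth_fun_pd h)
    ultimately have "(\<lambda>n. pd j (pd i h) (y n)) \<longlonglongrightarrow> pd j (pd i h) x"
      by (simp add: isCont_tendsto_compose)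
    then show ?thesis using y(2) pos by (simp add: less_imp_neq[symmetric])
  qed
  let ?s = "\<lambda>n. inverse (real (Suc n))"
  have "?s \<longlonglongrightarrow> 0" using LIMSEQ_inverse_real_of_nat .
  then show "pd i (pd j h) x = pd j (pd i h) x"
    using lim[of ?s i j] lim[of ?s j i] by (intro LIMSEQ_unique[of _ _ _]) (auto simp: algebra_simps)
qed

section \<open>The divergence theorem on balls\<close>

lemma lborel_integral_affine:
  fixes f :: "'a::euclidean_space \<Rightarrow> real"
  assumes f [measurable]: "f \<in> borel_measurable borel" and c: "c \<noteq> 0"
  shows "integral\<^sup>L lborel f = \<bar>c\<bar> ^ DIM('a) * integral\<^sup>L lborel (\<lambda>x. f (t + c *\<^sub>R x))"
proof -
  have "integral\<^sup>L lborel f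
      = integral\<^sup>L (density (distr lborel borel (\<lambda>x. t + c *\<^sub>R x)) (\<lambda>_. ennreal (\<bar>c\<bar> ^ DIM('a)))) f"
    using lborel_affine[OF c, of t] by simp
  also have "\<dots> = integral\<^sup>L (distr lborel borel (\<lambda>x. t + c *\<^sub>R x)) (\<lambda>x. \<bar>c\<bar> ^ DIM('a) *\<^sub>R f x)"
    by (rule integral_density) auto
  also have "\<dots> = \<bar>c\<bar> ^ DIM('a) * integral\<^sup>L lborel (\<lambda>x. f (t + c *\<^sub>R x))"
    by (subst integral_distr) auto
  finally show ?thesis .
qed

lemma set_integrable_lborel_bounded:
  fixes f :: "'a::euclidean_space \<Rightarrow> real"
  assumes [measurable]: "f \<in> borel_measurable borel" and S [measurable]: "S \<in> sets borel"
    and "bounded S" and B: "\<And>x. x \<in> S \<Longrightarrow> \<bar>f x\<bar> \<le> B"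
  shows "set_integrable lborel S f"
proof -
  have "emeasure lborel S < \<infinity>" using \<open>bounded S\<close> by (rule emeasure_bounded_finite)
  then have "integrable lborel (\<lambda>x. indicator S x *\<^sub>R B)"
    by simp
  then show ?thesis
    unfolding set_integrable_def
  proof (rule Bochner_Integration.integrable_bound)
    show "AE x in lborel. norm (indicat_real S x *\<^sub>R f x) \<le> norm (indicat_real S x *\<^sub>R B)"
      using B by (intro AE_I2) (force simp: indicator_def)
  qed measurable
qed

lemma set_integrable_lborel_imp_integrable_on:
  fixes f :: "'a::euclidean_space \<Rightarrow> real"
  assumes "set_integrable lborel S f"
  shows "f absolutely_integrable_on S" "integral S f = (LINT x:S|lborel. f x)"
proof -
  show "f absolutely_integrable_on S"
    using assms integrable_completion[of "\<lambda>x. indicator S x *\<^sub>R f x" lborel]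
    by (simp add: set_integrable_def borel_measurable_integrable)
  show "integral S f = (LINT x:S|lborel. f x)"
    using set_borel_integral_eq_integral(2)[OF assms] by simp
qed

text \<open>Scaling by \<open>r\<close> maps the unit ball onto \<open>ball 0 r\<close> and leaves
  \<open>K\<close> fixed, so all dependence on \<open>r\<close> sits in the volume factor.\<close>

lemma integral_ball_homogeneous:
  fixes K :: "'a::euclidean_space \<Rightarrow> real"
  assumes K [measurable]: "K \<in> borel_measurable borel" and B: "\<And>x. \<bar>K x\<bar> \<le> B"
    and hom: "\<And>c x. c > 0 \<Longrightarrow> K (c *\<^sub>R x) = K x" and r: "r > 0"
  shows "integral (ball 0 r) K = r ^ DIM('a) * integral (ball 0 1) K"
proof -
  have int: "integral (ball 0 s) K = (LINT x|lborel. indicator (ball 0 s) x * K x)" for s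
    using set_integrable_lborel_imp_integrable_on(2)[OF set_integrable_lborel_bounded[of K "ball 0 s" B]] B
    by (simp add: set_lebesgue_integral_def)
  have m: "(\<lambda>x. indicator (ball 0 r) x * K x) \<in> borel_measurable borel"
    by (intro borel_measurable_times borel_measurable_indicator K) auto
  have "integral (ball 0 r) K = r ^ DIM('a) * (LINT x|lborel. indicator (ball 0 r) (0 + r *\<^sub>R x) * K (0 + r *\<^sub>R x))"
    unfolding int using lborel_integral_affine[OF m, of r 0] r by simp
  also have "(\<lambda>x::'a. indicator (ball 0 r) (0 + r *\<^sub>R x) * K (0 + r *\<^sub>R x)) = (\<lambda>x. indicator (ball 0 1) x * K x)"
    using r hom[OF r] by (auto simp: fun_eq_iff indicator_def)
  finally show ?thesis unfolding int .
qed

lemma continuous_absolutely_integrable_ball: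
  fixes H :: "'a::euclidean_space \<Rightarrow> real"
  assumes H: "continuous_on UNIV H"
  shows "H absolutely_integrable_on ball 0 r"
proof -
  have "compact (H ` cball 0 r)"
    by (intro compact_continuous_image continuous_on_subset[OF H] compact_cball) simp
  then have "bounded (H ` cball 0 r)" by (rule compact_imp_bounded)
  then obtain B where "\<And>x. x \<in> cball 0 r \<Longrightarrow> \<bar>H x\<bar> \<le> B"
    unfolding bounded_iff real_norm_def by blast
  then show ?thesis
    using H by (intro set_integrable_lborel_imp_integrable_on(1) set_integrable_lborel_bounded[of _ _ B])
      (auto intro: borel_measurable_continuous_onI)
qed

lemma integral_ball_diff_bound:
  fixes F :: "'a::euclidean_space \<Rightarrow> real"
  assumes int: "\<And>r. F absolutely_integrable_on ball 0 r" and ab: "0 \<le> a" "a \<le> b"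
    and bd: "\<And>x. x \<noteq> 0 \<Longrightarrow> a \<le> norm x \<Longrightarrow> norm x < b \<Longrightarrow> \<bar>F x\<bar> \<le> e" and e: "e \<ge> 0"
  shows "\<bar>integral (ball 0 b) F - integral (ball 0 a) F\<bar> \<le> e * (measure lborel (ball (0::'a) 1) * (b ^ DIM('a) - a ^ DIM('a)))"
proof -
  let ?S = "ball 0 b - ball 0 a :: 'a set"
  have sub: "ball 0 a \<subseteq> (ball 0 b :: 'a set)" using ab by auto
  have hb: "(g has_integral integral (ball 0 b) g - integral (ball 0 a) g) ?S"
    if "\<And>r. g absolutely_integrable_on ball 0 r" for g :: "'a \<Rightarrow> real"
    using that sub by (intro has_integral_setdiff) (auto simp: absolutely_integrable_on_def)
  have F: "(F has_integral integral (ball 0 b) F - integral (ball 0 a) F) ?S"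
    by (rule hb[OF int])
  have one: "integral (ball 0 r) (\<lambda>x::'a. e) = e * measure lborel (ball (0::'a) r)" for r
    using lmeasure_integral[of "ball 0 r :: 'a set"] integral_mult_right[of "ball 0 r :: 'a set" e "\<lambda>x. 1"]
    by simp
  have E: "((\<lambda>x. e) has_integral e * measure lborel (ball (0::'a) b) - e * measure lborel (ball (0::'a) a)) ?S"
    using hb[of "\<lambda>x. e"] continuous_absolutely_integrable_ball[of "\<lambda>x::'a. e"] by (simp add: one)
  have F0: "((\<lambda>x. if x = 0 then 0 else F x) has_integral integral (ball 0 b) F - integral (ball 0 a) F) ?S"
    by (rule has_integral_spike[OF _ _ F, of "{0}"]) auto
  have "norm (integral (ball 0 b) F - integral (ball 0 a) F) \<le> e * measure lborel (ball (0::'a) b) - e * measure lborel (ball (0::'a) a)"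
  proof -
    have "norm (if x = 0 then 0 else F x) \<le> e \<bullet> 1" if "x \<in> ?S" for x
      using that bd[of x] e by (cases "x = 0") auto
    then show ?thesis
      using has_integral_norm_bound_integral_component[OF F0 E, of 1] by simp
  qed
  then show ?thesis
    using ab by (simp add: content_ball_conv_unit_ball[of b] content_ball_conv_unit_ball[of a] algebra_simps)
qed

text \<open>Near the sphere of radius \<open>R\<close>, \<open>H\<close> is uniformly close to its extension \<open>K\<close> that is
  homogeneous of degree 0, for which the integral over the ball is a multiple of \<open>r\<^sup>n\<close>.\<close>
lemma DERIV_integral_ball:
  fixes H :: "real^'n::finite \<Rightarrow> real"
  assumes H: "continuous_on UNIV H" and R: "R > 0"
  shows "((\<lambda>r. integral (ball 0 r) H) has_real_derivative sphere_int R H) (at R)"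
proof -
  let ?n = "CARD('n)"
  let ?\<omega> = "measure lborel (ball (0::real^'n) 1)"
  define K where "K = (\<lambda>x. H ((R / norm x) *\<^sub>R x))"
  have Hm: "H \<in> borel_measurable borel"
    using H by (rule borel_measurable_continuous_onI)
  have K: "K \<in> borel_measurable borel" unfolding K_def
    by (rule measurable_compose[OF _ Hm]) measurable
  have nabla_D2: "continuous_on S H" for S by (rule continuous_on_subset[OF H]) simp
  have "bounded (H ` cball 0 R)"
    by (intro compact_imp_bounded compact_continuous_image nabla_D2 compact_cball)
  then obtain B where B: "\<And>x. x \<in> cball 0 R \<Longrightarrow> \<bar>H x\<bar> \<le> B"
    unfolding bounded_iff real_norm_def by blast
  have KB: "\<bar>K x\<bar> \<le> B" for x unfolding K_def using R by (intro B) auto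
  have hom: "K (c *\<^sub>R x) = K x" if "c > 0" for c x
    unfolding K_def using that by simp
  have Kint: "K absolutely_integrable_on ball 0 r" for r
    using KB K by (intro set_integrable_lborel_imp_integrable_on(1) set_integrable_lborel_bounded[of _ _ B]) auto
  have Hint: "H absolutely_integrable_on ball 0 r" for r
    by (rule continuous_absolutely_integrable_ball[OF H])
  define F where "F = (\<lambda>x. H x - K x)"
  have Fint: "F absolutely_integrable_on ball 0 r" for r
    unfolding F_def by (intro set_integral_diff Hint Kint)
  define W where "W = (\<lambda>r. integral (ball 0 r) F)"
  have near: "\<exists>d>0. d < R \<and> (\<forall>x. \<bar>norm x - R\<bar> < d \<longrightarrow> \<bar>F x\<bar> \<le> e)" if e: "e > 0" for e
  proof -
    have "uniformly_continuous_on (cball 0 (2 * R)) H"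
      by (intro compact_uniformly_continuous nabla_D2 compact_cball)
    then obtain d where d: "d > 0" "\<And>x y. \<lbrakk>x \<in> cball 0 (2*R); y \<in> cball 0 (2*R); dist x y < d\<rbrakk> \<Longrightarrow> dist (H x) (H y) < e"
      unfolding uniformly_continuous_on_def using e by (metis dist_commute)
    \<comment> \<open>The bound \<open>R/2\<close> keeps \<open>x\<close> off the origin and keeps
      both \<open>x\<close> and its radial projection inside \<open>cball 0 (2 * R)\<close>, where
      \<open>H\<close> is uniformly continuous.\<close>
    have "\<bar>F x\<bar> \<le> e" if x: "\<bar>norm x - R\<bar> < min d (R/2)" for x
    proof -
      have nx: "norm x > 0" using x R by linarith
      have nx2: "norm x \<le> 2 * R" using x R by linarith
      have "x - (R / norm x) *\<^sub>R x = ((norm x - R) / norm x) *\<^sub>R x"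
        using nx by (simp add: diff_divide_distrib scaleR_diff_left)
      then have "dist x ((R / norm x) *\<^sub>R x) = \<bar>norm x - R\<bar>"
        using nx by (simp add: dist_norm)
      then have "dist (H x) (H ((R / norm x) *\<^sub>R x)) < e"
        using x nx nx2 abs_of_pos[OF R] R by (intro d(2)) simp_all
      then show ?thesis unfolding F_def K_def by (simp add: dist_real_def)
    qed
    then show ?thesis using d R by (intro exI[of _ "min d (R/2)"]) auto
  qed
  have pow: "((\<lambda>r. r ^ ?n) has_real_derivative real ?n * R ^ (?n - 1)) (at R)"
    by (auto intro!: derivative_eq_intros)
  \<comment> \<open>\<open>L\<close> is a local Lipschitz constant at \<open>R\<close> for the
    volume of \<open>ball 0 r\<close>: the derivative of \<open>r ^ ?n\<close> is enlarged by 1 to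
    absorb the linearization error.\<close>
  define L where "L = ?\<omega> * (real ?n * R ^ (?n - 1) + 1)"
  have L0: "L > 0" unfolding L_def using R content_ball_pos[of 1 "0::real^'n"]
    by (intro mult_pos_pos add_nonneg_pos) auto
  \<comment> \<open>\<open>F\<close> vanishes on the sphere of radius \<open>R\<close>, so near it
    \<open>F\<close> is at most \<open>e / L\<close>, while the shell between the two radii has
    volume at most \<open>L * |y - R|\<close>.\<close>
  have W: "(W has_real_derivative 0) (at R)"
    unfolding has_field_derivative_def has_derivative_at_alt
  proof (intro conjI allI impI)
    fix e :: real assume e: "e > 0"
    then have eL: "e / L > 0" using L0 by simp
    obtain d where d: "d > 0" "d < R" "\<And>x. \<bar>norm x - R\<bar> < d \<Longrightarrow> \<bar>F x\<bar> \<le> e / L"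
      using near[OF eL] by blast
    obtain d' where d': "d' > 0" "\<And>y. \<bar>y - R\<bar> < d' \<Longrightarrow> \<bar>y ^ ?n - R ^ ?n - real ?n * R ^ (?n - 1) * (y - R)\<bar> \<le> 1 * \<bar>y - R\<bar>"
      using pow[unfolded has_field_derivative_def has_derivative_at_alt] zero_less_one
      by (metis real_norm_def)
    have step: "\<bar>W b - W a\<bar> \<le> e / L * (?\<omega> * (b ^ ?n - a ^ ?n))"
      if "0 \<le> a" "a \<le> b" "R - d < a" "b < R + d" for a b
    proof -
      have "\<bar>integral (ball 0 b) F - integral (ball 0 a) F\<bar>
          \<le> e / L * (?\<omega> * (b ^ DIM(real^'n) - a ^ DIM(real^'n)))"
        using that eL by (intro integral_ball_diff_bound Fint d(3)) auto
      then show ?thesis unfolding W_def by simp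
    qed
    have "norm (W y - W R - 0 * (y - R)) \<le> e * norm (y - R)" if y: "norm (y - R) < min d d'" for y
    proof -
      have "\<bar>W y - W R\<bar> \<le> e / L * (?\<omega> * \<bar>y ^ ?n - R ^ ?n\<bar>)"
      proof (cases "y \<le> R")
        case True
        then show ?thesis using step[of y R] y d R power_mono[of y R ?n] by (simp add: abs_minus_commute)
      next
        case False
        then show ?thesis using step[of R y] y d R power_mono[of R y ?n] by simp
      qed
      also have "\<dots> \<le> e / L * (?\<omega> * ((real ?n * R ^ (?n - 1) + 1) * \<bar>y - R\<bar>))"
      proof (intro mult_left_mono)
        have "\<bar>y ^ ?n - R ^ ?n\<bar> \<le> \<bar>real ?n * R ^ (?n - 1) * (y - R)\<bar> + 1 * \<bar>y - R\<bar>"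
          using d'(2)[of y] y by (smt (verit) real_norm_def)
        then show "\<bar>y ^ ?n - R ^ ?n\<bar> \<le> (real ?n * R ^ (?n - 1) + 1) * \<bar>y - R\<bar>"
          using R by (simp add: abs_mult distrib_right)
      qed (use eL in auto)
      also have "\<dots> = e / L * (L * \<bar>y - R\<bar>)" unfolding L_def by (simp only: mult.assoc)
      also have "\<dots> = e * \<bar>y - R\<bar>" using L0 by simp
      finally show ?thesis by simp
    qed
    then show "\<exists>d>0. \<forall>y. norm (y - R) < d \<longrightarrow> norm (W y - W R - 0 * (y - R)) \<le> e * norm (y - R)"
      using d d' by (intro exI[of _ "min d d'"]) auto
  qed (rule bounded_linear_mult_right)
  have "0 + real ?n * R ^ (?n - 1) * integral (ball 0 1) K = sphere_int R H"
    unfolding sphere_int_def K_def by simp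
  then have d0: "((\<lambda>r. W r + r ^ ?n * integral (ball 0 1) K) has_real_derivative sphere_int R H) (at R)"
    using DERIV_add[OF W DERIV_cmult_right[OF pow, of "integral (ball 0 1) K"]] by simp
  have eq: "W r + r ^ ?n * integral (ball 0 1) K = integral (ball 0 r) H" if "r > 0" for r
  proof -
    have "W r = integral (ball 0 r) H - integral (ball 0 r) K"
      unfolding W_def F_def using Hint[of r] Kint[of r]
      by (intro Henstock_Kurzweil_Integration.integral_diff) (auto simp: absolutely_integrable_on_def)
    then show ?thesis using integral_ball_homogeneous[OF K KB hom that] by simp
  qed
  show ?thesis
    by (rule has_field_derivative_transform_within_open[OF d0 open_greaterThan[of 0]]) (use R eq in auto)
qed

lemma sphere_int_cong:
  assumes "\<And>x. norm x = r \<Longrightarrow> g x = h x" "r \<ge> 0"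
  shows "sphere_int r g = sphere_int r h"
proof -
  have "integral (ball 0 1) (\<lambda>y. g ((r / norm y) *\<^sub>R y)) = integral (ball 0 1) (\<lambda>y. h ((r / norm y) *\<^sub>R y))"
    by (rule integral_spike[of "{0}"]) (use assms in auto)
  then show ?thesis unfolding sphere_int_def by simp
qed

lemma sphere_int_cmult: "sphere_int r (\<lambda>x. c * h x) = c * sphere_int r h"
  unfolding sphere_int_def by simp

text \<open>Difference quotients of \<open>w\<close> integrate to zero by translation invariance,
  and dominated convergence carries this over to the derivative, without any iterated
  integration.\<close>

lemma integral_pd_compact_support:
  fixes w :: "real^'n::finite \<Rightarrow> real"
  assumes diff: "\<And>x. w differentiable (at x)" and cont: "continuous_on UNIV (pd i w)"
    and supp: "\<And>x. norm x \<ge> R \<Longrightarrow> w x = 0"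
  shows "integral (ball 0 R) (pd i w) = 0"
proof -
  have wc: "continuous_on UNIV w"
    by (meson continuous_at_imp_continuous_on diff differentiable_imp_continuous_within)
  have [measurable]: "w \<in> borel_measurable borel" "pd i w \<in> borel_measurable borel"
    by (intro borel_measurable_continuous_onI wc cont)+
  have pd0: "pd i w x = 0" if "norm x > R" for x
  proof -
    have o: "open {x::real^'n. norm x > R}" by (intro open_Collect_less continuous_intros)
    have "(w has_derivative (\<lambda>_. 0)) (at x)"
      by (rule has_derivative_transform_within_open[of "\<lambda>_. 0" _ _ _ "{x. norm x > R}"])
        (use that supp o in auto)
    then show ?thesis using pd_eq_has_derivative by fastforce
  qed
  have "bounded (pd i w ` cball 0 R)"
    by (intro compact_imp_bounded compact_continuous_image continuous_on_subset[OF cont] compact_cball) simp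
  then obtain M0 where M0: "\<And>x. x \<in> cball 0 R \<Longrightarrow> \<bar>pd i w x\<bar> \<le> M0"
    unfolding bounded_iff real_norm_def by blast
  define M where "M = max 0 M0"
  have M: "\<bar>pd i w x\<bar> \<le> M" for x
    using M0[of x] pd0[of x] unfolding M_def by (cases "norm x \<le> R") auto
  have M_ge: "M \<ge> 0" unfolding M_def by simp
  \<comment> \<open>Step sizes of at most 1 confine the supports of all quotients \<open>q k\<close>
    to \<open>cball 0 (R + 1)\<close>, which provides the dominating function.\<close>
  define s where "s = (\<lambda>k. inverse (real (Suc k)))"
  have s: "0 < s k" "s k \<le> 1" for k unfolding s_def by (auto simp: field_simps)
  have s0: "s \<longlonglongrightarrow> 0" unfolding s_def using LIMSEQ_inverse_real_of_nat .
  define q where "q = (\<lambda>k x. (w (x + s k *\<^sub>R axis i 1) - w x) / s k)"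
  have [measurable]: "q k \<in> borel_measurable borel" for k unfolding q_def by measurable
  have qM: "\<bar>q k x\<bar> \<le> M" for k x
  proof -
    obtain z where "0 < z" "z < s k" "w (x + s k *\<^sub>R axis i 1) - w (x + 0 *\<^sub>R axis i 1) = (s k - 0) * pd i w (x + z *\<^sub>R axis i 1)"
      using MVT2[OF s(1)[of k], of "\<lambda>t. w (x + t *\<^sub>R axis i 1)" "\<lambda>t. pd i w (x + t *\<^sub>R axis i 1)"]
        DERIV_along_axis[OF diff] by blast
    then have "q k x = pd i w (x + z *\<^sub>R axis i 1)" unfolding q_def using s[of k] by simp
    then show ?thesis using M by simp
  qed
  have q0: "q k x = 0" if "norm x > R + 1" for k x
  proof -
    have "norm (s k *\<^sub>R axis i (1::real) :: real^'n) \<le> 1" using s[of k] by simp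
    then have "norm (x + s k *\<^sub>R axis i 1) \<ge> R"
      using that norm_triangle_ineq2[of x "- (s k *\<^sub>R axis i 1)"] by simp
    then show ?thesis unfolding q_def using supp that by simp
  qed
  have wint: "integrable lborel w"
  proof -
    have "set_integrable lborel (cball 0 R) w"
      using continuous_on_subset[OF wc] unfolding set_integrable_def
      by (intro borel_integrable_compact) auto
    moreover have "(\<lambda>x. indicator (cball 0 R) x *\<^sub>R w x) = w"
      using supp by (auto simp: fun_eq_iff indicator_def)
    ultimately show ?thesis unfolding set_integrable_def by simp
  qed
  have wint': "integrable lborel (\<lambda>x. w (x + t *\<^sub>R axis i 1))" for t
  proof -
    have "integrable (distr lborel borel (\<lambda>x. t *\<^sub>R axis i 1 + x)) w"
      using wint lborel_distr_plus[of "t *\<^sub>R axis i 1 :: real^'n"] by simp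
    then show ?thesis by (subst (asm) integrable_distr_eq) (auto simp: add.commute)
  qed
  have qint: "integral\<^sup>L lborel (q k) = 0" for k
  proof -
    have "integral\<^sup>L lborel (\<lambda>x. w (x + s k *\<^sub>R axis i 1)) = integral\<^sup>L lborel w"
      using lborel_integral_affine[of w 1 "s k *\<^sub>R axis i 1"] by (simp add: add.commute)
    then show ?thesis unfolding q_def using wint wint' by simp
  qed
  have "(\<lambda>k. integral\<^sup>L lborel (q k)) \<longlonglongrightarrow> integral\<^sup>L lborel (pd i w)"
  proof (rule integral_dominated_convergence)
    show "integrable lborel (\<lambda>x::real^'n. M * indicator (cball 0 (R + 1)) x)"
      using emeasure_bounded_finite[of "cball (0::real^'n) (R+1)"] by simp
    show "AE x in lborel. (\<lambda>k. q k x) \<longlonglongrightarrow> pd i w x"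
    proof (rule AE_I2)
      fix x
      have "((\<lambda>t. w (x + t *\<^sub>R axis i 1)) has_real_derivative pd i w x) (at 0)"
        by (rule pd_has_real_derivative(1)[OF diff])
      then have "(\<lambda>t. (w (x + t *\<^sub>R axis i 1) - w x) / t) \<midarrow>0\<rightarrow> pd i w x"
        by (simp add: DERIV_def)
      moreover have "filterlim s (at 0) sequentially"
        using s0 s(1) by (auto simp: filterlim_at less_imp_neq[symmetric])
      ultimately show "(\<lambda>k. q k x) \<longlonglongrightarrow> pd i w x"
        unfolding q_def by (rule filterlim_compose)
    qed
    show "AE x in lborel. norm (q k x) \<le> M * indicator (cball 0 (R + 1)) x" for k
      using qM q0 by (intro AE_I2) (auto simp: indicator_def)
  qed auto
  then have L0: "integral\<^sup>L lborel (pd i w) = 0" by (simp add: qint LIMSEQ_const_iff)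
  have si: "set_integrable lborel (cball 0 R) (pd i w)"
    using continuous_on_subset[OF cont] unfolding set_integrable_def
    by (intro borel_integrable_compact) auto
  have "integral (cball 0 R) (pd i w) = (LINT x:cball 0 R|lborel. pd i w x)"
    by (rule set_integrable_lborel_imp_integrable_on(2)[OF si])
  also have "\<dots> = integral\<^sup>L lborel (pd i w)"
    unfolding set_lebesgue_integral_def
    by (rule Bochner_Integration.integral_cong) (use pd0 in \<open>auto simp: indicator_def not_le\<close>)
  finally have "integral (cball 0 R) (pd i w) = 0" using L0 by simp
  moreover have "integral (ball 0 R) (pd i w) = integral (cball 0 R) (pd i w)"
  proof (rule integral_spike_set)
    have "{x \<in> cball 0 R - ball 0 R. pd i w x \<noteq> 0} \<subseteq> sphere (0::real^'n) R" by auto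
    then show "negligible {x \<in> cball 0 R - ball 0 R. pd i w x \<noteq> 0}"
      using negligible_sphere negligible_subset by blast
    have "{x \<in> ball 0 R - cball 0 R. pd i w x \<noteq> 0} = {}" by auto
    then show "negligible {x \<in> ball 0 R - cball 0 R. pd i w x \<noteq> 0}"
      by (simp only: negligible_empty)
  qed
  ultimately show ?thesis by simp
qed

text \<open>Squaring removes the kink of the positive part at 0. The resulting cutoff is once
  continuously differentiable, as \<open>integral_pd_compact_support\<close> asks.\<close>

lemma DERIV_pos_part_square: "((\<lambda>s::real. (max 0 s)\<^sup>2) has_real_derivative 2 * max 0 s) (at s)"
proof -
  consider "s > 0" | "s < 0" | "s = 0" by linarith
  then show ?thesis
  proof cases
    case 1
    have "((\<lambda>s::real. s\<^sup>2) has_real_derivative 2 * max 0 s) (at s)"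
      using 1 by (auto intro!: derivative_eq_intros)
    then show ?thesis
      by (rule has_field_derivative_transform_within_open[of _ _ _ "{0<..}"]) (use 1 in auto)
  next
    case 2
    have "((\<lambda>s::real. 0) has_real_derivative 2 * max 0 s) (at s)"
      using 2 by (auto intro!: derivative_eq_intros)
    then show ?thesis
      by (rule has_field_derivative_transform_within_open[of _ _ _ "{..<0}"]) (use 2 in auto)
  next
    case 3
    have "((\<lambda>h::real. (max 0 h)\<^sup>2 / h) \<longlongrightarrow> 0) (at 0)"
    proof (rule tendsto_rabs_zero_cancel, rule tendsto_sandwich[of "\<lambda>_. 0" _ _ "\<lambda>h. \<bar>h\<bar>"])
      show "\<forall>\<^sub>F h in at 0. \<bar>(max 0 h)\<^sup>2 / h\<bar> \<le> \<bar>h::real\<bar>"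
        by (intro always_eventually) (auto simp: max_def power2_eq_square)
    qed (auto intro!: tendsto_eq_intros)
    then show ?thesis using 3 by (simp add: DERIV_def)
  qed
qed

lemma integral_ball_cutoff_divergence:
  fixes F :: "'n::finite \<Rightarrow> real^'n \<Rightarrow> real"
  assumes F: "\<And>i. smooth_fun (F i)"
  shows "integral (ball 0 R) (\<lambda>x. (R\<^sup>2 - x \<bullet> x)\<^sup>2 * (\<Sum>i\<in>UNIV. pd i (F i) x)
      - 4 * (R\<^sup>2 - x \<bullet> x) * (\<Sum>i\<in>UNIV. x $ i * F i x)) = 0"
proof (cases "R > 0")
  case True
  define P where "P = (\<lambda>x::real^'n. max 0 (R\<^sup>2 - x \<bullet> x))"
  have Pd: "((\<lambda>x. (P x)\<^sup>2) has_derivative (\<lambda>v. 2 * P x * (- 2 * (x \<bullet> v)))) (at x)" for x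
  proof -
    have "((\<lambda>x::real^'n. R\<^sup>2 - x \<bullet> x) has_derivative (\<lambda>v. - 2 * (x \<bullet> v))) (at x)"
      by (auto intro!: derivative_eq_intros simp: inner_commute)
    from diff_chain_at[OF this DERIV_pos_part_square[unfolded has_field_derivative_def]]
    show ?thesis unfolding P_def by (simp add: o_def)
  qed
  have Pdiff: "(\<lambda>x. (P x)\<^sup>2) differentiable (at x)" for x using Pd differentiable_def by blast
  have Fdiff: "F i differentiable (at x)" for i x using F smooth_fun_differentiable by blast
  have Pc: "continuous_on S P" for S unfolding P_def by (intro continuous_intros)
  have Fc: "continuous_on S (F i)" "continuous_on S (pd i (F i))" for S i
    using F smooth_fun_continuous_on smooth_fun_pd by blast+
  have pdw: "pd i (\<lambda>x. (P x)\<^sup>2 * F i x) = (\<lambda>x. (P x)\<^sup>2 * pd i (F i) x - 4 * P x * (x $ i * F i x))" for i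
  proof
    fix x
    have "pd i (\<lambda>x. (P x)\<^sup>2) x = 2 * P x * (- 2 * x $ i)"
      using pd_eq_has_derivative[OF Pd, of i x] by (simp add: inner_axis)
    then show "pd i (\<lambda>x. (P x)\<^sup>2 * F i x) x = (P x)\<^sup>2 * pd i (F i) x - 4 * P x * (x $ i * F i x)"
      using pd_mult[OF Pdiff[of x] Fdiff[of i x], of i] by simp
  qed
  have zero: "integral (ball 0 R) (\<lambda>x. (P x)\<^sup>2 * pd i (F i) x - 4 * P x * (x $ i * F i x)) = 0" for i
    unfolding pdw[symmetric]
  proof (rule integral_pd_compact_support)
    show "(\<lambda>x. (P x)\<^sup>2 * F i x) differentiable (at x)" for x
      by (intro differentiable_mult Pdiff Fdiff)
    show "continuous_on UNIV (pd i (\<lambda>x. (P x)\<^sup>2 * F i x))"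
      unfolding pdw by (intro continuous_intros Pc Fc)
    show "(P x)\<^sup>2 * F i x = 0" if "norm x \<ge> R" for x
    proof -
      have "R\<^sup>2 \<le> x \<bullet> x" using that True by (metis power2_norm_eq_inner power_mono less_imp_le)
      then show ?thesis unfolding P_def by simp
    qed
  qed
  have z: "integral (ball 0 R) (\<lambda>x. \<Sum>i\<in>UNIV. ((P x)\<^sup>2 * pd i (F i) x - 4 * P x * (x $ i * F i x))) = 0"
  proof (subst integral_sum)
    fix i
    have "(\<lambda>x. (P x)\<^sup>2 * pd i (F i) x - 4 * P x * (x $ i * F i x)) absolutely_integrable_on ball 0 R"
      by (intro continuous_absolutely_integrable_ball continuous_intros Pc Fc)
    then show "(\<lambda>x. (P x)\<^sup>2 * pd i (F i) x - 4 * P x * (x $ i * F i x)) integrable_on ball 0 R"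
      by (simp add: absolutely_integrable_on_def)
  qed (use zero in auto)
  have eq: "(\<Sum>i\<in>UNIV. ((P x)\<^sup>2 * pd i (F i) x - 4 * P x * (x $ i * F i x)))
      = (R\<^sup>2 - x \<bullet> x)\<^sup>2 * (\<Sum>i\<in>UNIV. pd i (F i) x) - 4 * (R\<^sup>2 - x \<bullet> x) * (\<Sum>i\<in>UNIV. x $ i * F i x)"
    if "x \<in> ball 0 R" for x
  proof -
    have "x \<bullet> x \<le> R\<^sup>2" using that True
      by (metis less_imp_le mem_ball_0 norm_ge_zero power2_norm_eq_inner power_mono)
    then have "P x = R\<^sup>2 - x \<bullet> x" unfolding P_def by simp
    then show ?thesis by (simp add: sum_subtractf sum_distrib_left)
  qed
  show ?thesis
    by (rule trans[OF Henstock_Kurzweil_Integration.integral_cong z]) (rule eq[symmetric])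
next
  case False
  then have "ball 0 R = ({} :: (real^'n) set)" by simp
  then show ?thesis by (simp only: Henstock_Kurzweil_Integration.integral_empty)
qed

text \<open>Differentiating the identity \<open>integral_ball_cutoff_divergence\<close> twice with respect to \<open>R\<close>
  gives the divergence theorem; the cutoff vanishes to second order on the sphere, so that
  \<open>integral_pd_compact_support\<close> applies to it.\<close>
theorem divergence_theorem_ball:
  fixes F :: "'n::finite \<Rightarrow> real^'n \<Rightarrow> real"
  assumes F: "\<And>i. smooth_fun (F i)" and R: "R > 0"
  shows "sphere_int R (\<lambda>x. \<Sum>i\<in>UNIV. F i x * (x $ i / R)) = integral (ball 0 R) (\<lambda>x. \<Sum>i\<in>UNIV. pd i (F i) x)"
proof -
  define d e where "d = (\<lambda>x. \<Sum>i\<in>UNIV. pd i (F i) x)" and "e = (\<lambda>x. \<Sum>i\<in>UNIV. x $ i * F i x)"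
  have c: "continuous_on S d" "continuous_on S e" for S
  proof -
    have "continuous_on S (F i)" "continuous_on S (pd i (F i))" for i
      using F smooth_fun_continuous_on smooth_fun_pd by blast+
    then show "continuous_on S d" "continuous_on S e"
      unfolding d_def e_def by (auto intro!: continuous_intros)
  qed
  define V where "V = (\<lambda>h r. integral (ball 0 r) (h :: real^'n \<Rightarrow> real))"
  let ?N = "\<lambda>x::real^'n. x \<bullet> x"
  have Vint: "h integrable_on ball 0 r" if "continuous_on UNIV h" for h :: "real^'n \<Rightarrow> real" and r
    using continuous_absolutely_integrable_ball[OF that] by (simp add: absolutely_integrable_on_def)
  have sN: "sphere_int r (\<lambda>x. ?N x * h x) = r\<^sup>2 * sphere_int r h" if "r > 0" for r and h :: "real^'n \<Rightarrow> real"
    unfolding sphere_int_cmult[symmetric] using that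
    by (intro sphere_int_cong) (auto simp: power2_norm_eq_inner[symmetric])
  have sNN: "sphere_int r (\<lambda>x. ?N x * (?N x * h x)) = r^4 * sphere_int r h" if "r > 0" for r and h :: "real^'n \<Rightarrow> real"
    using sN[OF that, of h] sN[OF that, of "\<lambda>x. ?N x * h x"] by (simp add: power2_eq_square power4_eq_xxxx)
  have D: "(V h has_real_derivative sphere_int r h) (at r)" if "continuous_on UNIV h" "r > 0" for h r
    unfolding V_def by (rule DERIV_integral_ball[OF that])
  \<comment> \<open>Expanding the square takes every power of \<open>r\<close> out of the integrals
    and leaves ball integrals of fixed functions, to which \<open>D\<close> applies.\<close>
  have eq1: "r^4 * V d r - 2 * r\<^sup>2 * V (\<lambda>x. ?N x * d x) r + V (\<lambda>x. ?N x * (?N x * d x)) r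
      - 4 * r\<^sup>2 * V e r + 4 * V (\<lambda>x. ?N x * e x) r = 0" (is "?E r = 0") for r
  proof -
    have "0 = integral (ball 0 r) (\<lambda>x. (r\<^sup>2 - ?N x)\<^sup>2 * d x - 4 * (r\<^sup>2 - ?N x) * e x)"
      using integral_ball_cutoff_divergence[of F r, OF F] unfolding d_def e_def by simp
    also have "(\<lambda>x. (r\<^sup>2 - ?N x)\<^sup>2 * d x - 4 * (r\<^sup>2 - ?N x) * e x)
        = (\<lambda>x. r^4 * d x - 2 * r\<^sup>2 * (?N x * d x) + ?N x * (?N x * d x) - 4 * r\<^sup>2 * e x + 4 * (?N x * e x))"
      by (simp add: fun_eq_iff power2_eq_square power4_eq_xxxx algebra_simps)
    also have "integral (ball 0 r) \<dots> = ?E r"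
      unfolding V_def
      by (simp add: Henstock_Kurzweil_Integration.integral_add Henstock_Kurzweil_Integration.integral_diff
          Vint c continuous_intros)
    finally show ?thesis by simp
  qed
  \<comment> \<open>On the sphere \<open>x \<bullet> x\<close> equals \<open>r^2\<close>, so all
    boundary terms of the first derivative cancel and \<open>4 * r * ?G r\<close> remains.\<close>
  have eq2: "r\<^sup>2 * V d r - V (\<lambda>x. ?N x * d x) r - 2 * V e r = 0" (is "?G r = 0") if r: "r > 0" for r
  proof -
    have "(?E has_real_derivative 4 * r^3 * V d r + r^4 * sphere_int r d
        - (4 * r * V (\<lambda>x. ?N x * d x) r + 2 * r\<^sup>2 * (r\<^sup>2 * sphere_int r d)) + r^4 * sphere_int r d
        - (8 * r * V e r + 4 * r\<^sup>2 * sphere_int r e) + 4 * (r\<^sup>2 * sphere_int r e)) (at r)"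
      by (auto intro!: derivative_eq_intros D c continuous_intros simp: r sN sNN)
    moreover have "(?E has_real_derivative 0) (at r)" using eq1 by simp
    ultimately have "4 * r^3 * V d r + r^4 * sphere_int r d
        - (4 * r * V (\<lambda>x. ?N x * d x) r + 2 * r\<^sup>2 * (r\<^sup>2 * sphere_int r d)) + r^4 * sphere_int r d
        - (8 * r * V e r + 4 * r\<^sup>2 * sphere_int r e) + 4 * (r\<^sup>2 * sphere_int r e) = 0"
      by (rule DERIV_unique)
    then have "4 * r * ?G r = 0" by (simp add: algebra_simps power2_eq_square power3_eq_cube power4_eq_xxxx)
    then show ?thesis using r by simp
  qed
  \<comment> \<open>In the second differentiation the boundary terms in \<open>d\<close> cancel
    again, but the one in \<open>e\<close> survives; up to the factor \<open>R\<close> it is the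
    flux.\<close>
  have "(?G has_real_derivative 2 * R * V d R + R\<^sup>2 * sphere_int R d - R\<^sup>2 * sphere_int R d - 2 * sphere_int R e) (at R)"
    by (auto intro!: derivative_eq_intros D c continuous_intros simp: R sN)
  moreover have "(?G has_real_derivative 0) (at R)"
    by (rule has_field_derivative_transform_within_open[of "\<lambda>_. 0" _ _ "{0<..}"]) (use R eq2 in auto)
  ultimately have "2 * R * V d R - 2 * sphere_int R e = 0"
    using DERIV_unique by fastforce
  then have "V d R = inverse R * sphere_int R e" using R by (simp add: field_simps)
  also have "\<dots> = sphere_int R (\<lambda>x. \<Sum>i\<in>UNIV. F i x * (x $ i / R))"
    unfolding sphere_int_cmult[symmetric] e_def by (simp add: sum_distrib_left field_simps)
  finally show ?thesis unfolding V_def d_def by simp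
qed

section \<open>The Gauss and Bianchi identities of a graph\<close>

text \<open>Index raising is treated as an operator on one slot, with \<open>up2\<close> and
  \<open>up4\<close> as iterates. Its interaction with differentiation then has to be established
  for a single slot only (\<open>pd_up\<close>).\<close>

definition up :: "('n::finite \<Rightarrow> 'n \<Rightarrow> real) \<Rightarrow> ('n \<Rightarrow> real) \<Rightarrow> 'n \<Rightarrow> real" where
  "up G X i = (\<Sum>a\<in>UNIV. G i a * X a)"

definition up2 :: "('n::finite \<Rightarrow> 'n \<Rightarrow> real) \<Rightarrow> ('n \<Rightarrow> 'n \<Rightarrow> real) \<Rightarrow> 'n \<Rightarrow> 'n \<Rightarrow> real" where
  "up2 G X i j = up G (\<lambda>a. up G (\<lambda>b. X a b) j) i"

definition up4 :: "('n::finite \<Rightarrow> 'n \<Rightarrow> real) \<Rightarrow> ('n \<Rightarrow> 'n \<Rightarrow> 'n \<Rightarrow> 'n \<Rightarrow> real)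
    \<Rightarrow> 'n \<Rightarrow> 'n \<Rightarrow> 'n \<Rightarrow> 'n \<Rightarrow> real" where
  "up4 G X i j k l = up G (\<lambda>a. up G (\<lambda>b. up G (\<lambda>c. up G (\<lambda>d. X a b c d) l) k) j) i"

definition trg :: "('n::finite \<Rightarrow> 'n \<Rightarrow> real) \<Rightarrow> ('n \<Rightarrow> 'n \<Rightarrow> real) \<Rightarrow> real" where
  "trg G X = (\<Sum>i\<in>UNIV. \<Sum>k\<in>UNIV. G i k * X i k)"

lemma trg_eq_up: "trg G X = (\<Sum>i\<in>UNIV. up G (X i) i)"
  unfolding trg_def up_def ..

lemma trg_transpose: "(\<And>i j. G i j = G j i) \<Longrightarrow> trg G (\<lambda>i j. X j i) = trg G X"
  unfolding trg_def by (subst sum.swap) simp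

lemma trg_swap: "trg G (\<lambda>a b. trg G' (\<lambda>c d. X a b c d)) = trg G' (\<lambda>c d. trg G (\<lambda>a b. X a b c d))"
proof -
  have "trg G (\<lambda>a b. trg G' (\<lambda>c d. X a b c d))
      = (\<Sum>a\<in>UNIV. \<Sum>b\<in>UNIV. \<Sum>c\<in>UNIV. \<Sum>d\<in>UNIV. G a b * (G' c d * X a b c d))"
    unfolding trg_def by (simp add: sum_distrib_left)
  also have "\<dots> = (\<Sum>a\<in>UNIV. \<Sum>c\<in>UNIV. \<Sum>b\<in>UNIV. \<Sum>d\<in>UNIV. G a b * (G' c d * X a b c d))"
    by (rule sum.cong[OF refl], rule sum.swap)
  also have "\<dots> = (\<Sum>c\<in>UNIV. \<Sum>a\<in>UNIV. \<Sum>b\<in>UNIV. \<Sum>d\<in>UNIV. G a b * (G' c d * X a b c d))"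
    by (rule sum.swap)
  also have "\<dots> = (\<Sum>c\<in>UNIV. \<Sum>a\<in>UNIV. \<Sum>d\<in>UNIV. \<Sum>b\<in>UNIV. G a b * (G' c d * X a b c d))"
    by (rule sum.cong[OF refl], rule sum.cong[OF refl], rule sum.swap)
  also have "\<dots> = (\<Sum>c\<in>UNIV. \<Sum>d\<in>UNIV. \<Sum>a\<in>UNIV. \<Sum>b\<in>UNIV. G a b * (G' c d * X a b c d))"
    by (rule sum.cong[OF refl], rule sum.swap)
  also have "\<dots> = trg G' (\<lambda>c d. trg G (\<lambda>a b. X a b c d))"
    unfolding trg_def by (simp add: sum_distrib_left mult.left_commute)
  finally show ?thesis .
qed

lemma trg_diff: "trg G (\<lambda>i j. X i j - Y i j) = trg G X - trg G Y"
  unfolding trg_def by (simp add: sum_subtractf right_diff_distrib)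

lemma up_diff: "up G (\<lambda>a. X a - Y a) i = up G X i - up G Y i"
  and up_add: "up G (\<lambda>a. X a + Y a) i = up G X i + up G Y i"
  and up_cmult: "up G (\<lambda>a. c * X a) i = c * up G X i"
  and up_zero: "up G (\<lambda>a. 0) i = 0"
  unfolding up_def
  by (simp_all add: sum_subtractf sum.distrib algebra_simps sum_distrib_left)

lemma up_sum: "up G (\<lambda>a. \<Sum>p\<in>S. X p a) i = (\<Sum>p\<in>S. up G (X p) i)"
  unfolding up_def by (simp add: sum_distrib_left) (rule sum.swap)

lemma up_swap: "up G (\<lambda>a. up G' (\<lambda>b. X a b) j) i = up G' (\<lambda>b. up G (\<lambda>a. X a b) i) j"
  unfolding up_def by (simp add: sum_distrib_left) (subst sum.swap, simp add: mult.left_commute)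

text \<open>Used for divergences: contracting the derivative index with the raised first index turns
  this pair into a trace, and the raising of the other indices passes outside.\<close>

lemma contract_up:
  "(\<Sum>i\<in>UNIV. up G (\<lambda>a. up G' (\<lambda>b. X i a b) j) i) = up G' (\<lambda>b. \<Sum>i\<in>UNIV. up G (\<lambda>a. X i a b) i) j"
  by (simp add: up_sum up_swap[of G G'])

text \<open>The abstract form of \<open>\<nabla>\<^sub>i P\<^sup>i\<^sup>j\<^sup>k\<^sup>l = 0\<close>, where \<open>B m i j k l\<close> plays the role of
  \<open>\<nabla>\<^sub>m R\<^sub>i\<^sub>j\<^sub>k\<^sub>l\<close> and the hypothesis \<open>bianchi\<close> is the second Bianchi identity.\<close>
lemma contracted_bianchi_P:
  fixes G :: "'n::finite \<Rightarrow> 'n \<Rightarrow> real" and B :: "'n \<Rightarrow> 'n \<Rightarrow> 'n \<Rightarrow> 'n \<Rightarrow> 'n \<Rightarrow> real"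
  assumes G: "\<And>i j. G i j = G j i"
    and anti1: "\<And>m i j k l. B m i j k l = - B m j i k l"
    and anti2: "\<And>m i j k l. B m i j k l = - B m i j l k"
    and pair: "\<And>m i j k l. B m i j k l = B m k l i j"
    and bianchi: "\<And>m i j k l. B m i j k l + B i j m k l + B j m i k l = 0"
  defines "Br \<equiv> \<lambda>m j l. trg G (\<lambda>i k. B m i j k l)"
  defines "Bs \<equiv> \<lambda>m. trg G (Br m)"
  shows "(\<Sum>i\<in>UNIV. up4 G (B i) i j k l + up2 G (Br i) j k * G i l - up2 G (Br i) j l * G i k
     - up2 G (Br i) i k * G j l + up2 G (Br i) i l * G j k
     + 1/2 * Bs i * (G i k * G j l - G i l * G j k)) = 0"
proof -
  have Br_sym: "Br m j l = Br m l j" for m j l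
  proof -
    have "Br m l j = trg G (\<lambda>i k. B m k j i l)"
      unfolding Br_def by (simp add: pair[of m _ l _ j])
    then show ?thesis unfolding Br_def using trg_transpose[of G "\<lambda>i k. B m i j k l", OF G] by simp
  qed
  \<comment> \<open>Pair symmetry moves the contracted index into the second pair, so that the
    cyclic identity runs over \<open>i, c, d\<close>. The outcome is the once contracted Bianchi
    identity.\<close>
  have key1: "trg G (\<lambda>i a. B i a b c d) = Br c d b - Br d c b" for b c d
  proof -
    have "B i a b c d = B c i d a b - B d i c a b" for i a
    proof -
      have "B i a b c d = B i c d a b" by (rule pair)
      moreover have "B i c d a b + B c d i a b + B d i c a b = 0" by (rule bianchi)
      moreover have "B c d i a b = - B c i d a b" by (rule anti1)
      ultimately show ?thesis by linarith
    qed
    then show ?thesis unfolding Br_def by (simp add: trg_diff)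
  qed
  \<comment> \<open>The trace of \<open>key1\<close>: the divergence of Ricci is half the gradient
    of the scalar curvature. The divergence occurs on both sides after the traces are exchanged,
    hence the factor \<open>1/2\<close>.\<close>
  have key2: "trg G (\<lambda>i a. Br i a c) = 1/2 * Bs c" for c
  proof -
    have "trg G (\<lambda>b d. trg G (\<lambda>i a. B i a b c d)) = trg G (\<lambda>i a. trg G (\<lambda>b d. B i a b c d))"
      by (rule trg_swap)
    also have "\<dots> = trg G (\<lambda>i a. Br i a c)"
    proof -
      have "B i a b c d = B i b a d c" for i a b d
        using anti1[of i a b c d] anti2[of i b a c d] by linarith
      then show ?thesis unfolding Br_def by simp
    qed
    finally have "trg G (\<lambda>i a. Br i a c) = trg G (\<lambda>b d. Br c d b) - trg G (\<lambda>b d. Br d c b)"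
      unfolding key1 trg_diff by simp
    moreover have "trg G (\<lambda>b d. Br c d b) = Bs c"
      unfolding Bs_def by (rule trg_transpose) (rule G)
    moreover have "trg G (\<lambda>b d. Br d c b) = trg G (\<lambda>i a. Br i a c)"
      using trg_transpose[of G "\<lambda>d b. Br d c b", OF G] by (simp add: Br_sym[of _ c])
    ultimately show ?thesis by linarith
  qed
  have t1: "(\<Sum>i\<in>UNIV. up4 G (B i) i j k l)
      = up G (\<lambda>b. up G (\<lambda>c. up G (\<lambda>d. Br c d b - Br d c b) l) k) j"
    unfolding up4_def contract_up trg_eq_up[symmetric] key1 ..
  have t2: "(\<Sum>i\<in>UNIV. up2 G (Br i) j k * G i l) = up G (\<lambda>b. up G (\<lambda>c. up G (\<lambda>d. Br d b c) l) k) j"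
  proof -
    have "(\<Sum>i\<in>UNIV. up2 G (Br i) j k * G i l) = up G (\<lambda>d. up2 G (Br d) j k) l"
      unfolding up_def[of G _ l] by (simp add: G[of _ l] mult.commute)
    also have "\<dots> = up G (\<lambda>b. up G (\<lambda>d. up G (\<lambda>c. Br d b c) k) l) j"
      unfolding up2_def by (rule up_swap)
    also have "\<dots> = up G (\<lambda>b. up G (\<lambda>c. up G (\<lambda>d. Br d b c) l) k) j"
      by (subst up_swap) simp
    finally show ?thesis .
  qed
  have t3: "(\<Sum>i\<in>UNIV. up2 G (Br i) j l * G i k) = up G (\<lambda>b. up G (\<lambda>c. up G (\<lambda>d. Br c b d) l) k) j"
  proof -
    have "(\<Sum>i\<in>UNIV. up2 G (Br i) j l * G i k) = up G (\<lambda>c. up2 G (Br c) j l) k"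
      unfolding up_def[of G _ k] by (simp add: G[of _ k] mult.commute)
    also have "\<dots> = up G (\<lambda>b. up G (\<lambda>c. up G (\<lambda>d. Br c b d) l) k) j"
      unfolding up2_def by (rule up_swap)
    finally show ?thesis .
  qed
  \<comment> \<open>By \<open>key1\<close> the divergence of the curvature term is a difference of
    two derivatives of Ricci, which the next two terms of P cancel. What is left of P is handled by
    \<open>key2\<close>.\<close>
  have t123: "(\<Sum>i\<in>UNIV. up4 G (B i) i j k l) + (\<Sum>i\<in>UNIV. up2 G (Br i) j k * G i l)
      - (\<Sum>i\<in>UNIV. up2 G (Br i) j l * G i k) = 0"
    unfolding t1 t2 t3 by (simp add: up_diff[symmetric] up_add[symmetric] Br_sym up_zero)
  have t4: "(\<Sum>i\<in>UNIV. up2 G (Br i) i k) = (\<Sum>i\<in>UNIV. 1/2 * Bs i * G i k)" for k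
  proof -
    have "(\<Sum>i\<in>UNIV. up2 G (Br i) i k) = up G (\<lambda>c. 1/2 * Bs c) k"
      unfolding up2_def contract_up trg_eq_up[symmetric] key2 ..
    then show ?thesis unfolding up_def by (simp add: G[of k] mult.commute)
  qed
  have "(\<Sum>i\<in>UNIV. up4 G (B i) i j k l + up2 G (Br i) j k * G i l - up2 G (Br i) j l * G i k
     - up2 G (Br i) i k * G j l + up2 G (Br i) i l * G j k
     + 1/2 * Bs i * (G i k * G j l - G i l * G j k))
    = ((\<Sum>i\<in>UNIV. up4 G (B i) i j k l) + (\<Sum>i\<in>UNIV. up2 G (Br i) j k * G i l)
      - (\<Sum>i\<in>UNIV. up2 G (Br i) j l * G i k))
      - (\<Sum>i\<in>UNIV. up2 G (Br i) i k) * G j l + (\<Sum>i\<in>UNIV. up2 G (Br i) i l) * G j k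
      + ((\<Sum>i\<in>UNIV. 1/2 * Bs i * G i k) * G j l - (\<Sum>i\<in>UNIV. 1/2 * Bs i * G i l) * G j k)"
    by (simp add: sum.distrib sum_subtractf sum_distrib_right right_diff_distrib mult.assoc[symmetric])
  then show ?thesis unfolding t123 t4 by simp
qed

section \<open>Metric, Christoffel symbols and curvature through the derivatives of f\<close>

definition D1 :: "(real^'n::finite \<Rightarrow> real^'m::finite) \<Rightarrow> 'n \<Rightarrow> real^'n \<Rightarrow> real^'m" where
  "D1 f i x = (\<chi> a. pd i (coordf f a) x)"

definition D2 :: "(real^'n::finite \<Rightarrow> real^'m::finite) \<Rightarrow> 'n \<Rightarrow> 'n \<Rightarrow> real^'n \<Rightarrow> real^'m" where
  "D2 f i j x = (\<chi> a. pd j (pd i (coordf f a)) x)"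

definition D3 :: "(real^'n::finite \<Rightarrow> real^'m::finite) \<Rightarrow> 'n \<Rightarrow> 'n \<Rightarrow> 'n \<Rightarrow> real^'n \<Rightarrow> real^'m" where
  "D3 f i j k x = (\<chi> a. pd k (pd j (pd i (coordf f a))) x)"

abbreviation gi :: "(real^'n::finite \<Rightarrow> real^'m::finite) \<Rightarrow> 'n \<Rightarrow> 'n \<Rightarrow> real^'n \<Rightarrow> real" where
  "gi f i j x \<equiv> ginv f x $ i $ j"

text \<open>The vector \<open>V1 f p x\<close> is U^{-1} applied to \<open>D1 f p x\<close>, see
  \<open>V1_eq_Umat_inv\<close>. Writing it through \<open>ginv\<close> keeps derivatives of the
  inverse of \<open>Umat\<close> out of the curvature computation.\<close>

definition V1 :: "(real^'n::finite \<Rightarrow> real^'m::finite) \<Rightarrow> 'n \<Rightarrow> real^'n \<Rightarrow> real^'m" where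
  "V1 f p x = (\<Sum>q\<in>UNIV. gi f p q x *\<^sub>R D1 f q x)"

text \<open>The quadratic form of the matrix \<open>U\<^sup>-\<^sup>1\<close>, by the Woodbury identity
  \<open>(1 + A A\<^sup>T)\<^sup>-\<^sup>1 = 1 - A (1 + A\<^sup>T A)\<^sup>-\<^sup>1 A\<^sup>T\<close>.\<close>
definition Uinv_form :: "(real^'n::finite \<Rightarrow> real^'m::finite) \<Rightarrow> real^'n \<Rightarrow> real^'m \<Rightarrow> real^'m \<Rightarrow> real" where
  "Uinv_form f x u v = u \<bullet> v - (\<Sum>s\<in>UNIV. (V1 f s x \<bullet> u) * (D1 f s x \<bullet> v))"

lemma smooth_fun_inner:
  fixes u v :: "real^'n::finite \<Rightarrow> real^'m::finite"
  assumes "\<And>a. smooth_fun (\<lambda>x. u x $ a)" "\<And>a. smooth_fun (\<lambda>x. v x $ a)"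
  shows "smooth_fun (\<lambda>x. u x \<bullet> v x)"
  unfolding inner_vec_def inner_real_def by (intro smooth_intros assms)

lemma pd_inner:
  fixes u v :: "real^'n::finite \<Rightarrow> real^'m::finite"
  assumes u: "\<And>a. smooth_fun (\<lambda>x. u x $ a)" and v: "\<And>a. smooth_fun (\<lambda>x. v x $ a)"
  shows "pd m (\<lambda>x. u x \<bullet> v x) x
    = (\<chi> a. pd m (\<lambda>x. u x $ a) x) \<bullet> v x + u x \<bullet> (\<chi> a. pd m (\<lambda>x. v x $ a) x)"
proof -
  note d = smooth_fun_differentiable[OF u] smooth_fun_differentiable[OF v]
  have "pd m (\<lambda>x. u x \<bullet> v x) x = (\<Sum>a\<in>UNIV. pd m (\<lambda>x. u x $ a * v x $ a) x)"
    unfolding inner_vec_def inner_real_def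
    by (rule pd_sum) (auto intro!: smooth_fun_differentiable smooth_intros u v)
  also have "\<dots> = (\<Sum>a\<in>UNIV. pd m (\<lambda>x. u x $ a) x * v x $ a + u x $ a * pd m (\<lambda>x. v x $ a) x)"
    by (simp add: pd_mult d)
  finally show ?thesis by (simp add: inner_vec_def sum.distrib)
qed

locale smooth_graph =
  fixes f :: "real^'n::finite \<Rightarrow> real^'m::finite"
  assumes smooth: "smooth_fun (coordf f a)"
begin

lemma smooth_D: "smooth_fun (\<lambda>x. D1 f i x $ a)" "smooth_fun (\<lambda>x. D2 f i j x $ a)" "smooth_fun (\<lambda>x. D3 f i j k x $ a)"
  unfolding D1_def D2_def D3_def by (simp_all add: smooth_fun_pd smooth)

lemma D2_sym: "D2 f i j x = D2 f j i x"
  unfolding D2_def by (simp add: pd_commute[OF smooth, of i j])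

lemma D3_sym: "D3 f i j k x = D3 f j i k x" "D3 f i j k x = D3 f i k j x"
proof -
  have "pd k (pd j (pd i (coordf f a))) = pd j (pd k (pd i (coordf f a)))" for a
    by (rule pd_commute[OF smooth_fun_pd[OF smooth]])
  then show "D3 f i j k x = D3 f i k j x" unfolding D3_def by simp
  show "D3 f i j k x = D3 f j i k x" unfolding D3_def by (simp add: pd_commute[OF smooth, of i j])
qed

lemma smooth_inner_D [smooth_intros]:
  "smooth_fun (\<lambda>x. D1 f i x \<bullet> D1 f j x)" "smooth_fun (\<lambda>x. D1 f i x \<bullet> D2 f j k x)"
  "smooth_fun (\<lambda>x. D2 f i j x \<bullet> D2 f k l x)"  "smooth_fun (\<lambda>x. D2 f j k x \<bullet> D1 f i x)"
  by (intro smooth_fun_inner smooth_D)+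

lemma pd_inner_D:
  "pd m (\<lambda>x. D1 f i x \<bullet> D1 f j x) x = D2 f i m x \<bullet> D1 f j x + D1 f i x \<bullet> D2 f j m x"
  "pd m (\<lambda>x. D1 f i x \<bullet> D2 f j k x) x = D2 f i m x \<bullet> D2 f j k x + D1 f i x \<bullet> D3 f j k m x"
  "pd m (\<lambda>x. D2 f j k x \<bullet> D1 f i x) x = D3 f j k m x \<bullet> D1 f i x + D2 f j k x \<bullet> D2 f i m x"
  "pd m (\<lambda>x. D2 f i j x \<bullet> D2 f k l x) x = D3 f i j m x \<bullet> D2 f k l x + D2 f i j x \<bullet> D3 f k l m x"
  by (simp_all add: pd_inner[OF smooth_D(1) smooth_D(1)] pd_inner[OF smooth_D(1) smooth_D(2)]
      pd_inner[OF smooth_D(2) smooth_D(1)] pd_inner[OF smooth_D(2) smooth_D(2)])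
    (simp_all add: D1_def D2_def D3_def)

lemma gc_eq: "gc f i j = (\<lambda>x. (if i = j then 1 else 0) + D1 f i x \<bullet> D1 f j x)"
  unfolding gc_def metric_def D1_def inner_vec_def by simp

lemma gc_sym: "gc f i j = gc f j i"
  unfolding gc_eq by (auto simp: inner_commute)

lemma smooth_gc [smooth_intros]: "smooth_fun (gc f i j)"
  unfolding gc_eq by (intro smooth_intros)

lemma pd_gc: "pd m (gc f i j) x = D2 f i m x \<bullet> D1 f j x + D1 f i x \<bullet> D2 f j m x"
  unfolding gc_eq
  by (subst pd_add) (auto intro!: smooth_fun_differentiable smooth_intros simp: pd_inner_D)

text \<open>The metric differs from the identity by a Gram matrix and so dominates it. Invertibility
  and the later uniform bounds on \<open>ginv\<close> rest on this.\<close>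

lemma metric_quadratic: "v \<bullet> (metric f x *v v) = v \<bullet> v + norm (\<Sum>i\<in>UNIV. v $ i *\<^sub>R D1 f i x) ^ 2"
proof -
  have "v \<bullet> (metric f x *v v) = (\<Sum>i\<in>UNIV. v $ i * (\<Sum>j\<in>UNIV. gc f i j x * v $ j))"
    by (simp add: inner_vec_def matrix_vector_mult_def gc_def)
  also have "\<dots> = (\<Sum>i\<in>UNIV. \<Sum>j\<in>UNIV. (if i = j then v $ i * v $ j else 0)
      + (v $ i *\<^sub>R D1 f i x) \<bullet> (v $ j *\<^sub>R D1 f j x))"
    unfolding gc_eq by (auto simp: sum_distrib_left algebra_simps intro!: sum.cong)
  also have "\<dots> = v \<bullet> v + (\<Sum>i\<in>UNIV. v $ i *\<^sub>R D1 f i x) \<bullet> (\<Sum>i\<in>UNIV. v $ i *\<^sub>R D1 f i x)"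
  proof -
    have "(\<Sum>i\<in>UNIV. \<Sum>j\<in>UNIV. (if i = j then v $ i * v $ j else 0)) = v \<bullet> v"
      by (simp add: inner_vec_def)
    then show ?thesis
      by (simp add: sum.distrib inner_sum_left inner_sum_right sum_distrib_left inner_commute mult.left_commute)
  qed
  finally show ?thesis by (simp add: power2_norm_eq_inner)
qed

lemma invertible_metric: "invertible (metric f x)"
proof -
  have "v = 0" if "metric f x *v v = 0" for v
  proof -
    have "v \<bullet> v + norm (\<Sum>i\<in>UNIV. v $ i *\<^sub>R D1 f i x) ^ 2 = 0"
      using metric_quadratic[of v x] that by simp
    then have "v \<bullet> v \<le> 0" by (smt (verit) zero_le_power2)
    then show ?thesis by (metis inner_ge_zero inner_eq_zero_iff order_antisym)
  qed
  then show ?thesis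
    unfolding invertible_left_inverse matrix_left_invertible_ker by blast
qed

lemma ginv_mult: "metric f x ** ginv f x = mat 1" "ginv f x ** metric f x = mat 1"
  unfolding ginv_def matrix_inv_def
  using someI_ex[OF invertible_metric[unfolded invertible_def, of x]] by auto

lemma gc_gi: "(\<Sum>k\<in>UNIV. gc f i k x * gi f k j x) = (if i = j then 1 else 0)"
  using ginv_mult(1)[of x] by (simp add: matrix_matrix_mult_def mat_def vec_eq_iff gc_def)

lemma gi_gc: "(\<Sum>k\<in>UNIV. gi f i k x * gc f k j x) = (if i = j then 1 else 0)"
  using ginv_mult(2)[of x] by (simp add: matrix_matrix_mult_def mat_def vec_eq_iff gc_def)

lemma transpose_ginv: "transpose (ginv f x) = ginv f x"
proof -
  have t: "transpose (metric f x) = metric f x"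
    using gc_sym by (simp add: transpose_def vec_eq_iff gc_def fun_eq_iff)
  have "transpose (ginv f x) ** metric f x = mat 1"
    using arg_cong[OF ginv_mult(1)[of x], of transpose]
    by (simp add: matrix_transpose_mul t transpose_mat)
  then have "transpose (ginv f x) ** (metric f x ** ginv f x) = ginv f x"
    by (simp add: matrix_mul_assoc)
  then show ?thesis by (simp add: ginv_mult)
qed

lemma gi_sym: "gi f i j x = gi f j i x"
  using transpose_ginv[of x] by (simp add: transpose_def vec_eq_iff)

lemma smooth_gi [smooth_intros]: "smooth_fun (gi f i j)"
  unfolding ginv_def
  by (rule smooth_fun_matrix_inv) (use smooth_gc invertible_metric in \<open>auto simp: gc_def\<close>)

lemma gi_gc_contract: "(\<Sum>a\<in>UNIV. gi f i a x * (\<Sum>b\<in>UNIV. gc f a b x * X b)) = X i"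
proof -
  have "(\<Sum>a\<in>UNIV. gi f i a x * (\<Sum>b\<in>UNIV. gc f a b x * X b))
      = (\<Sum>b\<in>UNIV. (\<Sum>a\<in>UNIV. gi f i a x * gc f a b x) * X b)"
    unfolding sum_distrib_left sum_distrib_right by (subst sum.swap) (simp add: mult.assoc)
  then show ?thesis by (simp add: gi_gc if_distrib if_distribR cong: if_cong)
qed

lemma gc_gi_contract: "(\<Sum>a\<in>UNIV. gc f i a x * (\<Sum>b\<in>UNIV. gi f a b x * X b)) = X i"
proof -
  have "(\<Sum>a\<in>UNIV. gc f i a x * (\<Sum>b\<in>UNIV. gi f a b x * X b))
      = (\<Sum>b\<in>UNIV. (\<Sum>a\<in>UNIV. gc f i a x * gi f a b x) * X b)"
    unfolding sum_distrib_left sum_distrib_right by (subst sum.swap) (simp add: mult.assoc)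
  then show ?thesis by (simp add: gc_gi if_distrib if_distribR cong: if_cong)
qed

lemma V1_inner: "V1 f p x \<bullet> u = (\<Sum>q\<in>UNIV. gi f p q x * (D1 f q x \<bullet> u))"
  unfolding V1_def by (simp add: inner_sum_left)

text \<open>Of the six terms in the combination of metric derivatives four cancel in pairs by
  symmetry of the Hessian, and the remaining two agree.\<close>

lemma Gam_eq: "Gam f k i j = (\<lambda>x. V1 f k x \<bullet> D2 f i j x)"
proof
  fix x
  have "pd i (gc f j l) x + pd j (gc f i l) x - pd l (gc f i j) x = 2 * (D1 f l x \<bullet> D2 f i j x)" for l
    unfolding pd_gc by (simp add: D2_sym[of j i] D2_sym[of j l] D2_sym[of i l] inner_commute)
  then show "Gam f k i j x = V1 f k x \<bullet> D2 f i j x"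
    unfolding Gam_def V1_inner by (simp add: sum_distrib_left mult_ac)
qed

lemma Gam_sym: "Gam f k i j = Gam f k j i"
  unfolding Gam_eq by (simp add: D2_sym)

lemma smooth_Gam [smooth_intros]: "smooth_fun (Gam f k i j)"
  unfolding Gam_eq V1_inner by (intro smooth_intros)

text \<open>The inverse metric is parallel. The formula arises by differentiating
  \<open>gc_gi\<close> and inserting the derivatives of the metric.\<close>

lemma pd_gi:
  "pd m (gi f i j) x = - (\<Sum>p\<in>UNIV. Gam f i m p x * gi f p j x) - (\<Sum>p\<in>UNIV. Gam f j m p x * gi f i p x)"
proof -
  have sm: "\<And>h. smooth_fun h \<Longrightarrow> h differentiable (at x)" by (rule smooth_fun_differentiable)
  have e: "(\<Sum>b\<in>UNIV. gc f a b x * pd m (gi f b j) x) = - (\<Sum>b\<in>UNIV. pd m (gc f a b) x * gi f b j x)" for a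
  proof -
    have "pd m (\<lambda>x. \<Sum>b\<in>UNIV. gc f a b x * gi f b j x) x = 0"
      unfolding gc_gi by simp
    moreover have "pd m (\<lambda>x. \<Sum>b\<in>UNIV. gc f a b x * gi f b j x) x
       = (\<Sum>b\<in>UNIV. pd m (gc f a b) x * gi f b j x + gc f a b x * pd m (gi f b j) x)"
      by (subst pd_sum) (auto intro!: sm smooth_intros sum.cong pd_mult)
    ultimately show ?thesis by (simp add: sum.distrib)
  qed
  have "pd m (gi f i j) x = (\<Sum>a\<in>UNIV. gi f i a x * (\<Sum>b\<in>UNIV. gc f a b x * pd m (gi f b j) x))"
    by (rule gi_gc_contract[symmetric])
  also have "\<dots> = - (\<Sum>a\<in>UNIV. gi f i a x * (\<Sum>b\<in>UNIV. pd m (gc f a b) x * gi f b j x))"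
    unfolding e by (simp add: sum_negf)
  also have "(\<Sum>a\<in>UNIV. gi f i a x * (\<Sum>b\<in>UNIV. pd m (gc f a b) x * gi f b j x))
      = (\<Sum>a\<in>UNIV. gi f i a x * (\<Sum>b\<in>UNIV. gi f j b x * (D1 f b x \<bullet> D2 f m a x)))
      + (\<Sum>a\<in>UNIV. \<Sum>b\<in>UNIV. gi f i a x * (D1 f a x \<bullet> D2 f m b x) * gi f b j x)"
    unfolding pd_gc
    by (simp add: sum.distrib[symmetric] sum_distrib_left algebra_simps inner_commute
        D2_sym[of _ m] gi_sym[of _ j])
  also have "(\<Sum>a\<in>UNIV. \<Sum>b\<in>UNIV. gi f i a x * (D1 f a x \<bullet> D2 f m b x) * gi f b j x)
     = (\<Sum>b\<in>UNIV. Gam f i m b x * gi f b j x)"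
    unfolding Gam_eq V1_inner sum_distrib_right by (rule sum.swap)
  also have "(\<Sum>a\<in>UNIV. gi f i a x * (\<Sum>b\<in>UNIV. gi f j b x * (D1 f b x \<bullet> D2 f m a x)))
     = (\<Sum>a\<in>UNIV. Gam f j m a x * gi f i a x)"
    unfolding Gam_eq V1_inner by (simp add: mult.commute)
  finally show ?thesis by simp
qed

text \<open>Raising commutes with covariant differentiation: hypothesis \<open>dX\<close> makes
  \<open>Y\<close> the derivative corrected in slot \<open>a\<close> alone. Corrections belonging to
  other slots may be hidden inside \<open>Y\<close>, which permits iteration.\<close>

lemma pd_up:
  assumes X: "\<And>a. X a differentiable (at x)"
    and dX: "\<And>a. pd m (X a) x = Y a + (\<Sum>p\<in>UNIV. Gam f p m a x * X p x)"
  shows "pd m (\<lambda>x. up (\<lambda>i j. gi f i j x) (\<lambda>a. X a x) i) x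
    = up (\<lambda>i j. gi f i j x) Y i - (\<Sum>p\<in>UNIV. Gam f i m p x * up (\<lambda>i j. gi f i j x) (\<lambda>a. X a x) p)"
proof -
  have "pd m (\<lambda>x. up (\<lambda>i j. gi f i j x) (\<lambda>a. X a x) i) x
      = (\<Sum>a\<in>UNIV. pd m (gi f i a) x * X a x + gi f i a x * pd m (X a) x)"
    unfolding up_def
    by (subst pd_sum) (auto intro!: derivative_intros smooth_fun_differentiable[OF smooth_gi] X sum.cong pd_mult)
  also have "\<dots> = up (\<lambda>i j. gi f i j x) Y i
      - (\<Sum>a\<in>UNIV. \<Sum>p\<in>UNIV. Gam f i m p x * gi f p a x * X a x)
      - (\<Sum>a\<in>UNIV. \<Sum>p\<in>UNIV. Gam f a m p x * gi f i p x * X a x)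
      + (\<Sum>a\<in>UNIV. \<Sum>p\<in>UNIV. Gam f p m a x * gi f i a x * X p x)"
    unfolding pd_gi dX up_def
    by (simp add: sum.distrib sum_subtractf sum_negf distrib_left right_diff_distrib sum_distrib_left sum_distrib_right mult_ac)
  also have "(\<Sum>a\<in>UNIV. \<Sum>p\<in>UNIV. Gam f a m p x * gi f i p x * X a x)
      = (\<Sum>a\<in>UNIV. \<Sum>p\<in>UNIV. Gam f p m a x * gi f i a x * X p x)"
    by (rule sum.swap)
  also have "(\<Sum>a\<in>UNIV. \<Sum>p\<in>UNIV. Gam f i m p x * gi f p a x * X a x)
      = (\<Sum>p\<in>UNIV. Gam f i m p x * up (\<lambda>i j. gi f i j x) (\<lambda>a. X a x) p)"
    unfolding up_def sum_distrib_left by (subst sum.swap) (simp add: mult.assoc)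
  finally show ?thesis by simp
qed

lemma smooth_up [smooth_intros]:
  "(\<And>a. smooth_fun (X a)) \<Longrightarrow> smooth_fun (\<lambda>x. up (\<lambda>i j. gi f i j x) (\<lambda>a. X a x) i)"
  unfolding up_def by (intro smooth_intros)

text \<open>Raising the second slot turns its correction into one of opposite sign, and on the
  diagonal this cancels the correction of the first slot.\<close>

lemma pd_trg:
  assumes X: "\<And>a b. X a b differentiable (at x)"
    and dX: "\<And>a b. pd m (X a b) x = Y a b + (\<Sum>p\<in>UNIV. Gam f p m a x * X p b x) + (\<Sum>p\<in>UNIV. Gam f p m b x * X a p x)"
  shows "pd m (\<lambda>x. trg (\<lambda>i j. gi f i j x) (\<lambda>a b. X a b x)) x = trg (\<lambda>i j. gi f i j x) Y"
proof -
  let ?G = "\<lambda>i j. gi f i j x"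
  have d: "(\<lambda>x. up (\<lambda>i j. gi f i j x) (\<lambda>b. X a b x) i) differentiable (at x)" for a i
    unfolding up_def by (auto intro!: derivative_intros smooth_fun_differentiable[OF smooth_gi] X)
  have e: "pd m (\<lambda>x. up (\<lambda>i j. gi f i j x) (\<lambda>b. X a b x) a) x
     = up ?G (\<lambda>b. Y a b + (\<Sum>p\<in>UNIV. Gam f p m a x * X p b x)) a
      - (\<Sum>p\<in>UNIV. Gam f a m p x * up ?G (\<lambda>b. X a b x) p)" for a
    by (rule pd_up) (auto simp: X dX)
  have "pd m (\<lambda>x. trg (\<lambda>i j. gi f i j x) (\<lambda>a b. X a b x)) x
      = (\<Sum>a\<in>UNIV. pd m (\<lambda>x. up (\<lambda>i j. gi f i j x) (\<lambda>b. X a b x) a) x)"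
    unfolding trg_eq_up by (rule pd_sum) (auto intro: d)
  also have "\<dots> = trg ?G Y + (\<Sum>a\<in>UNIV. \<Sum>p\<in>UNIV. Gam f p m a x * up ?G (\<lambda>b. X p b x) a)
      - (\<Sum>a\<in>UNIV. \<Sum>p\<in>UNIV. Gam f a m p x * up ?G (\<lambda>b. X a b x) p)"
    unfolding e trg_eq_up by (simp add: up_add up_sum up_cmult sum.distrib sum_subtractf)
  also have "(\<Sum>a\<in>UNIV. \<Sum>p\<in>UNIV. Gam f p m a x * up ?G (\<lambda>b. X p b x) a)
      = (\<Sum>a\<in>UNIV. \<Sum>p\<in>UNIV. Gam f a m p x * up ?G (\<lambda>b. X a b x) p)"
    by (rule sum.swap)
  finally show ?thesis by simp
qed

lemma Uinv_form_sym: "Uinv_form f x u v = Uinv_form f x v u"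
proof -
  have "(\<Sum>s\<in>UNIV. (V1 f s x \<bullet> u) * (D1 f s x \<bullet> v))
      = (\<Sum>s\<in>UNIV. \<Sum>t\<in>UNIV. gi f s t x * (D1 f t x \<bullet> u) * (D1 f s x \<bullet> v))"
    unfolding V1_inner sum_distrib_right ..
  also have "\<dots> = (\<Sum>t\<in>UNIV. \<Sum>s\<in>UNIV. gi f t s x * (D1 f s x \<bullet> v) * (D1 f t x \<bullet> u))"
    by (subst sum.swap) (simp add: gi_sym mult_ac)
  also have "\<dots> = (\<Sum>s\<in>UNIV. (V1 f s x \<bullet> v) * (D1 f s x \<bullet> u))"
    unfolding V1_inner sum_distrib_right ..
  finally show ?thesis unfolding Uinv_form_def by (simp add: inner_commute)
qed

lemma Uinv_form_linear:
  "Uinv_form f x (u + u') v = Uinv_form f x u v + Uinv_form f x u' v" "Uinv_form f x (u - u') v = Uinv_form f x u v - Uinv_form f x u' v"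
  "Uinv_form f x (c *\<^sub>R u) v = c * Uinv_form f x u v" "Uinv_form f x u (v + v') = Uinv_form f x u v + Uinv_form f x u v'"
  "Uinv_form f x u (v - v') = Uinv_form f x u v - Uinv_form f x u v'" "Uinv_form f x u (c *\<^sub>R v) = c * Uinv_form f x u v"
  unfolding Uinv_form_def
  by (simp_all add: inner_add_left inner_add_right inner_diff_left inner_diff_right
     algebra_simps sum.distrib sum_subtractf sum_distrib_left)

lemma Uinv_form_zero: "Uinv_form f x 0 v = 0" "Uinv_form f x u 0 = 0"
  unfolding Uinv_form_def by simp_all

lemma Uinv_form_sum_left: "Uinv_form f x (\<Sum>p\<in>S. u p) v = (\<Sum>p\<in>S. Uinv_form f x (u p) v)"
  by (induction S rule: infinite_finite_induct) (simp_all add: Uinv_form_linear Uinv_form_zero)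

lemma Gam_eq_up: "Gam f k i j x = up (\<lambda>i j. gi f i j x) (\<lambda>q. D1 f q x \<bullet> D2 f i j x) k"
  unfolding Gam_eq V1_inner up_def ..

text \<open>Sorted for the curvature formula: under antisymmetrization the third derivatives drop
  out and the last sum cancels the quadratic terms of \<open>Rm\<close>, so that only the
  \<open>Uinv_form\<close> part reaches \<open>gauss_equation\<close>.\<close>

lemma pd_Gam:
  "pd m (Gam f s i k) x = (\<Sum>q\<in>UNIV. gi f s q x * Uinv_form f x (D2 f m q x) (D2 f i k x))
      + V1 f s x \<bullet> D3 f i k m x - (\<Sum>p\<in>UNIV. Gam f s m p x * Gam f p i k x)"
proof -
  have dX: "pd m (\<lambda>x. D1 f q x \<bullet> D2 f i k x) x
     = (Uinv_form f x (D2 f m q x) (D2 f i k x) + D1 f q x \<bullet> D3 f i k m x)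
      + (\<Sum>p\<in>UNIV. Gam f p m q x * (D1 f p x \<bullet> D2 f i k x))" for q
    unfolding pd_inner_D Uinv_form_def Gam_eq by (simp add: D2_sym[of q m])
  have "pd m (\<lambda>x. up (\<lambda>i j. gi f i j x) (\<lambda>q. D1 f q x \<bullet> D2 f i k x) s) x
    = up (\<lambda>i j. gi f i j x) (\<lambda>q. Uinv_form f x (D2 f m q x) (D2 f i k x) + D1 f q x \<bullet> D3 f i k m x) s
     - (\<Sum>p\<in>UNIV. Gam f s m p x * up (\<lambda>i j. gi f i j x) (\<lambda>q. D1 f q x \<bullet> D2 f i k x) p)"
    by (rule pd_up[OF _ dX]) (intro smooth_fun_differentiable smooth_intros)
  then show ?thesis
    unfolding Gam_eq_up[symmetric] up_add by (simp add: up_def V1_inner)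
qed

lemma gauss_equation:
  "Rm f i j k l x = Uinv_form f x (D2 f i k x) (D2 f j l x) - Uinv_form f x (D2 f i l x) (D2 f j k x)"
proof -
  have "Rm f i j k l x = (\<Sum>s\<in>UNIV. gc f k s x *
       ((\<Sum>q\<in>UNIV. gi f s q x * Uinv_form f x (D2 f i q x) (D2 f j l x))
        - (\<Sum>q\<in>UNIV. gi f s q x * Uinv_form f x (D2 f j q x) (D2 f i l x))))"
  proof -
    have "D3 f j l i x = D3 f i l j x"
      using D3_sym(2)[of j l i x] D3_sym(1)[of j i l x] D3_sym(2)[of i j l x] by simp
    then show ?thesis unfolding Rm_def pd_Gam by (simp add: sum_subtractf mult.commute)
  qed
  also have "\<dots> = Uinv_form f x (D2 f i k x) (D2 f j l x) - Uinv_form f x (D2 f j k x) (D2 f i l x)"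
    by (simp add: right_diff_distrib sum_subtractf gc_gi_contract)
  finally show ?thesis by (simp add: Uinv_form_sym)
qed

lemma Uinv_form_D2_eq: "Uinv_form f x (D2 f i k x) (D2 f j l x)
    = D2 f i k x \<bullet> D2 f j l x - (\<Sum>s\<in>UNIV. Gam f s i k x * (D1 f s x \<bullet> D2 f j l x))"
  unfolding Uinv_form_def Gam_eq ..

lemma smooth_Uinv_form [smooth_intros]: "smooth_fun (\<lambda>x. Uinv_form f x (D2 f i k x) (D2 f j l x))"
  unfolding Uinv_form_D2_eq by (intro smooth_intros)

lemma smooth_Rm [smooth_intros]: "smooth_fun (Rm f i j k l)"
proof -
  have "Rm f i j k l = (\<lambda>x. Uinv_form f x (D2 f i k x) (D2 f j l x) - Uinv_form f x (D2 f i l x) (D2 f j k x))"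
    by (rule ext) (rule gauss_equation)
  then show ?thesis by (simp only: smooth_fun_diff smooth_Uinv_form)
qed

end

text \<open>The covariant derivative of the second fundamental form; its total symmetry is the
  Codazzi equation.\<close>
definition nabla_D2 :: "(real^'n::finite \<Rightarrow> real^'m::finite) \<Rightarrow> 'n \<Rightarrow> 'n \<Rightarrow> 'n \<Rightarrow> real^'n \<Rightarrow> real^'m" where
  "nabla_D2 f i j m x = D3 f i j m x - (\<Sum>p\<in>UNIV. Gam f p m i x *\<^sub>R D2 f p j x)
     - (\<Sum>p\<in>UNIV. Gam f p m j x *\<^sub>R D2 f i p x) - (\<Sum>p\<in>UNIV. Gam f p i j x *\<^sub>R D2 f m p x)"

text \<open>The Leibniz rule applied to the Gauss equation with the form of U^{-1} treated as
  parallel; \<open>pd_Rm\<close> justifies this. In this shape the Bianchi identity follows from the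
  symmetries of \<open>nabla_D2\<close> and of the form.\<close>

definition nabla_Rm :: "(real^'n::finite \<Rightarrow> real^'m::finite) \<Rightarrow> 'n \<Rightarrow> 'n \<Rightarrow> 'n \<Rightarrow> 'n \<Rightarrow> 'n \<Rightarrow> real^'n \<Rightarrow> real" where
  "nabla_Rm f m i j k l x = Uinv_form f x (nabla_D2 f i k m x) (D2 f j l x) + Uinv_form f x (D2 f i k x) (nabla_D2 f j l m x)
     - Uinv_form f x (nabla_D2 f i l m x) (D2 f j k x) - Uinv_form f x (D2 f i l x) (nabla_D2 f j k m x)"

context smooth_graph
begin

lemma nabla_D2_sym: "nabla_D2 f i j m x = nabla_D2 f j i m x" "nabla_D2 f i j m x = nabla_D2 f i m j x"
  unfolding nabla_D2_def
  by (simp_all add: D3_sym(1)[of i j m] D3_sym(2)[of i m j] D2_sym[of _ i] D2_sym[of _ j] D2_sym[of m]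
      Gam_sym[of _ j i] Gam_sym[of _ m i] Gam_sym[of _ m j])

lemma pd_Uinv_form_D2:
  "pd m (\<lambda>x. Uinv_form f x (D2 f i k x) (D2 f j l x)) x
   = Uinv_form f x (nabla_D2 f i k m x) (D2 f j l x) + Uinv_form f x (D2 f i k x) (nabla_D2 f j l m x)
    + (\<Sum>p\<in>UNIV. Gam f p m i x * Uinv_form f x (D2 f p k x) (D2 f j l x))
    + (\<Sum>p\<in>UNIV. Gam f p m k x * Uinv_form f x (D2 f i p x) (D2 f j l x))
    + (\<Sum>p\<in>UNIV. Gam f p m j x * Uinv_form f x (D2 f i k x) (D2 f p l x))
    + (\<Sum>p\<in>UNIV. Gam f p m l x * Uinv_form f x (D2 f i k x) (D2 f j p x))"
proof -
  let ?h = "\<lambda>i j. D2 f i j x" and ?A = "\<lambda>s. D1 f s x"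
  have "pd m (\<lambda>x. Uinv_form f x (D2 f i k x) (D2 f j l x)) x
    = D3 f i k m x \<bullet> ?h j l + ?h i k \<bullet> D3 f j l m x
     - (\<Sum>s\<in>UNIV. pd m (Gam f s i k) x * (?A s \<bullet> ?h j l) + Gam f s i k x * (?h s m \<bullet> ?h j l + ?A s \<bullet> D3 f j l m x))"
  proof -
    have "pd m (\<lambda>x. Gam f s i k x * (D1 f s x \<bullet> D2 f j l x)) x
      = pd m (Gam f s i k) x * (?A s \<bullet> ?h j l) + Gam f s i k x * (?h s m \<bullet> ?h j l + ?A s \<bullet> D3 f j l m x)" for s
      by (subst pd_mult) (auto intro!: smooth_fun_differentiable smooth_intros simp: pd_inner_D)
    moreover have "pd m (\<lambda>x. Uinv_form f x (D2 f i k x) (D2 f j l x)) x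
      = pd m (\<lambda>x. D2 f i k x \<bullet> D2 f j l x) x - (\<Sum>s\<in>UNIV. pd m (\<lambda>x. Gam f s i k x * (D1 f s x \<bullet> D2 f j l x)) x)"
      unfolding Uinv_form_D2_eq
      by (subst pd_diff) (auto intro!: smooth_fun_differentiable smooth_intros pd_sum)
    ultimately show ?thesis by (simp add: pd_inner_D)
  qed
  also have "(\<Sum>s\<in>UNIV. pd m (Gam f s i k) x * (?A s \<bullet> ?h j l) + Gam f s i k x * (?h s m \<bullet> ?h j l + ?A s \<bullet> D3 f j l m x))
    = (\<Sum>s\<in>UNIV. (\<Sum>q\<in>UNIV. gi f s q x * Uinv_form f x (?h m q) (?h i k)) * (?A s \<bullet> ?h j l))
     + (\<Sum>s\<in>UNIV. (V1 f s x \<bullet> D3 f i k m x) * (?A s \<bullet> ?h j l))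
     - (\<Sum>s\<in>UNIV. (\<Sum>p\<in>UNIV. Gam f s m p x * Gam f p i k x) * (?A s \<bullet> ?h j l))
     + (\<Sum>p\<in>UNIV. Gam f p i k x * (?h m p \<bullet> ?h j l))
     + (\<Sum>s\<in>UNIV. Gam f s i k x * (?A s \<bullet> D3 f j l m x))"
    unfolding pd_Gam
    by (simp add: distrib_right distrib_left left_diff_distrib sum.distrib sum_subtractf D2_sym[of _ m])
  also have "(\<Sum>s\<in>UNIV. (\<Sum>q\<in>UNIV. gi f s q x * Uinv_form f x (?h m q) (?h i k)) * (?A s \<bullet> ?h j l))
    = (\<Sum>q\<in>UNIV. Gam f q j l x * Uinv_form f x (?h i k) (?h m q))"
    unfolding Gam_eq_up up_def sum_distrib_right
    by (subst sum.swap) (simp add: gi_sym Uinv_form_sym mult_ac)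
  also have "(\<Sum>s\<in>UNIV. (\<Sum>p\<in>UNIV. Gam f s m p x * Gam f p i k x) * (?A s \<bullet> ?h j l))
    = (\<Sum>p\<in>UNIV. Gam f p i k x * (\<Sum>s\<in>UNIV. Gam f s m p x * (?A s \<bullet> ?h j l)))"
    unfolding sum_distrib_right sum_distrib_left by (subst sum.swap) (simp add: mult_ac)
  \<comment> \<open>Differentiating U^{-1} contributes the last two sums. They are exactly the third
    Christoffel corrections in the two factors \<open>nabla_D2\<close>.\<close>
  finally have e: "pd m (\<lambda>x. Uinv_form f x (D2 f i k x) (D2 f j l x)) x
    = Uinv_form f x (D3 f i k m x) (?h j l) + Uinv_form f x (?h i k) (D3 f j l m x)
     - (\<Sum>q\<in>UNIV. Gam f q j l x * Uinv_form f x (?h i k) (?h m q))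
     - (\<Sum>p\<in>UNIV. Gam f p i k x * Uinv_form f x (?h m p) (?h j l))"
    by (simp add: Uinv_form_def[of f x "D3 f i k m x"] Uinv_form_def[of f x "?h i k" "D3 f j l m x"] Uinv_form_D2_eq[of x m _ j l]
       Gam_eq[symmetric] right_diff_distrib sum_subtractf)
      (simp add: Gam_eq)
  have H: "Uinv_form f x (nabla_D2 f i k m x) v = Uinv_form f x (D3 f i k m x) v - (\<Sum>p\<in>UNIV. Gam f p m i x * Uinv_form f x (?h p k) v)
     - (\<Sum>p\<in>UNIV. Gam f p m k x * Uinv_form f x (?h i p) v) - (\<Sum>p\<in>UNIV. Gam f p i k x * Uinv_form f x (?h m p) v)" for i k v
    unfolding nabla_D2_def by (simp add: Uinv_form_linear Uinv_form_sum_left)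
  show ?thesis
    unfolding e H Uinv_form_sym[of x "?h i k" "nabla_D2 f j l m x"]
    by (simp add: Uinv_form_sym[of x _ "?h i k"])
qed

lemma pd_Rm:
  "pd m (Rm f i j k l) x = nabla_Rm f m i j k l x
    + (\<Sum>p\<in>UNIV. Gam f p m i x * Rm f p j k l x) + (\<Sum>p\<in>UNIV. Gam f p m j x * Rm f i p k l x)
    + (\<Sum>p\<in>UNIV. Gam f p m k x * Rm f i j p l x) + (\<Sum>p\<in>UNIV. Gam f p m l x * Rm f i j k p x)"
proof -
  have R: "Rm f i j k l = (\<lambda>x. Uinv_form f x (D2 f i k x) (D2 f j l x) - Uinv_form f x (D2 f i l x) (D2 f j k x))"
    by (rule ext) (rule gauss_equation)
  have "pd m (Rm f i j k l) x = pd m (\<lambda>x. Uinv_form f x (D2 f i k x) (D2 f j l x)) x - pd m (\<lambda>x. Uinv_form f x (D2 f i l x) (D2 f j k x)) x"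
    unfolding R by (rule pd_diff) (intro smooth_fun_differentiable smooth_intros)+
  then show ?thesis
    unfolding pd_Uinv_form_D2 nabla_Rm_def gauss_equation
    by (simp add: right_diff_distrib sum_subtractf)
qed

lemma Rm_anti: "Rm f i j k l x = - Rm f j i k l x" "Rm f i j k l x = - Rm f i j l k x"
  unfolding gauss_equation by (simp_all add: Uinv_form_sym)

lemma nabla_Rm_anti: "nabla_Rm f m i j k l x = - nabla_Rm f m j i k l x" "nabla_Rm f m i j k l x = - nabla_Rm f m i j l k x"
  unfolding nabla_Rm_def by (simp_all add: Uinv_form_sym)

lemma nabla_Rm_pair: "nabla_Rm f m i j k l x = nabla_Rm f m k l i j x"
  unfolding nabla_Rm_def
  by (simp add: Uinv_form_sym D2_sym[of k i] D2_sym[of l j] D2_sym[of k j] D2_sym[of l i]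
    nabla_D2_sym(1)[of k i] nabla_D2_sym(1)[of l j] nabla_D2_sym(1)[of k j] nabla_D2_sym(1)[of l i])

text \<open>Each summand has four terms. As \<open>nabla_D2\<close> is unchanged when its first and
  third index are exchanged, the twelve terms cancel in pairs.\<close>

lemma second_bianchi: "nabla_Rm f m i j k l x + nabla_Rm f i j m k l x + nabla_Rm f j m i k l x = 0"
proof -
  have c: "nabla_D2 f a b c x = nabla_D2 f c b a x" for a b c
    using nabla_D2_sym(1)[of a b c x] nabla_D2_sym(2)[of b a c x] nabla_D2_sym(1)[of b c a x] by simp
  show ?thesis
    unfolding nabla_Rm_def by (simp add: c[of i _ m] c[of j _ m] c[of i _ j] Uinv_form_sym)
qed

end

section \<open>The divergence of the flux field\<close>

lemma up2_add: "up2 G (\<lambda>a b. X a b + Y a b) i j = up2 G X i j + up2 G Y i j"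
  unfolding up2_def up_add ..

lemma up2_sum_cmult: "up2 G (\<lambda>a b. \<Sum>p\<in>S. c p * X p a b) i j = (\<Sum>p\<in>S. c p * up2 G (X p) i j)"
  unfolding up2_def by (simp add: up_sum up_cmult)

lemma up2_diff: "up2 G (\<lambda>a b. X a b - Y a b) i j = up2 G X i j - up2 G Y i j"
  unfolding up2_def up_diff ..

lemma up4_eq_up2: "up4 G X i j k l = up2 G (\<lambda>a b. up2 G (X a b) k l) i j"
  unfolding up2_def up4_def ..

lemma trg_add: "trg G (\<lambda>a b. X a b + Y a b) = trg G X + trg G Y"
  unfolding trg_def by (simp add: distrib_left sum.distrib)

lemma trg_sum_cmult: "trg G (\<lambda>a b. \<Sum>p\<in>S. c p * X p a b) = (\<Sum>p\<in>S. c p * trg G (X p))"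
proof -
  have "trg G (\<lambda>a b. \<Sum>p\<in>S. c p * X p a b) = (\<Sum>i\<in>UNIV. \<Sum>p\<in>S. c p * up G (X p i) i)"
    by (simp add: trg_eq_up up_sum up_cmult)
  also have "\<dots> = (\<Sum>p\<in>S. \<Sum>i\<in>UNIV. c p * up G (X p i) i)" by (rule sum.swap)
  finally show ?thesis by (simp add: trg_eq_up sum_distrib_left)
qed

abbreviation Gi :: "(real^'n::finite \<Rightarrow> real^'m::finite) \<Rightarrow> real^'n \<Rightarrow> 'n \<Rightarrow> 'n \<Rightarrow> real" where
  "Gi f x \<equiv> \<lambda>i j. gi f i j x"

section \<open>Covariant derivatives of Ricci, scalar curvature and P\<close>

definition nabla_Ric :: "(real^'n::finite \<Rightarrow> real^'m::finite) \<Rightarrow> 'n \<Rightarrow> 'n \<Rightarrow> 'n \<Rightarrow> real^'n \<Rightarrow> real" where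
  "nabla_Ric f m j l x = trg (Gi f x) (\<lambda>i k. nabla_Rm f m i j k l x)"

definition nabla_Scal :: "(real^'n::finite \<Rightarrow> real^'m::finite) \<Rightarrow> 'n \<Rightarrow> real^'n \<Rightarrow> real" where
  "nabla_Scal f m x = trg (Gi f x) (\<lambda>j l. nabla_Ric f m j l x)"

text \<open>Only the curvature factors carry a derivative because \<open>ginv\<close> is parallel;
  \<open>pd_Ptens\<close> relates this to the coordinate derivative.\<close>

definition nabla_Ptens :: "(real^'n::finite \<Rightarrow> real^'m::finite) \<Rightarrow> 'n \<Rightarrow> 'n \<Rightarrow> 'n \<Rightarrow> 'n \<Rightarrow> 'n \<Rightarrow> real^'n \<Rightarrow> real" where
  "nabla_Ptens f m i j k l x = up4 (Gi f x) (\<lambda>a b c d. nabla_Rm f m a b c d x) i j k l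
    + up2 (Gi f x) (\<lambda>a b. nabla_Ric f m a b x) j k * gi f i l x - up2 (Gi f x) (\<lambda>a b. nabla_Ric f m a b x) j l * gi f i k x
    - up2 (Gi f x) (\<lambda>a b. nabla_Ric f m a b x) i k * gi f j l x + up2 (Gi f x) (\<lambda>a b. nabla_Ric f m a b x) i l * gi f j k x
    + 1/2 * nabla_Scal f m x * (gi f i k x * gi f j l x - gi f i l x * gi f j k x)"

lemma Rmup_eq: "Rmup f i j k l x = up4 (Gi f x) (\<lambda>a b c d. Rm f a b c d x) i j k l"
  unfolding Rmup_def up4_def up_def by (simp add: sum_distrib_left mult.assoc)

lemma Ricup_eq: "Ricup f i j x = up2 (Gi f x) (\<lambda>a b. Ric f a b x) i j"
  unfolding Ricup_def up2_def up_def by (simp add: sum_distrib_left mult.assoc)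

lemma Ric_eq: "Ric f j l x = trg (Gi f x) (\<lambda>i k. Rm f i j k l x)"
  unfolding Ric_def trg_def ..

lemma Scal_eq: "Scal f x = trg (Gi f x) (\<lambda>j l. Ric f j l x)"
  unfolding Scal_def trg_def ..

context smooth_graph
begin

lemma pd_up2:
  assumes X: "\<And>a b. smooth_fun (X a b)"
    and dX: "\<And>a b. pd m (X a b) x = Y a b + (\<Sum>p\<in>UNIV. Gam f p m a x * X p b x) + (\<Sum>p\<in>UNIV. Gam f p m b x * X a p x)"
  shows "pd m (\<lambda>x. up2 (Gi f x) (\<lambda>a b. X a b x) i j) x
    = up2 (Gi f x) Y i j - (\<Sum>p\<in>UNIV. Gam f i m p x * up2 (Gi f x) (\<lambda>a b. X a b x) p j)
       - (\<Sum>p\<in>UNIV. Gam f j m p x * up2 (Gi f x) (\<lambda>a b. X a b x) i p)"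
proof -
  have e: "pd m (\<lambda>x. up (Gi f x) (\<lambda>b. X a b x) j) x
     = up (Gi f x) (\<lambda>b. Y a b + (\<Sum>p\<in>UNIV. Gam f p m a x * X p b x)) j
      - (\<Sum>p\<in>UNIV. Gam f j m p x * up (Gi f x) (\<lambda>b. X a b x) p)" for a
    by (rule pd_up) (auto simp: X dX smooth_fun_differentiable)
  \<comment> \<open>The correction for slot \<open>a\<close> is pulled out of the inner raising; the
    bracketed rest serves as \<open>Y\<close> in the second use of \<open>pd_up\<close>.\<close>
  have e': "pd m (\<lambda>x. up (Gi f x) (\<lambda>b. X a b x) j) x
     = (up (Gi f x) (Y a) j - (\<Sum>p\<in>UNIV. Gam f j m p x * up (Gi f x) (\<lambda>b. X a b x) p))
      + (\<Sum>p\<in>UNIV. Gam f p m a x * up (Gi f x) (\<lambda>b. X p b x) j)" for a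
    unfolding e by (simp add: up_add up_sum up_cmult)
  have "pd m (\<lambda>x. up (Gi f x) (\<lambda>a. up (Gi f x) (\<lambda>b. X a b x) j) i) x
     = up (Gi f x) (\<lambda>a. up (Gi f x) (Y a) j - (\<Sum>p\<in>UNIV. Gam f j m p x * up (Gi f x) (\<lambda>b. X a b x) p)) i
      - (\<Sum>p\<in>UNIV. Gam f i m p x * up (Gi f x) (\<lambda>a. up (Gi f x) (\<lambda>b. X a b x) j) p)"
    by (rule pd_up[OF _ e']) (intro smooth_fun_differentiable smooth_intros X)
  then show ?thesis unfolding up2_def by (simp add: up_diff up_sum up_cmult)
qed

lemma smooth_up2 [smooth_intros]:
  "(\<And>a b. smooth_fun (X a b)) \<Longrightarrow> smooth_fun (\<lambda>x. up2 (Gi f x) (\<lambda>a b. X a b x) i j)"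
  unfolding up2_def by (intro smooth_intros)

lemma pd_up4:
  assumes X: "\<And>a b c d. smooth_fun (X a b c d)"
    and dX: "\<And>a b c d. pd m (X a b c d) x = Y a b c d
      + (\<Sum>p\<in>UNIV. Gam f p m a x * X p b c d x) + (\<Sum>p\<in>UNIV. Gam f p m b x * X a p c d x)
      + (\<Sum>p\<in>UNIV. Gam f p m c x * X a b p d x) + (\<Sum>p\<in>UNIV. Gam f p m d x * X a b c p x)"
  shows "pd m (\<lambda>x. up4 (Gi f x) (\<lambda>a b c d. X a b c d x) i j k l) x
    = up4 (Gi f x) Y i j k l
       - (\<Sum>p\<in>UNIV. Gam f i m p x * up4 (Gi f x) (\<lambda>a b c d. X a b c d x) p j k l)
       - (\<Sum>p\<in>UNIV. Gam f j m p x * up4 (Gi f x) (\<lambda>a b c d. X a b c d x) i p k l)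
       - (\<Sum>p\<in>UNIV. Gam f k m p x * up4 (Gi f x) (\<lambda>a b c d. X a b c d x) i j p l)
       - (\<Sum>p\<in>UNIV. Gam f l m p x * up4 (Gi f x) (\<lambda>a b c d. X a b c d x) i j k p)"
proof -
  let ?Z = "\<lambda>a b k l x. up2 (Gi f x) (\<lambda>c d. X a b c d x) k l"
  have e: "pd m (?Z a b k l) x
     = up2 (Gi f x) (\<lambda>c d. Y a b c d + (\<Sum>p\<in>UNIV. Gam f p m a x * X p b c d x) + (\<Sum>p\<in>UNIV. Gam f p m b x * X a p c d x)) k l
      - (\<Sum>p\<in>UNIV. Gam f k m p x * ?Z a b p l x) - (\<Sum>p\<in>UNIV. Gam f l m p x * ?Z a b k p x)" for a b
    by (rule pd_up2) (auto simp: X dX)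
  have e': "pd m (?Z a b k l) x
     = (up2 (Gi f x) (Y a b) k l - (\<Sum>p\<in>UNIV. Gam f k m p x * ?Z a b p l x) - (\<Sum>p\<in>UNIV. Gam f l m p x * ?Z a b k p x))
      + (\<Sum>p\<in>UNIV. Gam f p m a x * ?Z p b k l x) + (\<Sum>p\<in>UNIV. Gam f p m b x * ?Z a p k l x)" for a b
    unfolding e by (simp add: up2_add up2_sum_cmult)
  have "pd m (\<lambda>x. up2 (Gi f x) (\<lambda>a b. ?Z a b k l x) i j) x
     = up2 (Gi f x) (\<lambda>a b. up2 (Gi f x) (Y a b) k l - (\<Sum>p\<in>UNIV. Gam f k m p x * ?Z a b p l x) - (\<Sum>p\<in>UNIV. Gam f l m p x * ?Z a b k p x)) i j
      - (\<Sum>p\<in>UNIV. Gam f i m p x * up2 (Gi f x) (\<lambda>a b. ?Z a b k l x) p j)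
      - (\<Sum>p\<in>UNIV. Gam f j m p x * up2 (Gi f x) (\<lambda>a b. ?Z a b k l x) i p)"
    by (rule pd_up2[OF _ e']) (intro smooth_intros X)
  then show ?thesis unfolding up4_eq_up2 by (simp add: up2_diff up2_sum_cmult)
qed

lemma smooth_up4 [smooth_intros]:
  "(\<And>a b c d. smooth_fun (X a b c d)) \<Longrightarrow> smooth_fun (\<lambda>x. up4 (Gi f x) (\<lambda>a b c d. X a b c d x) i j k l)"
  unfolding up4_eq_up2 by (intro smooth_intros)

lemma smooth_trg [smooth_intros]:
  "(\<And>a b. smooth_fun (X a b)) \<Longrightarrow> smooth_fun (\<lambda>x. trg (Gi f x) (\<lambda>a b. X a b x))"
  unfolding trg_def by (intro smooth_intros)

lemma smooth_curv [smooth_intros]: "smooth_fun (Ric f j l)" "smooth_fun (Scal f)"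
  "smooth_fun (Rmup f i j k l)" "smooth_fun (Ricup f i j)"
proof -
  show R: "smooth_fun (Ric f j l)" for j l
    unfolding Ric_eq[abs_def] by (intro smooth_intros)
  show "smooth_fun (Scal f)" "smooth_fun (Rmup f i j k l)" "smooth_fun (Ricup f i j)"
    unfolding Scal_eq[abs_def] Rmup_eq[abs_def] Ricup_eq[abs_def] by (intro smooth_intros R)+
qed

lemma smooth_Ptens [smooth_intros]: "smooth_fun (Ptens f i j k l)"
  unfolding Ptens_def[abs_def] Let_def by (intro smooth_intros)

lemma pd_Ric: "pd m (Ric f j l) x = nabla_Ric f m j l x
    + (\<Sum>p\<in>UNIV. Gam f p m j x * Ric f p l x) + (\<Sum>p\<in>UNIV. Gam f p m l x * Ric f j p x)"
proof -
  have "pd m (\<lambda>x. trg (Gi f x) (\<lambda>i k. Rm f i j k l x)) x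
    = trg (Gi f x) (\<lambda>i k. nabla_Rm f m i j k l x + (\<Sum>p\<in>UNIV. Gam f p m j x * Rm f i p k l x)
       + (\<Sum>p\<in>UNIV. Gam f p m l x * Rm f i j k p x))"
    by (rule pd_trg) (auto simp: pd_Rm intro: smooth_fun_differentiable smooth_intros)
  then show ?thesis
    unfolding Ric_eq[symmetric] trg_add trg_sum_cmult nabla_Ric_def[symmetric] .
qed

lemma pd_Scal: "pd m (Scal f) x = nabla_Scal f m x"
proof -
  have "pd m (\<lambda>x. trg (Gi f x) (\<lambda>j l. Ric f j l x)) x = trg (Gi f x) (\<lambda>j l. nabla_Ric f m j l x)"
    by (rule pd_trg) (auto simp: pd_Ric intro: smooth_fun_differentiable smooth_intros)
  then show ?thesis unfolding Scal_eq[symmetric] nabla_Scal_def[symmetric] .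
qed

lemma pd_Ricup: "pd m (Ricup f i j) x = up2 (Gi f x) (\<lambda>a b. nabla_Ric f m a b x) i j
    - (\<Sum>p\<in>UNIV. Gam f i m p x * Ricup f p j x) - (\<Sum>p\<in>UNIV. Gam f j m p x * Ricup f i p x)"
proof -
  have "pd m (\<lambda>x. up2 (Gi f x) (\<lambda>a b. Ric f a b x) i j) x = up2 (Gi f x) (\<lambda>a b. nabla_Ric f m a b x) i j
    - (\<Sum>p\<in>UNIV. Gam f i m p x * up2 (Gi f x) (\<lambda>a b. Ric f a b x) p j)
    - (\<Sum>p\<in>UNIV. Gam f j m p x * up2 (Gi f x) (\<lambda>a b. Ric f a b x) i p)"
    by (rule pd_up2) (auto simp: pd_Ric intro: smooth_intros)
  then show ?thesis unfolding Ricup_eq[symmetric] .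
qed

lemma pd_Rmup: "pd m (Rmup f i j k l) x = up4 (Gi f x) (\<lambda>a b c d. nabla_Rm f m a b c d x) i j k l
    - (\<Sum>p\<in>UNIV. Gam f i m p x * Rmup f p j k l x) - (\<Sum>p\<in>UNIV. Gam f j m p x * Rmup f i p k l x)
    - (\<Sum>p\<in>UNIV. Gam f k m p x * Rmup f i j p l x) - (\<Sum>p\<in>UNIV. Gam f l m p x * Rmup f i j k p x)"
proof -
  have "pd m (\<lambda>x. up4 (Gi f x) (\<lambda>a b c d. Rm f a b c d x) i j k l) x = up4 (Gi f x) (\<lambda>a b c d. nabla_Rm f m a b c d x) i j k l
    - (\<Sum>p\<in>UNIV. Gam f i m p x * up4 (Gi f x) (\<lambda>a b c d. Rm f a b c d x) p j k l)
    - (\<Sum>p\<in>UNIV. Gam f j m p x * up4 (Gi f x) (\<lambda>a b c d. Rm f a b c d x) i p k l)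
    - (\<Sum>p\<in>UNIV. Gam f k m p x * up4 (Gi f x) (\<lambda>a b c d. Rm f a b c d x) i j p l)
    - (\<Sum>p\<in>UNIV. Gam f l m p x * up4 (Gi f x) (\<lambda>a b c d. Rm f a b c d x) i j k p)"
    by (rule pd_up4) (auto simp: pd_Rm intro: smooth_intros)
  then show ?thesis unfolding Rmup_eq[symmetric] .
qed

lemma pd_Ptens: "pd m (Ptens f i j k l) x = nabla_Ptens f m i j k l x
    - (\<Sum>p\<in>UNIV. Gam f i m p x * Ptens f p j k l x) - (\<Sum>p\<in>UNIV. Gam f j m p x * Ptens f i p k l x)
    - (\<Sum>p\<in>UNIV. Gam f k m p x * Ptens f i j p l x) - (\<Sum>p\<in>UNIV. Gam f l m p x * Ptens f i j k p x)"
proof -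
  note d = smooth_fun_differentiable[where x = x]
  let ?R = "\<lambda>i j. Ricup f i j x" and ?g = "\<lambda>i j. gi f i j x" and ?C = "\<lambda>i p. Gam f i m p x"
  let ?DR = "\<lambda>i j. up2 (Gi f x) (\<lambda>a b. nabla_Ric f m a b x) i j"
  have comb: "pd m (\<lambda>x. u1 x + u2 x - u3 x - u4 x + u5 x + u6 x) x
      = pd m u1 x + pd m u2 x - pd m u3 x - pd m u4 x + pd m u5 x + pd m u6 x"
    if "smooth_fun u1" "smooth_fun u2" "smooth_fun u3" "smooth_fun u4" "smooth_fun u5" "smooth_fun u6"
    for u1 u2 u3 u4 u5 u6 :: "real^'n \<Rightarrow> real"
    using that by (simp add: pd_add pd_diff d smooth_intros)
  have prod: "pd m (\<lambda>x. Ricup f a b x * gi f c d x) x = ?DR a b * ?g c d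
     - (\<Sum>p\<in>UNIV. ?C a p * (?R p b * ?g c d)) - (\<Sum>p\<in>UNIV. ?C b p * (?R a p * ?g c d))
     - (\<Sum>p\<in>UNIV. ?C c p * (?R a b * ?g p d)) - (\<Sum>p\<in>UNIV. ?C d p * (?R a b * ?g c p))" for a b c d
    by (subst pd_mult)
      (auto intro!: d smooth_intros simp: pd_Ricup pd_gi left_diff_distrib right_diff_distrib sum_distrib_left mult_ac)
  have gg: "pd m (\<lambda>x. gi f a b x * gi f c d x) x =
     - (\<Sum>p\<in>UNIV. ?C a p * (?g p b * ?g c d)) - (\<Sum>p\<in>UNIV. ?C b p * (?g a p * ?g c d))
     - (\<Sum>p\<in>UNIV. ?C c p * (?g a b * ?g p d)) - (\<Sum>p\<in>UNIV. ?C d p * (?g a b * ?g c p))" for a b c d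
    by (subst pd_mult)
      (auto intro!: d smooth_intros simp: pd_gi left_diff_distrib right_diff_distrib sum_distrib_left mult_ac)
  have sg: "pd m (\<lambda>x. 1/2 * Scal f x * (gi f i k x * gi f j l x - gi f i l x * gi f j k x)) x
     = 1/2 * nabla_Scal f m x * (?g i k * ?g j l - ?g i l * ?g j k)
      + 1/2 * Scal f x * (pd m (\<lambda>x. gi f i k x * gi f j l x) x - pd m (\<lambda>x. gi f i l x * gi f j k x) x)"
    by (subst pd_mult, (intro d smooth_intros)+, subst pd_cmult, (intro d smooth_intros)+,
        subst pd_diff, (intro d smooth_intros)+, simp add: pd_Scal)
  have "pd m (Ptens f i j k l) x = pd m (Rmup f i j k l) x
     + pd m (\<lambda>x. Ricup f j k x * gi f i l x) x - pd m (\<lambda>x. Ricup f j l x * gi f i k x) x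
     - pd m (\<lambda>x. Ricup f i k x * gi f j l x) x + pd m (\<lambda>x. Ricup f i l x * gi f j k x) x
     + pd m (\<lambda>x. 1/2 * Scal f x * (gi f i k x * gi f j l x - gi f i l x * gi f j k x)) x"
    unfolding Ptens_def[abs_def] Let_def by (rule comb) (intro smooth_intros)+
  also have "\<dots> = nabla_Ptens f m i j k l x
    - (\<Sum>p\<in>UNIV. Gam f i m p x * Ptens f p j k l x) - (\<Sum>p\<in>UNIV. Gam f j m p x * Ptens f i p k l x)
    - (\<Sum>p\<in>UNIV. Gam f k m p x * Ptens f i j p l x) - (\<Sum>p\<in>UNIV. Gam f l m p x * Ptens f i j k p x)"
  proof -
    have s: "(\<Sum>p\<in>UNIV. c p * (1/2 * Scal f x * (X p - Y p)))
      = 1/2 * Scal f x * ((\<Sum>p\<in>UNIV. c p * X p) - (\<Sum>p\<in>UNIV. c p * Y p))" for c X Y :: "'n \<Rightarrow> real"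
    proof -
      have "c p * (1/2 * Scal f x * (X p - Y p)) = 1/2 * Scal f x * (c p * X p) - 1/2 * Scal f x * (c p * Y p)" for p
        by (simp add: field_simps)
      then show ?thesis by (simp only: sum_subtractf sum_distrib_left[symmetric] right_diff_distrib)
    qed
    show ?thesis
      unfolding sg prod gg pd_Rmup nabla_Ptens_def Ptens_def Let_def
      by (simp only: distrib_left right_diff_distrib[of "Gam f _ _ _ _"] sum.distrib sum_subtractf s)
        (simp add: algebra_simps)
  qed
  finally show ?thesis .
qed

lemma div_Ptens: "(\<Sum>i\<in>UNIV. nabla_Ptens f i i j k l x) = 0"
  unfolding nabla_Ptens_def nabla_Scal_def nabla_Ric_def
  by (rule contracted_bianchi_P) (rule gi_sym nabla_Rm_anti nabla_Rm_pair second_bianchi)+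

lemma Ptens_anti: "Ptens f i j k l x = - Ptens f j i k l x" "Ptens f i j k l x = - Ptens f i j l k x"
proof -
  let ?G = "Gi f x"
  have e1: "(\<lambda>c d. Rm f a b c d x) = (\<lambda>c d. (-1) * Rm f b a c d x)" for a b
    using Rm_anti(1)[of a b] by (intro ext) simp
  have e2: "(\<lambda>d c. Rm f a b c d x) = (\<lambda>d c. (-1) * Rm f a b d c x)" for a b
    by (intro ext) (simp add: Rm_anti(2)[of a b _ _ x, symmetric])
  have "Rmup f i j k l x = up2 ?G (\<lambda>b a. up2 ?G (\<lambda>c d. Rm f a b c d x) k l) j i"
    unfolding Rmup_eq up4_eq_up2 up2_def by (rule up_swap)
  also have "\<dots> = up2 ?G (\<lambda>b a. up2 ?G (\<lambda>c d. (-1) * Rm f b a c d x) k l) j i"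
    unfolding e1 ..
  also have "\<dots> = - Rmup f j i k l x"
    unfolding Rmup_eq up4_eq_up2 by (simp only: up2_def up_cmult)
  finally have 1: "Rmup f i j k l x = - Rmup f j i k l x" .
  have "Rmup f i j k l x = up2 ?G (\<lambda>a b. up2 ?G (\<lambda>d c. Rm f a b c d x) l k) i j"
    unfolding Rmup_eq up4_eq_up2 up2_def by (subst (2) up_swap) simp
  also have "\<dots> = up2 ?G (\<lambda>a b. up2 ?G (\<lambda>d c. (-1) * Rm f a b d c x) l k) i j"
    unfolding e2 ..
  also have "\<dots> = - Rmup f i j l k x"
    unfolding Rmup_eq up4_eq_up2 by (simp only: up2_def up_cmult)
  finally have 2: "Rmup f i j k l x = - Rmup f i j l k x" .
  show "Ptens f i j k l x = - Ptens f j i k l x" "Ptens f i j k l x = - Ptens f i j l k x"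
    unfolding Ptens_def Let_def using 1 2 by (simp_all add: algebra_simps)
qed

text \<open>The push-through identity \<open>(1 + A^T A)^{-1} A^T (1 + A A^T) = A^T\<close>, where
  \<open>A\<close> has the vectors \<open>D1 f i x\<close> as columns. It links the inverse of
  \<open>Umat\<close> in the definition of \<open>Tt\<close> with the Christoffel symbols.\<close>

lemma Umat_V1: "(\<Sum>c\<in>UNIV. V1 f s x $ c * Umat f x $ c $ d) = D1 f s x $ d"
proof -
  have "(\<Sum>c\<in>UNIV. V1 f s x $ c * Umat f x $ c $ d) = V1 f s x $ d + (\<Sum>i\<in>UNIV. (V1 f s x \<bullet> D1 f i x) * D1 f i x $ d)"
  proof -
    have "(\<Sum>c\<in>UNIV. V1 f s x $ c * (if c = d then 1 else 0)) = V1 f s x $ d"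
      by (simp add: if_distrib cong: if_cong)
    moreover have "(\<Sum>c\<in>UNIV. V1 f s x $ c * (\<Sum>i\<in>UNIV. D1 f i x $ c * D1 f i x $ d))
      = (\<Sum>i\<in>UNIV. (V1 f s x \<bullet> D1 f i x) * D1 f i x $ d)"
      unfolding inner_vec_def sum_distrib_left sum_distrib_right inner_real_def
      by (subst sum.swap) (simp add: mult.assoc)
    ultimately show ?thesis
      unfolding Umat_def by (simp add: D1_def distrib_left sum.distrib)
  qed
  also have "V1 f s x $ d = (\<Sum>i\<in>UNIV. gi f s i x * D1 f i x $ d)"
    unfolding V1_def by simp
  also have "\<dots> + (\<Sum>i\<in>UNIV. (V1 f s x \<bullet> D1 f i x) * D1 f i x $ d)
      = (\<Sum>i\<in>UNIV. (gi f s i x + V1 f s x \<bullet> D1 f i x) * D1 f i x $ d)"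
    by (simp add: distrib_right sum.distrib)
  also have "\<dots> = (\<Sum>i\<in>UNIV. (\<Sum>q\<in>UNIV. gi f s q x * gc f q i x) * D1 f i x $ d)"
  proof -
    have "(\<Sum>q\<in>UNIV. gi f s q x * gc f q i x) = (\<Sum>q\<in>UNIV. gi f s q x * (if q = i then 1 else 0)) + V1 f s x \<bullet> D1 f i x" for i
      unfolding V1_inner gc_eq by (simp only: distrib_left sum.distrib)
    then show ?thesis by (simp add: if_distrib cong: if_cong)
  qed
  also have "\<dots> = D1 f s x $ d"
    unfolding gi_gc by (simp add: if_distrib if_distribR cong: if_cong)
  finally show ?thesis .
qed

lemma invertible_Umat: "invertible (Umat f x)"
proof -
  have "v = 0" if v: "Umat f x *v v = 0" for v
  proof -
    have "v \<bullet> (Umat f x *v v) = v \<bullet> v + (\<Sum>i\<in>UNIV. (D1 f i x \<bullet> v)\<^sup>2)"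
    proof -
      have "(Umat f x *v v) $ a = v $ a + (\<Sum>i\<in>UNIV. D1 f i x $ a * (D1 f i x \<bullet> v))" for a
      proof -
        have "(Umat f x *v v) $ a = (\<Sum>b\<in>UNIV. (if a = b then 1 else 0) * v $ b)
           + (\<Sum>b\<in>UNIV. \<Sum>i\<in>UNIV. D1 f i x $ a * (D1 f i x $ b * v $ b))"
          unfolding Umat_def matrix_vector_mult_def D1_def
          by (simp only: vec_lambda_beta distrib_right sum.distrib sum_distrib_right mult.assoc)
        also have "(\<Sum>b\<in>UNIV. \<Sum>i\<in>UNIV. D1 f i x $ a * (D1 f i x $ b * v $ b))
          = (\<Sum>i\<in>UNIV. D1 f i x $ a * (D1 f i x \<bullet> v))"
          unfolding inner_vec_def sum_distrib_left inner_real_def by (rule sum.swap)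
        finally show ?thesis by (simp add: if_distrib if_distribR cong: if_cong)
      qed
      then have "Umat f x *v v = v + (\<Sum>i\<in>UNIV. (D1 f i x \<bullet> v) *\<^sub>R D1 f i x)"
        by (simp add: vec_eq_iff mult.commute)
      then show ?thesis
        by (simp add: inner_add_right inner_sum_right power2_eq_square inner_commute)
    qed
    then have "v \<bullet> v + (\<Sum>i\<in>UNIV. (D1 f i x \<bullet> v)\<^sup>2) = 0" using v by simp
    moreover have "(\<Sum>i\<in>UNIV. (D1 f i x \<bullet> v)\<^sup>2) \<ge> 0" by (intro sum_nonneg) simp
    ultimately have "v \<bullet> v \<le> 0" by linarith
    then show ?thesis by (metis inner_ge_zero inner_eq_zero_iff order_antisym)
  qed
  then show ?thesis
    unfolding invertible_left_inverse matrix_left_invertible_ker by blast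
qed

lemma V1_eq_Umat_inv: "V1 f s x $ c = (\<Sum>b\<in>UNIV. matrix_inv (Umat f x) $ b $ c * D1 f s x $ b)"
proof -
  have "Umat f x ** matrix_inv (Umat f x) = mat 1"
    using someI_ex[OF invertible_Umat[unfolded invertible_def, of x]] by (simp add: matrix_inv_def)
  then have u: "(\<Sum>b\<in>UNIV. Umat f x $ d $ b * matrix_inv (Umat f x) $ b $ c) = (if d = c then 1 else 0)" for d
    by (simp add: matrix_matrix_mult_def mat_def vec_eq_iff)
  have "(\<Sum>b\<in>UNIV. matrix_inv (Umat f x) $ b $ c * D1 f s x $ b)
     = (\<Sum>d\<in>UNIV. V1 f s x $ d * (\<Sum>b\<in>UNIV. Umat f x $ d $ b * matrix_inv (Umat f x) $ b $ c))"
    unfolding Umat_V1[symmetric] sum_distrib_left by (subst sum.swap) (simp add: mult_ac)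
  then show ?thesis unfolding u by (simp add: if_distrib cong: if_cong)
qed

text \<open>Contracting U^{-1} with a first and a second derivative gives a Christoffel symbol, by
  \<open>V1_eq_Umat_inv\<close>. In this form \<open>Tt\<close> can be matched with the terms left
  over in the divergence of the flux field.\<close>

lemma Tt_eq: "Tt f i j k l x = (\<Sum>s\<in>UNIV. Gam f s j s x * (D2 f i l x \<bullet> D1 f k x)
    - Gam f s i l x * (D2 f j s x \<bullet> D1 f k x))"
proof -
  let ?U = "\<lambda>b c. matrix_inv (Umat f x) $ b $ c"
  have "Tt f i j k l x = (\<Sum>b\<in>UNIV. \<Sum>c\<in>UNIV. \<Sum>s\<in>UNIV. \<Sum>a\<in>UNIV.
      ?U b c * D1 f s x $ b * D1 f k x $ a * (D2 f j s x $ c * D2 f i l x $ a - D2 f i l x $ c * D2 f j s x $ a))"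
    unfolding Tt_def D1_def D2_def by simp
  also have "\<dots> = (\<Sum>b\<in>UNIV. \<Sum>s\<in>UNIV. \<Sum>c\<in>UNIV. ?U b c * D1 f s x $ b *
      (D2 f j s x $ c * (D2 f i l x \<bullet> D1 f k x) - D2 f i l x $ c * (D2 f j s x \<bullet> D1 f k x)))"
  proof (rule sum.cong[OF refl])
    fix b
    have "(\<Sum>a\<in>UNIV. ?U b c * D1 f s x $ b * D1 f k x $ a * (D2 f j s x $ c * D2 f i l x $ a - D2 f i l x $ c * D2 f j s x $ a))
       = ?U b c * D1 f s x $ b * (D2 f j s x $ c * (D2 f i l x \<bullet> D1 f k x) - D2 f i l x $ c * (D2 f j s x \<bullet> D1 f k x))" for s c
      unfolding inner_vec_def inner_real_def
      by (simp add: sum_distrib_left right_diff_distrib sum_subtractf mult_ac)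
    then show "(\<Sum>c\<in>UNIV. \<Sum>s\<in>UNIV. \<Sum>a\<in>UNIV.
      ?U b c * D1 f s x $ b * D1 f k x $ a * (D2 f j s x $ c * D2 f i l x $ a - D2 f i l x $ c * D2 f j s x $ a))
      = (\<Sum>s\<in>UNIV. \<Sum>c\<in>UNIV. ?U b c * D1 f s x $ b *
      (D2 f j s x $ c * (D2 f i l x \<bullet> D1 f k x) - D2 f i l x $ c * (D2 f j s x \<bullet> D1 f k x)))"
      by simp (rule sum.swap)
  qed
  also have "\<dots> = (\<Sum>s\<in>UNIV. \<Sum>c\<in>UNIV. \<Sum>b\<in>UNIV. ?U b c * D1 f s x $ b *
      (D2 f j s x $ c * (D2 f i l x \<bullet> D1 f k x) - D2 f i l x $ c * (D2 f j s x \<bullet> D1 f k x)))"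
    by (subst sum.swap, rule sum.cong[OF refl], rule sum.swap)
  also have "\<dots> = (\<Sum>s\<in>UNIV. \<Sum>c\<in>UNIV. V1 f s x $ c *
      (D2 f j s x $ c * (D2 f i l x \<bullet> D1 f k x) - D2 f i l x $ c * (D2 f j s x \<bullet> D1 f k x)))"
    unfolding V1_eq_Umat_inv sum_distrib_right ..
  also have "\<dots> = (\<Sum>s\<in>UNIV. Gam f s j s x * (D2 f i l x \<bullet> D1 f k x)
    - Gam f s i l x * (D2 f j s x \<bullet> D1 f k x))"
    unfolding Gam_eq inner_vec_def[of "V1 f _ x"] inner_real_def
    by (simp add: right_diff_distrib sum_subtractf sum_distrib_right mult.assoc)
  finally show ?thesis .
qed

end

lemma sum_rot4: "(\<Sum>j\<in>A. \<Sum>k\<in>B. \<Sum>l\<in>C. \<Sum>i\<in>D. X i j k l) = (\<Sum>i\<in>D. \<Sum>j\<in>A. \<Sum>k\<in>B. \<Sum>l\<in>C. X i j k l)"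
proof -
  have "(\<Sum>j\<in>A. \<Sum>k\<in>B. \<Sum>l\<in>C. \<Sum>i\<in>D. X i j k l) = (\<Sum>j\<in>A. \<Sum>k\<in>B. \<Sum>i\<in>D. \<Sum>l\<in>C. X i j k l)"
    by (intro sum.cong refl sum.swap)
  also have "\<dots> = (\<Sum>j\<in>A. \<Sum>i\<in>D. \<Sum>k\<in>B. \<Sum>l\<in>C. X i j k l)"
    by (intro sum.cong refl sum.swap)
  finally show ?thesis by (simp only: sum.swap[of _ D A])
qed

lemma sum_swap13: "(\<Sum>k\<in>A. \<Sum>l\<in>B. \<Sum>p\<in>A. X k l p) = (\<Sum>k\<in>A. \<Sum>l\<in>B. \<Sum>p\<in>A. X p l k)"
proof -
  have "(\<Sum>k\<in>A. \<Sum>l\<in>B. \<Sum>p\<in>A. X k l p) = (\<Sum>l\<in>B. \<Sum>k\<in>A. \<Sum>p\<in>A. X k l p)" by (rule sum.swap)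
  also have "\<dots> = (\<Sum>l\<in>B. \<Sum>k\<in>A. \<Sum>p\<in>A. X p l k)" by (rule sum.cong[OF refl], rule sum.swap)
  also have "\<dots> = (\<Sum>k\<in>A. \<Sum>l\<in>B. \<Sum>p\<in>A. X p l k)" by (rule sum.swap)
  finally show ?thesis .
qed

definition flux_field :: "(real^'n::finite \<Rightarrow> real^'m::finite) \<Rightarrow> 'n \<Rightarrow> real^'n \<Rightarrow> real" where
  "flux_field f i x = (\<Sum>j\<in>UNIV. \<Sum>k\<in>UNIV. \<Sum>l\<in>UNIV. Ptens f i j k l x * pd l (gc f j k) x)"

context smooth_graph
begin

lemma smooth_flux_field: "smooth_fun (flux_field f i)"
  unfolding flux_field_def[abs_def] by (intro smooth_intros smooth_fun_pd)

text \<open>The other half of the metric derivative, \<open>D1 f j x \<bullet> D2 f k l x\<close>,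
  is symmetric in \<open>k\<close> and \<open>l\<close> and is annihilated by the antisymmetry of
  P.\<close>

lemma flux_field_eq: "flux_field f i x
    = (\<Sum>j\<in>UNIV. \<Sum>k\<in>UNIV. \<Sum>l\<in>UNIV. Ptens f i j k l x * (D2 f j l x \<bullet> D1 f k x))"
proof -
  have z: "(\<Sum>k\<in>UNIV. \<Sum>l\<in>UNIV. Ptens f i j k l x * (D1 f j x \<bullet> D2 f k l x)) = 0" for j
  proof -
    let ?S = "\<Sum>k\<in>UNIV. \<Sum>l\<in>UNIV. Ptens f i j k l x * (D1 f j x \<bullet> D2 f k l x)"
    have "?S = (\<Sum>l\<in>UNIV. \<Sum>k\<in>UNIV. Ptens f i j k l x * (D1 f j x \<bullet> D2 f k l x))" by (rule sum.swap)
    also have "\<dots> = - ?S"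
      by (subst Ptens_anti(2), subst D2_sym) (simp add: sum_negf)
    finally show ?thesis by simp
  qed
  have "(\<Sum>k\<in>UNIV. \<Sum>l\<in>UNIV. Ptens f i j k l x * pd l (gc f j k) x)
     = (\<Sum>k\<in>UNIV. \<Sum>l\<in>UNIV. Ptens f i j k l x * (D2 f j l x \<bullet> D1 f k x))" for j
    using z[of j] by (simp add: pd_gc distrib_left sum.distrib)
  then show ?thesis unfolding flux_field_def by simp
qed

lemma pd_flux_field: "pd m (flux_field f i) x = (\<Sum>j\<in>UNIV. \<Sum>k\<in>UNIV. \<Sum>l\<in>UNIV.
    pd m (Ptens f i j k l) x * (D2 f j l x \<bullet> D1 f k x)
    + Ptens f i j k l x * (D3 f j l m x \<bullet> D1 f k x + D2 f j l x \<bullet> D2 f k m x))"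
proof -
  have t: "pd m (\<lambda>x. Ptens f i j k l x * (D2 f j l x \<bullet> D1 f k x)) x =
    pd m (Ptens f i j k l) x * (D2 f j l x \<bullet> D1 f k x)
    + Ptens f i j k l x * (D3 f j l m x \<bullet> D1 f k x + D2 f j l x \<bullet> D2 f k m x)" for j k l
    by (subst pd_mult) (auto intro!: smooth_fun_differentiable smooth_intros simp: pd_inner_D)
  have s: "smooth_fun (\<lambda>x. Ptens f i j k l x * (D2 f j l x \<bullet> D1 f k x))" for j k l
    by (intro smooth_intros)
  note d = smooth_fun_differentiable[where x = x]
  show ?thesis
    unfolding flux_field_eq[abs_def] t[symmetric]
    by (simp add: pd_sum d smooth_fun_sum s)
qed

text \<open>P kills whatever is symmetric in \<open>i, j\<close> or in \<open>k, l\<close>: the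
  third derivatives and the Christoffel correction for slot \<open>j\<close> disappear. Of the other
  corrections, the one for slot \<open>k\<close> completes the product of second derivatives to the
  Gauss form, and those for slots \<open>i\<close> and \<open>l\<close> make up
  \<open>Tt\<close>.\<close>

theorem divergence_flux_field: "(\<Sum>i\<in>UNIV. pd i (flux_field f i) x) = 1/2 * (L2 f x + L2perp f x)"
proof -
  let ?P = "\<lambda>i j k l. Ptens f i j k l x" and ?h = "\<lambda>i j. D2 f i j x" and ?A = "\<lambda>k. D1 f k x"
    and ?C = "\<lambda>k i j. Gam f k i j x"
  define w where "w = (\<lambda>j k l. ?h j l \<bullet> ?A k)"
  define S where "S = (\<lambda>X. \<Sum>i\<in>UNIV. \<Sum>j\<in>UNIV. \<Sum>k\<in>UNIV. \<Sum>l\<in>UNIV. ?P i j k l * (X :: 'n \<Rightarrow> 'n \<Rightarrow> 'n \<Rightarrow> 'n \<Rightarrow> real) i j k l)"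
  have S_add: "S (\<lambda>i j k l. X i j k l + Y i j k l) = S X + S Y"
    and S_diff: "S (\<lambda>i j k l. X i j k l - Y i j k l) = S X - S Y" for X Y
    unfolding S_def by (simp_all add: distrib_left right_diff_distrib sum.distrib sum_subtractf)
  have S_ij: "S (\<lambda>i j k l. X j i k l) = - S X" for X
  proof -
    have "S (\<lambda>i j k l. X j i k l) = (\<Sum>j\<in>UNIV. \<Sum>i\<in>UNIV. \<Sum>k\<in>UNIV. \<Sum>l\<in>UNIV. ?P i j k l * X j i k l)"
      unfolding S_def by (rule sum.swap)
    then show ?thesis unfolding S_def by (subst (asm) Ptens_anti(1)) (simp add: sum_negf)
  qed
  have S_kl: "S (\<lambda>i j k l. X i j l k) = - S X" for X
  proof -
    have "S (\<lambda>i j k l. X i j l k) = (\<Sum>i\<in>UNIV. \<Sum>j\<in>UNIV. \<Sum>l\<in>UNIV. \<Sum>k\<in>UNIV. ?P i j k l * X i j l k)"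
      unfolding S_def by (intro sum.cong refl sum.swap)
    then show ?thesis unfolding S_def by (subst (asm) Ptens_anti(2)) (simp add: sum_negf)
  qed
  define gam where "gam = (\<lambda>p. \<Sum>i\<in>UNIV. ?C i i p)"
  have D: "(\<Sum>i\<in>UNIV. pd i (Ptens f i j k l) x) = - (\<Sum>p\<in>UNIV. gam p * ?P p j k l)
      - (\<Sum>i\<in>UNIV. \<Sum>p\<in>UNIV. ?C k i p * ?P i j p l) - (\<Sum>i\<in>UNIV. \<Sum>p\<in>UNIV. ?C l i p * ?P i j k p)" for j k l
  proof -
    have z: "(\<Sum>i\<in>UNIV. \<Sum>p\<in>UNIV. ?C j i p * ?P i p k l) = 0"
    proof -
      let ?S = "\<Sum>i\<in>UNIV. \<Sum>p\<in>UNIV. ?C j i p * ?P i p k l"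
      have "?S = (\<Sum>p\<in>UNIV. \<Sum>i\<in>UNIV. ?C j i p * ?P i p k l)" by (rule sum.swap)
      also have "\<dots> = - ?S"
        by (subst Ptens_anti(1), subst Gam_sym) (simp add: sum_negf)
      finally show ?thesis by simp
    qed
    have g: "(\<Sum>i\<in>UNIV. \<Sum>p\<in>UNIV. ?C i i p * ?P p j k l) = (\<Sum>p\<in>UNIV. gam p * ?P p j k l)"
      unfolding gam_def sum_distrib_right by (rule sum.swap)
    have "(\<Sum>i\<in>UNIV. pd i (Ptens f i j k l) x) = (\<Sum>i\<in>UNIV. nabla_Ptens f i i j k l x)
      - (\<Sum>i\<in>UNIV. \<Sum>p\<in>UNIV. ?C i i p * ?P p j k l) - (\<Sum>i\<in>UNIV. \<Sum>p\<in>UNIV. ?C j i p * ?P i p k l)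
      - (\<Sum>i\<in>UNIV. \<Sum>p\<in>UNIV. ?C k i p * ?P i j p l) - (\<Sum>i\<in>UNIV. \<Sum>p\<in>UNIV. ?C l i p * ?P i j k p)"
      unfolding pd_Ptens by (simp add: sum_subtractf)
    then show ?thesis unfolding div_Ptens z g by simp
  qed
  have T1: "(\<Sum>j\<in>UNIV. \<Sum>k\<in>UNIV. \<Sum>l\<in>UNIV. (\<Sum>p\<in>UNIV. gam p * ?P p j k l) * w j k l) = S (\<lambda>i j k l. gam i * w j k l)"
    unfolding S_def sum_distrib_right by (subst sum_rot4) (simp add: mult_ac)
  have T3: "(\<Sum>j\<in>UNIV. \<Sum>k\<in>UNIV. \<Sum>l\<in>UNIV. (\<Sum>i\<in>UNIV. \<Sum>p\<in>UNIV. ?C k i p * ?P i j p l) * w j k l)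
     = S (\<lambda>i j k l. \<Sum>p\<in>UNIV. ?C p i k * w j p l)"
  proof -
    have "(\<Sum>j\<in>UNIV. \<Sum>k\<in>UNIV. \<Sum>l\<in>UNIV. (\<Sum>i\<in>UNIV. \<Sum>p\<in>UNIV. ?C k i p * ?P i j p l) * w j k l)
      = (\<Sum>i\<in>UNIV. \<Sum>j\<in>UNIV. \<Sum>k\<in>UNIV. \<Sum>l\<in>UNIV. \<Sum>p\<in>UNIV. ?C k i p * ?P i j p l * w j k l)"
      unfolding sum_distrib_right by (rule sum_rot4)
    also have "\<dots> = (\<Sum>i\<in>UNIV. \<Sum>j\<in>UNIV. \<Sum>k\<in>UNIV. \<Sum>l\<in>UNIV. \<Sum>p\<in>UNIV. ?C p i k * ?P i j k l * w j p l)"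
      by (intro sum.cong refl sum_swap13)
    also have "\<dots> = S (\<lambda>i j k l. \<Sum>p\<in>UNIV. ?C p i k * w j p l)"
      unfolding S_def by (simp add: sum_distrib_left mult_ac)
    finally show ?thesis .
  qed
  have T4: "(\<Sum>j\<in>UNIV. \<Sum>k\<in>UNIV. \<Sum>l\<in>UNIV. (\<Sum>i\<in>UNIV. \<Sum>p\<in>UNIV. ?C l i p * ?P i j k p) * w j k l)
     = S (\<lambda>i j k l. \<Sum>p\<in>UNIV. ?C p i l * w j k p)"
  proof -
    have "(\<Sum>j\<in>UNIV. \<Sum>k\<in>UNIV. \<Sum>l\<in>UNIV. (\<Sum>i\<in>UNIV. \<Sum>p\<in>UNIV. ?C l i p * ?P i j k p) * w j k l)
      = (\<Sum>i\<in>UNIV. \<Sum>j\<in>UNIV. \<Sum>k\<in>UNIV. \<Sum>l\<in>UNIV. \<Sum>p\<in>UNIV. ?C l i p * ?P i j k p * w j k l)"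
      unfolding sum_distrib_right by (rule sum_rot4)
    also have "\<dots> = (\<Sum>i\<in>UNIV. \<Sum>j\<in>UNIV. \<Sum>k\<in>UNIV. \<Sum>l\<in>UNIV. \<Sum>p\<in>UNIV. ?C p i l * ?P i j k l * w j k p)"
      by (intro sum.cong refl sum.swap)
    also have "\<dots> = S (\<lambda>i j k l. \<Sum>p\<in>UNIV. ?C p i l * w j k p)"
      unfolding S_def by (simp add: sum_distrib_left mult_ac)
    finally show ?thesis .
  qed
  have D3z: "S (\<lambda>i j k l. D3 f j l i x \<bullet> ?A k) = 0"
  proof -
    have "D3 f j l i x = D3 f i l j x" for i j l
      using D3_sym(2)[of j l i x] D3_sym(1)[of j i l x] D3_sym(2)[of i j l x] by simp
    then have "S (\<lambda>i j k l. D3 f j l i x \<bullet> ?A k) = S (\<lambda>i j k l. D3 f i l j x \<bullet> ?A k)" by simp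
    then show ?thesis using S_ij[of "\<lambda>i j k l. D3 f j l i x \<bullet> ?A k"] by simp
  qed
  have "(\<Sum>i\<in>UNIV. pd i (flux_field f i) x)
    = (\<Sum>i\<in>UNIV. \<Sum>j\<in>UNIV. \<Sum>k\<in>UNIV. \<Sum>l\<in>UNIV. pd i (Ptens f i j k l) x * w j k l)
      + S (\<lambda>i j k l. D3 f j l i x \<bullet> ?A k + ?h j l \<bullet> ?h k i)"
    unfolding pd_flux_field S_def w_def by (simp add: sum.distrib)
  also have "(\<Sum>i\<in>UNIV. \<Sum>j\<in>UNIV. \<Sum>k\<in>UNIV. \<Sum>l\<in>UNIV. pd i (Ptens f i j k l) x * w j k l)
    = (\<Sum>j\<in>UNIV. \<Sum>k\<in>UNIV. \<Sum>l\<in>UNIV. (\<Sum>i\<in>UNIV. pd i (Ptens f i j k l) x) * w j k l)"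
    unfolding sum_distrib_right by (rule sum_rot4[symmetric])
  also have "\<dots> = - S (\<lambda>i j k l. gam i * w j k l) - S (\<lambda>i j k l. \<Sum>p\<in>UNIV. ?C p i k * w j p l)
      - S (\<lambda>i j k l. \<Sum>p\<in>UNIV. ?C p i l * w j k p)"
    unfolding D T1[symmetric] T3[symmetric] T4[symmetric]
    by (simp add: left_diff_distrib sum_subtractf sum_negf)
  finally have E: "(\<Sum>i\<in>UNIV. pd i (flux_field f i) x) =
     - S (\<lambda>i j k l. gam i * w j k l) - S (\<lambda>i j k l. \<Sum>p\<in>UNIV. ?C p i k * w j p l)
      - S (\<lambda>i j k l. \<Sum>p\<in>UNIV. ?C p i l * w j k p) + S (\<lambda>i j k l. ?h j l \<bullet> ?h k i)"
    unfolding S_add D3z by simp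
  have bfS: "S (\<lambda>i j k l. ?h j l \<bullet> ?h k i) - S (\<lambda>i j k l. \<Sum>p\<in>UNIV. ?C p i k * w j p l) = S (\<lambda>i j k l. Uinv_form f x (?h i k) (?h j l))"
    unfolding S_diff[symmetric] w_def Uinv_form_D2_eq
    by (simp add: inner_commute D2_sym[of _ _ x])
  \<comment> \<open>The two halves of the Gauss equation contribute equally because P is
    antisymmetric in its last two indices; hence the factor 2.\<close>
  have L2: "L2 f x = 2 * S (\<lambda>i j k l. Uinv_form f x (?h i k) (?h j l))"
  proof -
    have "L2 f x = S (\<lambda>i j k l. Uinv_form f x (?h i k) (?h j l) - Uinv_form f x (?h i l) (?h j k))"
      unfolding L2_def S_def gauss_equation ..
    then show ?thesis
      unfolding S_diff using S_kl[of "\<lambda>i j k l. Uinv_form f x (?h i k) (?h j l)"] by simp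
  qed
  \<comment> \<open>\<open>Tt\<close> carries the Christoffel trace at index \<open>j\<close>, the
    divergence carries it at \<open>i\<close>; exchanging the two costs a sign.\<close>
  have Lp: "L2perp f x = 2 * (- S (\<lambda>i j k l. gam i * w j k l) - S (\<lambda>i j k l. \<Sum>p\<in>UNIV. ?C p i l * w j k p))"
  proof -
    have "L2perp f x = 2 * S (\<lambda>i j k l. gam j * w i k l - (\<Sum>p\<in>UNIV. ?C p i l * w j k p))"
      unfolding L2perp_def S_def Tt_eq gam_def w_def
      by (simp add: sum_subtractf sum_distrib_right Gam_sym)
    then show ?thesis
      unfolding S_diff using S_ij[of "\<lambda>i j k l. gam i * w j k l"] by simp
  qed
  show ?thesis unfolding E L2 Lp bfS[symmetric] by simp
qed

end

section \<open>Flat normal bundle\<close>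

lemma up_multc: "up G (\<lambda>a. X a * c) i = up G X i * c"
  unfolding up_def by (simp add: sum_distrib_right mult.assoc)

lemma trg_eq_sum_out: "trg G (\<lambda>a b. \<Sum>p\<in>S. X p a b) = (\<Sum>p\<in>S. trg G (X p))"
  using trg_sum_cmult[where c = "\<lambda>_. 1"] by simp

definition hess :: "(real^'n::finite \<Rightarrow> real^'m::finite) \<Rightarrow> 'm \<Rightarrow> real^'n \<Rightarrow> real^'n^'n" where
  "hess f a x = (\<chi> i j. D2 f i j x $ a)"

lemma shape_eq: "shape f a x = hess f a x ** ginv f x"
  unfolding shape_def hess_def D2_def matrix_matrix_mult_def by simp

lemma hess_nth: "hess f a x $ i $ j = D2 f i j x $ a"
  unfolding hess_def by simp

lemma matrix_scaleR_mult:
  fixes A :: "real^'n::finite^'k::finite" and B :: "real^'l::finite^'n"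
  shows "(c *\<^sub>R A) ** B = c *\<^sub>R (A ** B)" "A ** (c *\<^sub>R B) = c *\<^sub>R (A ** B)"
  by (simp_all add: matrix_matrix_mult_def vec_eq_iff sum_distrib_left mult_ac)

lemma matrix_add_rdistrib:
  fixes A B :: "real^'n::finite^'k::finite" and C :: "real^'l::finite^'n"
  shows "(A + B) ** C = A ** C + B ** C"
  by (simp add: matrix_matrix_mult_def vec_eq_iff distrib_right sum.distrib)

text \<open>If the shape operators commute, this set contains \<open>g\<^sup>-\<^sup>1\<close> and is closed under
  \<open>X \<mapsto> X H g\<^sup>-\<^sup>1\<close> for the Hessian \<open>H\<close> of each component of \<open>f\<close>, so it contains every matrix
  that arises from contracting \<open>P\<close> with such Hessians.\<close>
definition commuting :: "(real^'n::finite \<Rightarrow> real^'m::finite) \<Rightarrow> real^'n \<Rightarrow> (real^'n^'n) set" where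
  "commuting f x = {X. transpose X = X \<and> (\<forall>c. X ** hess f c x ** ginv f x = ginv f x ** hess f c x ** X)}"

lemma commuting_add: "X \<in> commuting f x \<Longrightarrow> Y \<in> commuting f x \<Longrightarrow> X + Y \<in> commuting f x"
  unfolding commuting_def
  by (simp add: matrix_add_ldistrib matrix_add_rdistrib) (simp add: transpose_def vec_eq_iff)

lemma commuting_scaleR: "X \<in> commuting f x \<Longrightarrow> c *\<^sub>R X \<in> commuting f x"
  unfolding commuting_def by (simp add: matrix_scaleR_mult) (simp add: transpose_def vec_eq_iff)

lemma commuting_zero: "0 \<in> commuting f x"
  unfolding commuting_def by (simp add: transpose_def vec_eq_iff matrix_matrix_mult_def)

lemma commuting_diff: "X \<in> commuting f x \<Longrightarrow> Y \<in> commuting f x \<Longrightarrow> X - Y \<in> commuting f x"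
  using commuting_add[of X f x "(-1) *\<^sub>R Y"] commuting_scaleR[of Y f x "-1"] by simp

lemma commuting_sum: "(\<And>a. a \<in> A \<Longrightarrow> X a \<in> commuting f x) \<Longrightarrow> (\<Sum>a\<in>A. X a) \<in> commuting f x"
  by (induction A rule: infinite_finite_induct) (auto simp: commuting_zero commuting_add)

lemma commuting_sym: "X \<in> commuting f x \<Longrightarrow> X $ i $ j = X $ j $ i"
  unfolding commuting_def by (auto simp: transpose_def vec_eq_iff)

context smooth_graph
begin

lemma transpose_hess: "transpose (hess f a x) = hess f a x"
  unfolding transpose_def hess_def using D2_sym by (simp add: vec_eq_iff)

lemma commuting_ginv: "ginv f x \<in> commuting f x"
  unfolding commuting_def by (simp add: transpose_ginv)

lemma hess_commute:
  assumes "flat_normal_bundle f"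
  shows "hess f a x ** ginv f x ** hess f b x = hess f b x ** ginv f x ** hess f a x"
proof -
  have "shape f a x ** shape f b x = shape f b x ** shape f a x"
    using assms unfolding flat_normal_bundle_def by blast
  then have "(hess f a x ** ginv f x ** hess f b x) ** ginv f x = (hess f b x ** ginv f x ** hess f a x) ** ginv f x"
    unfolding shape_eq by (simp add: matrix_mul_assoc)
  from arg_cong[OF this, of "\<lambda>X. X ** metric f x"] show ?thesis
    by (simp add: matrix_mul_assoc[symmetric] ginv_mult)
qed

text \<open>The transpose of the word is its reversal, which membership of \<open>X\<close>
  identifies with the word itself. A further Hessian is moved through by exchanging it first with
  \<open>hess f c x\<close>, by \<open>hess_commute\<close>, and then with \<open>X\<close>.\<close>

lemma commuting_step:
  assumes flat: "flat_normal_bundle f" and X: "X \<in> commuting f x"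
  shows "X ** hess f c x ** ginv f x \<in> commuting f x"
proof -
  let ?M = "\<lambda>c. hess f c x" and ?g = "ginv f x"
  have Xc: "X ** ?M c ** ?g = ?g ** ?M c ** X" and Xs: "transpose X = X" for c
    using X unfolding commuting_def by auto
  have "transpose (X ** ?M c ** ?g) = ?g ** ?M c ** X"
    by (simp add: matrix_transpose_mul transpose_ginv transpose_hess Xs matrix_mul_assoc)
  moreover have "X ** ?M c ** ?g ** ?M d ** ?g = ?g ** ?M d ** (X ** ?M c ** ?g)" for d
  proof -
    have "X ** ?M c ** ?g ** ?M d ** ?g = X ** (?M c ** ?g ** ?M d) ** ?g"
      by (simp add: matrix_mul_assoc)
    also have "\<dots> = (X ** ?M d ** ?g) ** ?M c ** ?g"
      unfolding hess_commute[OF flat, of c x d] by (simp add: matrix_mul_assoc)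
    also have "\<dots> = ?g ** ?M d ** (X ** ?M c ** ?g)"
      unfolding Xc[of d] by (simp add: matrix_mul_assoc)
    finally show ?thesis .
  qed
  ultimately show ?thesis unfolding commuting_def by (simp add: Xc)
qed

definition Uinv_coeff :: "'m \<Rightarrow> 'm \<Rightarrow> real^'n \<Rightarrow> real" where
  "Uinv_coeff a b x = Uinv_form f x (axis a 1) (axis b 1)"

lemma Uinv_form_eq_Uinv_coeff: "Uinv_form f x u v = (\<Sum>a\<in>UNIV. \<Sum>b\<in>UNIV. Uinv_coeff a b x * (u $ a * v $ b))"
proof -
  have "Uinv_form f x u v = Uinv_form f x (\<Sum>a\<in>UNIV. u $ a *\<^sub>R axis a 1) v"
    by (metis (no_types, lifting) basis_expansion scalar_mult_eq_scaleR sum.cong)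
  also have "\<dots> = (\<Sum>a\<in>UNIV. u $ a * Uinv_form f x v (axis a 1))"
    unfolding Uinv_form_sum_left Uinv_form_linear Uinv_form_sym[of x v] ..
  also have "\<dots> = (\<Sum>a\<in>UNIV. u $ a * Uinv_form f x (\<Sum>b\<in>UNIV. v $ b *\<^sub>R axis b 1) (axis a 1))"
    by (metis (no_types, lifting) basis_expansion scalar_mult_eq_scaleR sum.cong)
  also have "\<dots> = (\<Sum>a\<in>UNIV. \<Sum>b\<in>UNIV. Uinv_coeff a b x * (u $ a * v $ b))"
    unfolding Uinv_form_sum_left Uinv_form_linear Uinv_coeff_def sum_distrib_left
    by (simp add: Uinv_form_sym[of x "axis _ 1" "axis _ 1"] mult_ac)
  finally show ?thesis .
qed

definition hessup :: "'m \<Rightarrow> real^'n \<Rightarrow> real^'n^'n" where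
  "hessup a x = ginv f x ** hess f a x ** ginv f x"

lemma up2_eq_matrix: "up2 (Gi f x) X i j = (ginv f x ** (\<chi> a b. X a b) ** ginv f x) $ i $ j"
proof -
  have "up2 (Gi f x) X i j = (\<Sum>a\<in>UNIV. \<Sum>b\<in>UNIV. gi f i a x * X a b * gi f b j x)"
    unfolding up2_def up_def by (simp add: sum_distrib_left gi_sym[of _ j] mult_ac)
  also have "\<dots> = (\<Sum>b\<in>UNIV. \<Sum>a\<in>UNIV. gi f i a x * X a b * gi f b j x)" by (rule sum.swap)
  finally show ?thesis by (simp add: matrix_matrix_mult_def sum_distrib_right)
qed

text \<open>The Gauss equation with raised indices, split into products of entries of raised
  Hessians so that contractions with it become matrix products.\<close>

lemma Rmup_eq_hessup: "Rmup f i j k l x = (\<Sum>a\<in>UNIV. \<Sum>b\<in>UNIV. Uinv_coeff a b x *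
    (hessup a x $ i $ k * hessup b x $ j $ l - hessup a x $ i $ l * hessup b x $ j $ k))"
proof -
  let ?G = "Gi f x"
  have N: "hessup a x $ i $ k = up ?G (\<lambda>p. up ?G (\<lambda>q. D2 f p q x $ a) k) i" for a i k
    using up2_eq_matrix[of x "\<lambda>p q. D2 f p q x $ a" i k] unfolding hessup_def hess_def up2_def by simp
  have s: "up ?G (\<lambda>p. \<Sum>a\<in>UNIV. Z a p) i = (\<Sum>a\<in>UNIV. up ?G (\<lambda>p. Z a p) i)" for Z :: "'m \<Rightarrow> 'n \<Rightarrow> real" and i
    by (rule up_sum)
  have c1: "up4 ?G (\<lambda>i j k l. D2 f i k x $ a * D2 f j l x $ b) i j k l = hessup a x $ i $ k * hessup b x $ j $ l" for a b
    unfolding up4_def N by (simp only: up_cmult up_multc)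
  have c2: "up4 ?G (\<lambda>i j k l. D2 f i l x $ a * D2 f j k x $ b) i j k l = hessup a x $ i $ l * hessup b x $ j $ k" for a b
    unfolding up4_def N by (simp only: up_cmult up_multc)
  have "Rmup f i j k l x = up4 ?G (\<lambda>i j k l. \<Sum>a\<in>UNIV. \<Sum>b\<in>UNIV. Uinv_coeff a b x *
     (D2 f i k x $ a * D2 f j l x $ b - D2 f i l x $ a * D2 f j k x $ b)) i j k l"
    unfolding Rmup_eq gauss_equation Uinv_form_eq_Uinv_coeff
    by (simp add: sum_subtractf[symmetric] right_diff_distrib)
  also have "\<dots> = (\<Sum>a\<in>UNIV. \<Sum>b\<in>UNIV. Uinv_coeff a b x *
     (up4 ?G (\<lambda>i j k l. D2 f i k x $ a * D2 f j l x $ b) i j k l - up4 ?G (\<lambda>i j k l. D2 f i l x $ a * D2 f j k x $ b) i j k l))"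
    unfolding up4_def by (simp only: s up_cmult up_diff)
  finally show ?thesis unfolding c1 c2 .
qed

text \<open>Tracing the Gauss equation leaves multiples of Hessians and products of two Hessians
  with \<open>ginv\<close> between them. After raising both indices these are words generated from
  \<open>ginv\<close> by \<open>commuting_step\<close>.\<close>

lemma Ricup_commuting:
  assumes flat: "flat_normal_bundle f"
  shows "(\<chi> i j. Ricup f i j x) \<in> commuting f x"
proof -
  let ?g = "ginv f x" and ?M = "\<lambda>a. hess f a x"
  have Ric: "(\<chi> j l. Ric f j l x) = (\<Sum>a\<in>UNIV. \<Sum>b\<in>UNIV. Uinv_coeff a b x *\<^sub>R
     (trg (Gi f x) (\<lambda>i k. ?M a $ i $ k) *\<^sub>R ?M b - ?M b ** ?g ** ?M a))"
  proof -
    have "Ric f j l x = (\<Sum>a\<in>UNIV. \<Sum>b\<in>UNIV. Uinv_coeff a b x *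
      (trg (Gi f x) (\<lambda>i k. ?M a $ i $ k) * ?M b $ j $ l - (?M b ** ?g ** ?M a) $ j $ l))" for j l
    proof -
      have "trg (Gi f x) (\<lambda>i k. D2 f i k x $ a * D2 f j l x $ b) = trg (Gi f x) (\<lambda>i k. ?M a $ i $ k) * ?M b $ j $ l" for a b
        unfolding trg_def by (simp add: hess_nth sum_distrib_right sum_distrib_left mult_ac)
      moreover have "trg (Gi f x) (\<lambda>i k. D2 f i l x $ a * D2 f j k x $ b) = (?M b ** ?g ** ?M a) $ j $ l" for a b
        unfolding trg_def
        by (simp add: hess_nth matrix_matrix_mult_def sum_distrib_right sum_distrib_left gi_sym mult_ac)
      ultimately show ?thesis
        unfolding Ric_eq gauss_equation Uinv_form_eq_Uinv_coeff sum_subtractf[symmetric] right_diff_distrib[symmetric]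
        by (simp add: trg_sum_cmult trg_diff trg_eq_sum_out)
    qed
    then show ?thesis by (simp add: vec_eq_iff)
  qed
  have "(\<chi> i j. Ricup f i j x) = ?g ** (\<chi> j l. Ric f j l x) ** ?g"
    unfolding Ricup_eq up2_eq_matrix by (simp add: vec_eq_iff)
  also have "\<dots> = (\<Sum>a\<in>UNIV. \<Sum>b\<in>UNIV. Uinv_coeff a b x *\<^sub>R
     (trg (Gi f x) (\<lambda>i k. ?M a $ i $ k) *\<^sub>R (?g ** ?M b ** ?g) - ?g ** ?M b ** ?g ** ?M a ** ?g))"
  proof -
    have l: "linear (\<lambda>X. ?g ** X ** ?g)"
      by (auto intro!: linearI simp: matrix_add_ldistrib matrix_add_rdistrib matrix_scaleR_mult)
    show ?thesis unfolding Ric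
      by (simp add: linear_sum[OF l] linear_cmul[OF l] linear_diff[OF l] matrix_mul_assoc)
  qed
  also have "\<dots> \<in> commuting f x"
    by (intro commuting_sum commuting_scaleR commuting_diff commuting_step[OF flat] commuting_ginv)
  finally show ?thesis .
qed

text \<open>Every summand of P is built from products of two symmetric matrices whose indices are
  paired as \<open>ik, jl\<close> or as \<open>il, jk\<close>. The first pairing contracts to one
  matrix word, the second to a scalar times a shorter word. All these words lie in
  \<open>commuting\<close> and so are symmetric in \<open>k\<close> and \<open>q\<close>.\<close>

lemma flat_contraction_sym:
  fixes x :: "real^'n"
  assumes flat: "flat_normal_bundle f"
  defines "Y \<equiv> \<lambda>a c k q. \<Sum>i\<in>UNIV. \<Sum>j\<in>UNIV. \<Sum>l\<in>UNIV. Ptens f i j k l x *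
      (hess f a x $ i $ l * (hess f c x ** ginv f x) $ j $ q)"
  shows "Y a c k q = Y a c q k"
proof -
  let ?g = "ginv f x" and ?M = "\<lambda>a. hess f a x" and ?Q = "hess f c x ** ginv f x"
  let ?R = "\<chi> i j. Ricup f i j x"
  define E where "E = (\<lambda>H. \<chi> k q. \<Sum>i\<in>UNIV. \<Sum>j\<in>UNIV. \<Sum>l\<in>UNIV. H i j k l * (?M a $ i $ l * ?Q $ j $ q) :: real^'n^'n)"
  have E_lin: "E (\<lambda>i j k l. H i j k l + H' i j k l) = E H + E H'"
    "E (\<lambda>i j k l. H i j k l - H' i j k l) = E H - E H'"
    "E (\<lambda>i j k l. r * H i j k l) = r *\<^sub>R E H" for H H' r
    unfolding E_def vec_eq_iff
    by (simp_all add: distrib_right left_diff_distrib sum.distrib sum_subtractf sum_distrib_left mult.assoc)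
  have E_sum: "E (\<lambda>i j k l. \<Sum>s\<in>S. H s i j k l) = (\<Sum>s\<in>S. E (H s))" for S :: "'m set" and H
  proof (induction S rule: infinite_finite_induct)
    case (insert s S)
    then show ?case by (simp add: E_lin)
  qed (simp_all add: E_def vec_eq_iff)
  have E1: "E (\<lambda>i j k l. X $ i $ k * Z $ j $ l) = X ** ?M a ** Z ** ?M c ** ?g"
    if "transpose X = X" "transpose Z = Z" for X Z
  proof -
    have s: "X $ i $ k = X $ k $ i" "Z $ i $ k = Z $ k $ i" for i k
      using that by (auto simp: transpose_def vec_eq_iff)
    have "(X ** ?M a ** Z ** ?Q) $ k $ q = E (\<lambda>i j k l. X $ i $ k * Z $ j $ l) $ k $ q" for k q
    proof -
      have "(X ** ?M a ** Z ** ?Q) $ k $ q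
        = (\<Sum>j\<in>UNIV. \<Sum>l\<in>UNIV. \<Sum>i\<in>UNIV. X $ i $ k * Z $ j $ l * (?M a $ i $ l * ?Q $ j $ q))"
        unfolding matrix_matrix_mult_def[of _ ?Q] matrix_matrix_mult_def[of _ Z] matrix_matrix_mult_def[of X]
        by (simp add: sum_distrib_right sum_distrib_left s(1)[of _ k] s(2)[of _ "_"] mult_ac)
      also have "\<dots> = (\<Sum>j\<in>UNIV. \<Sum>i\<in>UNIV. \<Sum>l\<in>UNIV. X $ i $ k * Z $ j $ l * (?M a $ i $ l * ?Q $ j $ q))"
        by (intro sum.cong refl sum.swap)
      also have "\<dots> = (\<Sum>i\<in>UNIV. \<Sum>j\<in>UNIV. \<Sum>l\<in>UNIV. X $ i $ k * Z $ j $ l * (?M a $ i $ l * ?Q $ j $ q))"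
        by (rule sum.swap)
      finally show ?thesis unfolding E_def by simp
    qed
    then show ?thesis by (simp add: vec_eq_iff matrix_mul_assoc)
  qed
  have E2: "E (\<lambda>i j k l. X $ i $ l * Z $ j $ k) = (\<Sum>i\<in>UNIV. \<Sum>l\<in>UNIV. X $ i $ l * ?M a $ i $ l) *\<^sub>R (Z ** ?M c ** ?g)"
    if "transpose Z = Z" for X Z
  proof -
    have s: "Z $ i $ k = Z $ k $ i" for i k
      using that by (auto simp: transpose_def vec_eq_iff)
    have "(\<Sum>i\<in>UNIV. \<Sum>l\<in>UNIV. X $ i $ l * ?M a $ i $ l) * (Z ** ?Q) $ k $ q = E (\<lambda>i j k l. X $ i $ l * Z $ j $ k) $ k $ q" for k q
    proof -
      have "(\<Sum>i\<in>UNIV. \<Sum>l\<in>UNIV. X $ i $ l * ?M a $ i $ l) * (Z ** ?Q) $ k $ q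
        = (\<Sum>j\<in>UNIV. \<Sum>i\<in>UNIV. \<Sum>l\<in>UNIV. X $ i $ l * Z $ j $ k * (?M a $ i $ l * ?Q $ j $ q))"
        unfolding matrix_matrix_mult_def[of _ ?Q]
        by (simp add: sum_distrib_right sum_distrib_left s[of _ k] mult_ac)
      also have "\<dots> = (\<Sum>i\<in>UNIV. \<Sum>j\<in>UNIV. \<Sum>l\<in>UNIV. X $ i $ l * Z $ j $ k * (?M a $ i $ l * ?Q $ j $ q))"
        by (rule sum.swap)
      finally show ?thesis unfolding E_def by simp
    qed
    then show ?thesis by (simp add: vec_eq_iff matrix_mul_assoc)
  qed
  have N: "hessup b x \<in> commuting f x" for b
    unfolding hessup_def by (intro commuting_step[OF flat] commuting_ginv)
  have R: "?R \<in> commuting f x" by (rule Ricup_commuting[OF flat])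
  have tr: "X \<in> commuting f x \<Longrightarrow> transpose X = X" for X unfolding commuting_def by simp
  have E2c: "E (\<lambda>i j k l. X $ i $ l * Z $ j $ k) \<in> commuting f x" if "Z \<in> commuting f x" for X Z
    unfolding E2[OF tr[OF that]] by (intro commuting_scaleR commuting_step[OF flat] that)
  have E1g: "E (\<lambda>i j k l. X $ i $ k * ?g $ j $ l) \<in> commuting f x" if "X \<in> commuting f x" for X
    unfolding E1[OF tr[OF that] transpose_ginv] by (intro commuting_step[OF flat] that)
  \<comment> \<open>Here the word starts with \<open>ginv\<close> and \<open>Z\<close> stands third.
    Membership of \<open>Z\<close> in \<open>commuting\<close> turns the word round to start with
    \<open>Z\<close>, where \<open>commuting_step\<close> applies.\<close>
  have Eg1: "E (\<lambda>i j k l. ?g $ i $ k * Z $ j $ l) \<in> commuting f x" if Z: "Z \<in> commuting f x" for Z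
  proof -
    have "?g ** ?M a ** Z = Z ** ?M a ** ?g" using Z unfolding commuting_def by simp
    then show ?thesis
      unfolding E1[OF transpose_ginv tr[OF Z]] by (simp add: commuting_step[OF flat] Z)
  qed
  have E1N: "E (\<lambda>i j k l. hessup b x $ i $ k * hessup d x $ j $ l) \<in> commuting f x" for b d
  proof -
    have "hessup b x ** ?M a ** hessup d x ** ?M c ** ?g = ?g ** ?M b ** ?g ** ?M a ** ?g ** ?M d ** ?g ** ?M c ** ?g"
      unfolding hessup_def by (simp add: matrix_mul_assoc)
    then show ?thesis unfolding E1[OF tr[OF N] tr[OF N]]
      by (simp add: commuting_step[OF flat] commuting_ginv)
  qed
  \<comment> \<open>The Ricci terms are written with the factor carrying index \<open>i\<close>
    first, to match \<open>E2c\<close>, \<open>E1g\<close> and \<open>Eg1\<close>.\<close>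
  have Peq: "(\<lambda>i j k l. Ptens f i j k l x) = (\<lambda>i j k l.
      (\<Sum>b\<in>UNIV. \<Sum>d\<in>UNIV. Uinv_coeff b d x * (hessup b x $ i $ k * hessup d x $ j $ l - hessup b x $ i $ l * hessup d x $ j $ k))
      + ?g $ i $ l * ?R $ j $ k - ?g $ i $ k * ?R $ j $ l - ?R $ i $ k * ?g $ j $ l + ?R $ i $ l * ?g $ j $ k
      + 1/2 * Scal f x * (?g $ i $ k * ?g $ j $ l - ?g $ i $ l * ?g $ j $ k))"
    unfolding Ptens_def Let_def Rmup_eq_hessup by (simp add: fun_eq_iff mult.commute)
  have "E (\<lambda>i j k l. Ptens f i j k l x) \<in> commuting f x"
    unfolding Peq E_lin E_sum
    by (intro commuting_add commuting_diff commuting_sum commuting_scaleR E1N E2c E1g Eg1 R N commuting_ginv)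
  then have "E (\<lambda>i j k l. Ptens f i j k l x) $ k $ q = E (\<lambda>i j k l. Ptens f i j k l x) $ q $ k"
    by (rule commuting_sym)
  then show ?thesis unfolding E_def Y_def by simp
qed

end

text \<open>The index \<open>k\<close> stays free because the symmetry coming from the flat normal
  bundle exchanges \<open>k\<close> with an index outside P.\<close>

definition contr :: "('n::finite \<Rightarrow> 'n \<Rightarrow> 'n \<Rightarrow> 'n \<Rightarrow> real) \<Rightarrow> 'n \<Rightarrow> ('n \<Rightarrow> 'n \<Rightarrow> 'n \<Rightarrow> real) \<Rightarrow> real" where
  "contr P k H = (\<Sum>i\<in>UNIV. \<Sum>j\<in>UNIV. \<Sum>l\<in>UNIV. P i j k l * H i j l)"

lemma contr_diff: "contr P k (\<lambda>i j l. H i j l - H' i j l) = contr P k H - contr P k H'"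
  and contr_add: "contr P k (\<lambda>i j l. H i j l + H' i j l) = contr P k H + contr P k H'"
  and contr_cmult: "contr P k (\<lambda>i j l. c * H i j l) = c * contr P k H"
  and contr_zero: "contr P k (\<lambda>i j l. 0) = 0"
  unfolding contr_def
  by (simp_all add: right_diff_distrib distrib_left sum_subtractf sum.distrib sum_distrib_left mult.left_commute)

lemma contr_sum: "contr P k (\<lambda>i j l. \<Sum>s\<in>S. H s i j l) = (\<Sum>s\<in>S. contr P k (H s))"
  by (induction S rule: infinite_finite_induct) (simp_all add: contr_add contr_zero)

lemma sum_swap22: "(\<Sum>a\<in>A. \<Sum>b\<in>B. \<Sum>c\<in>C. \<Sum>d\<in>D. X a b c d) = (\<Sum>c\<in>C. \<Sum>d\<in>D. \<Sum>a\<in>A. \<Sum>b\<in>B. X a b c d)"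
proof -
  have "(\<Sum>a\<in>A. \<Sum>b\<in>B. \<Sum>c\<in>C. \<Sum>d\<in>D. X a b c d) = (\<Sum>a\<in>A. \<Sum>c\<in>C. \<Sum>d\<in>D. \<Sum>b\<in>B. X a b c d)"
    by (rule sum.cong[OF refl], subst sum.swap, intro sum.cong refl sum.swap)
  also have "\<dots> = (\<Sum>c\<in>C. \<Sum>d\<in>D. \<Sum>a\<in>A. \<Sum>b\<in>B. X a b c d)"
    by (subst sum.swap, intro sum.cong refl sum.swap)
  finally show ?thesis .
qed

context smooth_graph
begin

text \<open>Made explicit in the components of f, \<open>Tt\<close> is antisymmetrized over
  \<open>a\<close> and \<open>c\<close> in the Hessians. Exchanging the pairs \<open>(k, a)\<close>
  and \<open>(q, c)\<close> preserves the prefactor, so symmetry of the contraction in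
  \<open>k\<close> and \<open>q\<close> forces cancellation in \<open>L2perp_flat\<close>.\<close>

lemma Tt_eq_hess: "Tt f i j k l x = (\<Sum>a\<in>UNIV. \<Sum>q\<in>UNIV. \<Sum>c\<in>UNIV. (D1 f k x $ a * D1 f q x $ c) *
   (hess f a x $ i $ l * (hess f c x ** ginv f x) $ j $ q - hess f c x $ i $ l * (hess f a x ** ginv f x) $ j $ q))"
proof -
  let ?A = "\<lambda>k a. D1 f k x $ a" and ?Mg = "\<lambda>c j q. (hess f c x ** ginv f x) $ j $ q"
  have Mg: "(\<Sum>s\<in>UNIV. gi f s q x * D2 f j s x $ c) = ?Mg c j q" for q j c
    by (simp add: matrix_matrix_mult_def hess_nth mult.commute)
  have 1: "(\<Sum>s\<in>UNIV. Gam f s j s x) = (\<Sum>q\<in>UNIV. \<Sum>c\<in>UNIV. ?A q c * ?Mg c j q)"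
  proof -
    have "(\<Sum>s\<in>UNIV. Gam f s j s x) = (\<Sum>s\<in>UNIV. \<Sum>q\<in>UNIV. \<Sum>c\<in>UNIV. ?A q c * (gi f s q x * D2 f j s x $ c))"
      unfolding Gam_eq V1_inner inner_vec_def[of "D1 f _ x"] inner_real_def by (simp add: sum_distrib_left mult_ac)
    also have "\<dots> = (\<Sum>q\<in>UNIV. \<Sum>s\<in>UNIV. \<Sum>c\<in>UNIV. ?A q c * (gi f s q x * D2 f j s x $ c))" by (rule sum.swap)
    also have "\<dots> = (\<Sum>q\<in>UNIV. \<Sum>c\<in>UNIV. \<Sum>s\<in>UNIV. ?A q c * (gi f s q x * D2 f j s x $ c))"
      by (intro sum.cong refl sum.swap)
    finally show ?thesis unfolding sum_distrib_left[symmetric] Mg .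
  qed
  have 2: "(\<Sum>s\<in>UNIV. Gam f s i l x * (D2 f j s x \<bullet> D1 f k x))
     = (\<Sum>q\<in>UNIV. (D1 f q x \<bullet> D2 f i l x) * (\<Sum>a\<in>UNIV. ?A k a * ?Mg a j q))"
  proof -
    have "(\<Sum>s\<in>UNIV. Gam f s i l x * (D2 f j s x \<bullet> D1 f k x))
      = (\<Sum>s\<in>UNIV. \<Sum>q\<in>UNIV. \<Sum>a\<in>UNIV. (D1 f q x \<bullet> D2 f i l x) * (?A k a * (gi f s q x * D2 f j s x $ a)))"
      unfolding Gam_eq V1_inner inner_vec_def[of "D2 f j _ x"] inner_real_def
      by (simp add: sum_distrib_left sum_distrib_right mult_ac)
    also have "\<dots> = (\<Sum>q\<in>UNIV. \<Sum>s\<in>UNIV. \<Sum>a\<in>UNIV. (D1 f q x \<bullet> D2 f i l x) * (?A k a * (gi f s q x * D2 f j s x $ a)))"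
      by (rule sum.swap)
    also have "\<dots> = (\<Sum>q\<in>UNIV. \<Sum>a\<in>UNIV. \<Sum>s\<in>UNIV. (D1 f q x \<bullet> D2 f i l x) * (?A k a * (gi f s q x * D2 f j s x $ a)))"
      by (intro sum.cong refl sum.swap)
    finally show ?thesis unfolding sum_distrib_left[symmetric] Mg .
  qed
  have "Tt f i j k l x = (\<Sum>s\<in>UNIV. Gam f s j s x) * (D2 f i l x \<bullet> D1 f k x)
     - (\<Sum>q\<in>UNIV. (D1 f q x \<bullet> D2 f i l x) * (\<Sum>a\<in>UNIV. ?A k a * ?Mg a j q))"
    unfolding Tt_eq by (simp add: sum_subtractf sum_distrib_right 2)
  also have "(\<Sum>s\<in>UNIV. Gam f s j s x) * (D2 f i l x \<bullet> D1 f k x)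
     = (\<Sum>a\<in>UNIV. \<Sum>q\<in>UNIV. \<Sum>c\<in>UNIV. ?A k a * ?A q c * (hess f a x $ i $ l * ?Mg c j q))"
    unfolding 1 inner_vec_def inner_real_def hess_nth sum_distrib_left
    by (simp add: sum_distrib_right sum_distrib_left mult_ac)
  also have "(\<Sum>q\<in>UNIV. (D1 f q x \<bullet> D2 f i l x) * (\<Sum>a\<in>UNIV. ?A k a * ?Mg a j q))
     = (\<Sum>a\<in>UNIV. \<Sum>q\<in>UNIV. \<Sum>c\<in>UNIV. ?A k a * ?A q c * (hess f c x $ i $ l * ?Mg a j q))"
  proof -
    have "(\<Sum>q\<in>UNIV. (D1 f q x \<bullet> D2 f i l x) * (\<Sum>a\<in>UNIV. ?A k a * ?Mg a j q))
      = (\<Sum>q\<in>UNIV. \<Sum>a\<in>UNIV. \<Sum>c\<in>UNIV. ?A k a * ?A q c * (hess f c x $ i $ l * ?Mg a j q))"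
      unfolding inner_vec_def inner_real_def hess_nth sum_distrib_left
      by (simp add: sum_distrib_right sum_distrib_left mult_ac)
    also have "\<dots> = (\<Sum>a\<in>UNIV. \<Sum>q\<in>UNIV. \<Sum>c\<in>UNIV. ?A k a * ?A q c * (hess f c x $ i $ l * ?Mg a j q))"
      by (rule sum.swap)
    finally show ?thesis .
  qed
  finally show ?thesis by (simp add: right_diff_distrib sum_subtractf)
qed

lemma L2perp_flat:
  assumes flat: "flat_normal_bundle f"
  shows "L2perp f x = 0"
proof -
  let ?A = "\<lambda>k a. D1 f k x $ a"
  define Y where "Y = (\<lambda>a c k q. contr (\<lambda>i j k l. Ptens f i j k l x) k
     (\<lambda>i j l. hess f a x $ i $ l * (hess f c x ** ginv f x) $ j $ q))"
  have Y: "Y a c k q = Y a c q k" for a c k q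
    unfolding Y_def contr_def by (rule flat_contraction_sym[OF flat])
  have "(\<Sum>i\<in>UNIV. \<Sum>j\<in>UNIV. \<Sum>k\<in>UNIV. \<Sum>l\<in>UNIV. Ptens f i j k l x * Tt f i j k l x)
     = (\<Sum>k\<in>UNIV. contr (\<lambda>i j k l. Ptens f i j k l x) k (\<lambda>i j l. Tt f i j k l x))"
  proof -
    have "(\<Sum>i\<in>UNIV. \<Sum>j\<in>UNIV. \<Sum>k\<in>UNIV. \<Sum>l\<in>UNIV. Ptens f i j k l x * Tt f i j k l x)
      = (\<Sum>i\<in>UNIV. \<Sum>k\<in>UNIV. \<Sum>j\<in>UNIV. \<Sum>l\<in>UNIV. Ptens f i j k l x * Tt f i j k l x)"
      by (intro sum.cong refl sum.swap)
    also have "\<dots> = (\<Sum>k\<in>UNIV. \<Sum>i\<in>UNIV. \<Sum>j\<in>UNIV. \<Sum>l\<in>UNIV. Ptens f i j k l x * Tt f i j k l x)"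
      by (rule sum.swap)
    finally show ?thesis unfolding contr_def .
  qed
  also have "\<dots> = (\<Sum>k\<in>UNIV. \<Sum>a\<in>UNIV. \<Sum>q\<in>UNIV. \<Sum>c\<in>UNIV. ?A k a * ?A q c * (Y a c k q - Y c a k q))"
    unfolding Tt_eq_hess contr_sum contr_cmult contr_diff Y_def ..
  also have "\<dots> = (\<Sum>k\<in>UNIV. \<Sum>a\<in>UNIV. \<Sum>q\<in>UNIV. \<Sum>c\<in>UNIV. ?A k a * ?A q c * Y a c k q)
      - (\<Sum>k\<in>UNIV. \<Sum>a\<in>UNIV. \<Sum>q\<in>UNIV. \<Sum>c\<in>UNIV. ?A k a * ?A q c * Y c a k q)"
    by (simp add: right_diff_distrib sum_subtractf)
  also have "(\<Sum>k\<in>UNIV. \<Sum>a\<in>UNIV. \<Sum>q\<in>UNIV. \<Sum>c\<in>UNIV. ?A k a * ?A q c * Y c a k q)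
     = (\<Sum>q\<in>UNIV. \<Sum>c\<in>UNIV. \<Sum>k\<in>UNIV. \<Sum>a\<in>UNIV. ?A q c * ?A k a * Y c a q k)"
    by (subst sum_swap22) (simp add: mult.commute Y[of _ _ _ _])
  finally show ?thesis unfolding L2perp_def by simp
qed

end

section \<open>Decay at infinity and the mass formula\<close>

definition decays :: "real \<Rightarrow> (real^'n::finite \<Rightarrow> real) \<Rightarrow> bool" where
  "decays p h \<longleftrightarrow> h \<in> O[at_infinity](\<lambda>x. norm x powr - p)"

lemma decaysI:
  assumes "\<And>x. norm x \<ge> R \<Longrightarrow> \<bar>h x\<bar> \<le> c * norm x powr - p"
  shows "decays p h"
  unfolding decays_def
  by (rule bigoI[of _ c]) (use assms in \<open>auto simp: eventually_at_infinity\<close>)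

lemma decays_add: "decays p u \<Longrightarrow> decays p v \<Longrightarrow> decays p (\<lambda>x. u x + v x)"
  and decays_diff: "decays p u \<Longrightarrow> decays p v \<Longrightarrow> decays p (\<lambda>x. u x - v x)"
  unfolding decays_def by (rule sum_in_bigo, assumption+)+

lemma decays_cmult: "decays p u \<Longrightarrow> decays p (\<lambda>x. c * u x)"
  unfolding decays_def by (cases "c = 0") simp_all

lemma decays_sum: "(\<And>a. a \<in> A \<Longrightarrow> decays p (u a)) \<Longrightarrow> decays p (\<lambda>x. \<Sum>a\<in>A. u a x)"
  unfolding decays_def by (rule big_sum_in_bigo)

lemma decays_mult: "decays p u \<Longrightarrow> decays q v \<Longrightarrow> decays (p + q) (\<lambda>x. u x * v x)"
  unfolding decays_def by (drule (1) landau_o.big.mult) (simp add: powr_add[symmetric] add.commute)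

lemma decays_weaken:
  assumes "decays p (u :: real^'n::finite \<Rightarrow> real)" "q \<le> p"
  shows "decays q u"
proof -
  have "decays q (\<lambda>x::real^'n. norm x powr - p)"
    by (rule decaysI[of 1 _ 1]) (use assms in \<open>auto intro!: powr_mono\<close>)
  then show ?thesis
    using assms(1) unfolding decays_def by (rule landau_o.big_trans[rotated])
qed

section \<open>Integrability of decaying functions\<close>

lemma sphere_int_radial_power:
  "sphere_int r (\<lambda>x::real^'n::finite. (1 + norm x) powr - p)
    = real CARD('n) * r ^ (CARD('n) - 1) * (measure lborel (ball (0::real^'n) 1) * (1 + r) powr - p)" if "r \<ge> 0"
proof -
  have "sphere_int r (\<lambda>x::real^'n. (1 + norm x) powr - p) = sphere_int r (\<lambda>x::real^'n. (1 + r) powr - p * 1)"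
    by (rule sphere_int_cong) (use that in auto)
  also have "\<dots> = (1 + r) powr - p * sphere_int r (\<lambda>x::real^'n. 1)" by (rule sphere_int_cmult)
  also have "sphere_int r (\<lambda>x::real^'n. 1) = real CARD('n) * r ^ (CARD('n) - 1) * measure lborel (ball (0::real^'n) 1)"
    unfolding sphere_int_def using lmeasure_integral[of "ball (0::real^'n) 1"] by simp
  finally show ?thesis by simp
qed

text \<open>The radial derivative of the ball integrals, given by
  \<open>DERIV_integral_ball\<close>, is compared with an explicit power; this bounds them, and
  monotone convergence yields integrability. The shift \<open>1 + norm x\<close> avoids a
  singularity at the origin.\<close>

lemma absolutely_integrable_radial_power:
  assumes p: "p > real CARD('n)"
  shows "(\<lambda>x::real^'n::finite. (1 + norm x) powr - p) absolutely_integrable_on UNIV"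
proof -
  let ?H = "\<lambda>x::real^'n. (1 + norm x) powr - p" and ?n = "real CARD('n)"
  let ?om = "measure lborel (ball (0::real^'n) 1)"
  have ne: "1 + norm x \<noteq> 0" for x :: "real^'n" using norm_ge_zero[of x] by linarith
  have nabla_D2: "continuous_on S ?H" for S
    using ne by (intro continuous_intros) auto
  have Hint: "?H absolutely_integrable_on ball 0 r" for r
    by (rule continuous_absolutely_integrable_ball[OF nabla_D2])
  define V where "V = (\<lambda>r. integral (ball 0 r) ?H)"
  \<comment> \<open>The added term is \<open>?n * ?om\<close> times the integral of
    \<open>(1 + s) powr (?n - p - 1)\<close> over \<open>s > r\<close>, finite because
    \<open>p > ?n\<close>. It turns the growth bound on \<open>V\<close> into monotonicity of
    \<open>D\<close>.\<close>
  define D where "D = (\<lambda>r. V r + ?n * ?om / (p - ?n) * (1 + r) powr (?n - p))"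
  have Dd: "(D has_real_derivative (sphere_int r ?H - ?n * ?om * (1 + r) powr (?n - p - 1))) (at r)" if "r > 0" for r
    unfolding D_def V_def
    by (rule derivative_eq_intros DERIV_integral_ball nabla_D2 that refl | use that p in \<open>simp add: field_simps\<close>)+
  have neg: "sphere_int r ?H - ?n * ?om * (1 + r) powr (?n - p - 1) \<le> 0" if "r > 0" for r
  proof -
    have "r ^ (CARD('n) - 1) \<le> (1 + r) ^ (CARD('n) - 1)" using that by (intro power_mono) auto
    also have "\<dots> = (1 + r) powr (?n - 1)"
      using that by (subst powr_realpow[symmetric]) (auto simp: of_nat_diff Suc_leI)
    finally have "r ^ (CARD('n) - 1) * (1 + r) powr - p \<le> (1 + r) powr (?n - 1) * (1 + r) powr - p"
      by (rule mult_right_mono) simp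
    also have "\<dots> = (1 + r) powr (?n - p - 1)" unfolding powr_add[symmetric] by (simp add: algebra_simps)
    finally have "?n * ?om * (r ^ (CARD('n) - 1) * (1 + r) powr - p) \<le> ?n * ?om * (1 + r) powr (?n - p - 1)"
      by (rule mult_left_mono) simp
    then show ?thesis using that by (simp add: sphere_int_radial_power mult_ac)
  qed
  have bound: "V r \<le> D 1" if "r \<ge> 1" for r
  proof -
    have "D r \<le> D 1"
    proof (rule DERIV_nonpos_imp_nonincreasing[OF that])
      fix s :: real assume "1 \<le> s" "s \<le> r"
      then have "s > 0" by simp
      then show "\<exists>y. (D has_real_derivative y) (at s) \<and> y \<le> 0" using Dd neg by blast
    qed
    moreover have "V r \<le> D r" unfolding D_def using p by simp
    ultimately show ?thesis by simp
  qed
  \<comment> \<open>The radii \<open>Suc k\<close> are at least 1, where \<open>bound\<close> is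
    available.\<close>
  let ?f = "\<lambda>k x. if x \<in> ball 0 (real (Suc k)) then ?H x else 0"
  have "?H integrable_on UNIV \<and> (\<lambda>k. integral UNIV (?f k)) \<longlonglongrightarrow> integral UNIV ?H"
  proof (rule monotone_convergence_increasing)
    show "?f k integrable_on UNIV" for k
      using Hint[of "real (Suc k)"] unfolding integrable_restrict_UNIV absolutely_integrable_on_def by blast
    show "?f k x \<le> ?f (Suc k) x" for k x by auto
    show "(\<lambda>k. ?f k x) \<longlonglongrightarrow> ?H x" for x
    proof (rule tendsto_eventually)
      obtain N where "norm x < real N" using reals_Archimedean2 by blast
      then show "\<forall>\<^sub>F k in sequentially. ?f k x = ?H x"
        unfolding eventually_sequentially by (intro exI[of _ N]) auto
    qed
    have "\<bar>integral UNIV (?f k)\<bar> \<le> D 1" for k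
    proof -
      have "integral UNIV (?f k) = V (real (Suc k))" unfolding V_def by (rule integral_restrict_UNIV)
      moreover have "V (real (Suc k)) \<ge> 0"
        unfolding V_def by (rule Henstock_Kurzweil_Integration.integral_nonneg)
          (use Hint in \<open>auto simp: absolutely_integrable_on_def\<close>)
      ultimately show ?thesis using bound[of "real (Suc k)"] by simp
    qed
    then show "bounded (range (\<lambda>k. integral UNIV (?f k)))"
      unfolding bounded_iff by (intro exI[of _ "D 1"]) auto
  qed
  then show ?thesis
    by (intro nonnegative_absolutely_integrable_1) auto
qed

lemma continuous_decays_absolutely_integrable:
  fixes h :: "real^'n::finite \<Rightarrow> real"
  assumes c: "continuous_on UNIV h" and d: "decays p h" and p: "p > real CARD('n)"
  shows "h absolutely_integrable_on UNIV"
proof -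
  have p0: "p > 0" using p by (smt (verit) of_nat_0_le_iff)
  obtain C where "\<forall>\<^sub>F x in at_infinity. \<bar>h x\<bar> \<le> C * norm x powr - p"
    using d unfolding decays_def by (elim landau_o.bigE) auto
  then obtain b where b: "\<And>x. norm x \<ge> b \<Longrightarrow> \<bar>h x\<bar> \<le> C * norm x powr - p"
    unfolding eventually_at_infinity by blast
  define b1 where "b1 = max b 1"
  have "bounded (h ` cball 0 b1)"
    by (intro compact_imp_bounded compact_continuous_image continuous_on_subset[OF c] compact_cball) simp
  then obtain B where B: "\<And>x. x \<in> cball 0 b1 \<Longrightarrow> \<bar>h x\<bar> \<le> B"
    unfolding bounded_iff real_norm_def by blast
  \<comment> \<open>The first part of \<open>K\<close> covers \<open>cball 0 b1\<close>, where
    \<open>1 + norm x\<close> is at most \<open>1 + b1\<close>; the second covers the outside, where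
    it is at most \<open>2 * norm x\<close> since \<open>b1\<close> is at least 1.\<close>
  define K where "K = \<bar>B\<bar> * (1 + b1) powr p + \<bar>C\<bar> * 2 powr p"
  have K: "K * z = \<bar>B\<bar> * ((1 + b1) powr p * z) + \<bar>C\<bar> * (2 powr p * z)" for z
    unfolding K_def by (simp add: algebra_simps)
  have bound: "\<bar>h x\<bar> \<le> K * (1 + norm x) powr - p" for x
  proof (cases "norm x \<le> b1")
    case True
    have "1 \<le> (1 + b1) powr p * (1 + norm x) powr - p"
    proof -
      have "(1 + norm x) powr p \<le> (1 + b1) powr p"
        using True p0 by (intro powr_mono2) auto
      moreover have "(1 + norm x) powr p > 0" using norm_ge_zero[of x] by (smt (verit) powr_gt_zero)
      ultimately show ?thesis by (simp add: powr_minus field_simps)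
    qed
    then have "\<bar>B\<bar> * 1 \<le> \<bar>B\<bar> * ((1 + b1) powr p * (1 + norm x) powr - p)" by (intro mult_left_mono) auto
    moreover have "0 \<le> \<bar>C\<bar> * (2 powr p * (1 + norm x) powr - p)" by simp
    moreover have "\<bar>h x\<bar> \<le> \<bar>B\<bar>" using B[of x] True by simp
    ultimately show ?thesis unfolding K by linarith
  next
    case False
    then have nx: "norm x \<ge> 1" "norm x \<ge> b" unfolding b1_def by auto
    have "norm x powr - p \<le> 2 powr p * (1 + norm x) powr - p"
    proof -
      have "(1 + norm x) powr p \<le> (2 * norm x) powr p" using nx p0 by (intro powr_mono2) auto
      also have "\<dots> = 2 powr p * norm x powr p" by (simp add: powr_mult)
      finally have "(1 + norm x) powr p \<le> 2 powr p * norm x powr p" .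
      moreover have "norm x powr p > 0" "(1 + norm x) powr p > 0" using nx by auto
      ultimately show ?thesis by (simp add: powr_minus divide_simps mult.commute)
    qed
    then have "\<bar>C\<bar> * norm x powr - p \<le> \<bar>C\<bar> * (2 powr p * (1 + norm x) powr - p)" by (intro mult_left_mono) auto
    moreover have "\<bar>h x\<bar> \<le> \<bar>C\<bar> * norm x powr - p"
      using b[OF nx(2)] by (rule order_trans) (intro mult_right_mono, auto)
    moreover have "0 \<le> \<bar>B\<bar> * ((1 + b1) powr p * (1 + norm x) powr - p)" by simp
    ultimately show ?thesis unfolding K by linarith
  qed
  show ?thesis
  proof (rule measurable_bounded_by_integrable_imp_absolutely_integrable)
    show "h \<in> borel_measurable (lebesgue_on UNIV)"
      using c by (rule continuous_imp_measurable_on_sets_lebesgue) simp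
    show "(\<lambda>x::real^'n. K * (1 + norm x) powr - p) integrable_on UNIV"
      using absolutely_integrable_radial_power[OF p]
      by (intro integrable_on_mult_right) (auto simp: absolutely_integrable_on_def)
  qed (use bound in auto)
qed

section \<open>Bounds on the inverse metric and the volume density, decay rates\<close>

context smooth_graph
begin

text \<open>As the metric dominates the identity, \<open>w = ginv f x *v v\<close> satisfies
  \<open>norm w ^ 2 \<le> w \<bullet> v\<close>, and Cauchy-Schwarz finishes.\<close>

lemma norm_ginv_column_le_1: "norm (ginv f x *v v) \<le> norm v"
proof -
  let ?w = "ginv f x *v v"
  have "metric f x *v ?w = v"
    by (simp add: matrix_vector_mul_assoc ginv_mult)
  then have "?w \<bullet> v = ?w \<bullet> ?w + norm (\<Sum>i\<in>UNIV. ?w $ i *\<^sub>R D1 f i x) ^ 2"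
    using metric_quadratic[of ?w x] by simp
  then have "norm ?w * norm ?w \<le> ?w \<bullet> v" by (simp add: norm_eq_sqrt_inner)
  also have "\<dots> \<le> norm ?w * norm v" by (rule norm_cauchy_schwarz)
  finally show ?thesis
    by (cases "norm ?w = 0") (auto dest: mult_left_le_imp_le)
qed

lemma abs_gi_le_1: "\<bar>gi f i j x\<bar> \<le> 1"
proof -
  have "\<bar>gi f i j x\<bar> = \<bar>(ginv f x *v axis j 1) $ i\<bar>"
    by (simp add: matrix_vector_mult_basis column_def)
  also have "\<dots> \<le> norm (ginv f x *v axis j 1)" by (rule component_le_norm_cart)
  also have "\<dots> \<le> norm (axis j (1::real) :: real^'n)" by (rule norm_ginv_column_le_1)
  finally show ?thesis by simp
qed

text \<open>The determinant of the inverse is a sum of n! signed products of entries bounded by 1.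
  The constant is crude, but any positive lower bound transfers integrability from M to Lebesgue
  measure.\<close>

lemma abs_Gdet_ge: "1 / fact CARD('n) \<le> \<bar>Gdet f x\<bar>"
proof -
  have "det (ginv f x) * det (metric f x) = 1"
    by (metis det_I det_mul ginv_mult(2))
  then have e: "\<bar>det (ginv f x)\<bar> * \<bar>Gdet f x\<bar> = 1"
    unfolding Gdet_def by (metis abs_1 abs_mult)
  have "\<bar>det (ginv f x)\<bar> \<le> (\<Sum>p | p permutes (UNIV :: 'n set). \<bar>of_int (sign p) * (\<Prod>i\<in>UNIV. gi f i (p i) x)\<bar>)"
    unfolding det_def by (rule sum_abs)
  also have "\<dots> \<le> (\<Sum>p | p permutes (UNIV :: 'n set). 1)"
  proof (rule sum_mono)
    fix p
    have "(\<Prod>i\<in>UNIV. \<bar>gi f i (p i) x\<bar>) \<le> (\<Prod>i\<in>(UNIV :: 'n set). 1)"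
      by (rule prod_mono) (use abs_gi_le_1 in auto)
    then show "\<bar>of_int (sign p) * (\<Prod>i\<in>UNIV. gi f i (p i) x)\<bar> \<le> 1"
      by (simp add: abs_mult abs_prod sign_def)
  qed
  also have "\<dots> = fact CARD('n)"
    using card_permutations[of "UNIV :: 'n set" "CARD('n)"] by simp
  finally have "\<bar>det (ginv f x)\<bar> \<le> fact CARD('n)" .
  then have "1 \<le> fact CARD('n) * \<bar>Gdet f x\<bar>"
    using e by (metis abs_ge_zero mult_right_mono)
  then show ?thesis by (simp add: field_simps)
qed

text \<open>Absolute values avoid a proof that G is positive: \<open>sqrt\<close> is extended to
  negative reals as an odd function, so its modulus is the root of the modulus.\<close>

lemma abs_sqrt_Gdet_ge: "sqrt (1 / fact CARD('n)) \<le> \<bar>sqrt (Gdet f x)\<bar>"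
  using real_sqrt_le_mono[OF abs_Gdet_ge] by (simp add: real_sqrt_abs2 real_sqrt_abs' )

lemma sqrt_Gdet_nonzero: "sqrt (Gdet f x) \<noteq> 0"
proof -
  have "(0::real) < 1 / fact CARD('n)" by simp
  then have "Gdet f x \<noteq> 0" using abs_Gdet_ge[of x] by linarith
  then show ?thesis by simp
qed

lemma decays_gi: "decays 0 (gi f i j)"
  by (rule decaysI[of 1 _ 1]) (use abs_gi_le_1 in auto)

lemma decays_up: "(\<And>a. decays p (X a)) \<Longrightarrow> decays p (\<lambda>x. up (Gi f x) (\<lambda>a. X a x) i)"
  unfolding up_def using decays_mult[OF decays_gi, of p] by (intro decays_sum) simp

lemma decays_inner:
  fixes u v :: "real^'n \<Rightarrow> real^'m"
  shows "(\<And>a. decays p (\<lambda>x. u x $ a)) \<Longrightarrow> (\<And>a. decays q (\<lambda>x. v x $ a)) \<Longrightarrow> decays (p + q) (\<lambda>x. u x \<bullet> v x)"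
  unfolding inner_vec_def inner_real_def by (intro decays_sum decays_mult)

context
  fixes t :: real
  assumes AF: "asymp_flat f (2 * t)" and t: "t > 0"
begin

lemma decays_D: "decays t (\<lambda>x. D1 f i x $ a)" "decays (t + 1) (\<lambda>x. D2 f i j x $ a)"
proof -
  obtain C R0 where H0: "\<forall>x a i j k. norm x \<ge> R0 \<longrightarrow> \<bar>pd i (coordf f a) x\<bar> + \<bar>pd j (pd i (coordf f a)) x\<bar> * norm x
      + \<bar>pd k (pd j (pd i (coordf f a))) x\<bar> * (norm x)\<^sup>2 \<le> C * norm x powr (- (2 * t) / 2)"
    using AF unfolding asymp_flat_def by blast
  have H: "\<bar>pd i (coordf f a) x\<bar> + \<bar>pd j (pd i (coordf f a)) x\<bar> * norm x
      + \<bar>pd k (pd j (pd i (coordf f a))) x\<bar> * (norm x)\<^sup>2 \<le> C * norm x powr - t" if "norm x \<ge> R0" for x a i j k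
    using H0[rule_format, OF that, of i a j k] by simp
  show "decays t (\<lambda>x. D1 f i x $ a)"
  proof (rule decaysI[of R0 _ C])
    fix x :: "real^'n" assume "R0 \<le> norm x"
    moreover have "0 \<le> \<bar>pd i (pd i (coordf f a)) x\<bar> * norm x" "0 \<le> \<bar>pd i (pd i (pd i (coordf f a))) x\<bar> * (norm x)\<^sup>2"
      by auto
    ultimately show "\<bar>D1 f i x $ a\<bar> \<le> C * norm x powr - t"
      using H[of x i a i i] unfolding D1_def vec_lambda_beta by linarith
  qed
  show "decays (t + 1) (\<lambda>x. D2 f i j x $ a)"
  \<comment> \<open>The radius is at least 1 so that the weight \<open>norm x\<close> can be divided
    out.\<close>
  proof (rule decaysI[of "max R0 1" _ C])
    fix x :: "real^'n" assume x: "max R0 1 \<le> norm x"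
    moreover have "0 \<le> \<bar>pd i (coordf f a) x\<bar>" "0 \<le> \<bar>pd i (pd j (pd i (coordf f a))) x\<bar> * (norm x)\<^sup>2"
      by auto
    ultimately have "\<bar>pd j (pd i (coordf f a)) x\<bar> * norm x \<le> C * norm x powr - t"
      using H[of x i a j i] by linarith
    moreover have "norm x > 0" using x by linarith
    moreover have "norm x powr - (t + 1) = norm x powr - t / norm x"
      using x by (simp add: powr_diff)
    ultimately show "\<bar>D2 f i j x $ a\<bar> \<le> C * norm x powr - (t + 1)"
      unfolding D2_def by (simp add: pos_le_divide_eq)
  qed
qed

lemma decays_Gam: "decays (2 * t + 1) (Gam f k i j)"
proof -
  have "decays (t + (t + 1)) (\<lambda>x. D1 f q x \<bullet> D2 f i j x)" for q
    by (intro decays_inner decays_D)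
  then have "decays (2 * t + 1) (\<lambda>x. D1 f q x \<bullet> D2 f i j x)" for q by (simp add: algebra_simps)
  then show ?thesis unfolding Gam_eq_up[abs_def] by (intro decays_up)
qed

text \<open>The product of two second derivatives sets the rate; the Christoffel correction decays
  faster by \<open>2 * t\<close>, which is where \<open>t > 0\<close> enters.\<close>

lemma decays_Rm: "decays (2 * t + 2) (Rm f i j k l)"
proof -
  have b: "decays (2 * t + 2) (\<lambda>x. Uinv_form f x (D2 f i k x) (D2 f j l x))" for i j k l
    unfolding Uinv_form_D2_eq
  proof (intro decays_diff decays_sum)
    have "decays ((t + 1) + (t + 1)) (\<lambda>x. D2 f i k x \<bullet> D2 f j l x)"
      by (intro decays_inner decays_D)
    then show "decays (2 * t + 2) (\<lambda>x. D2 f i k x \<bullet> D2 f j l x)" by (simp add: algebra_simps)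
    have "decays ((2 * t + 1) + (t + (t + 1))) (\<lambda>x. Gam f s i k x * (D1 f s x \<bullet> D2 f j l x))" for s
      by (intro decays_mult decays_Gam decays_inner decays_D)
    then show "decays (2 * t + 2) (\<lambda>x. Gam f s i k x * (D1 f s x \<bullet> D2 f j l x))" for s
      by (rule decays_weaken) (use t in simp)
  qed
  show ?thesis unfolding gauss_equation[abs_def] by (intro decays_diff b)
qed

lemma decays_Ptens: "decays (2 * t + 2) (Ptens f i j k l)"
proof -
  have trg: "decays p (\<lambda>x. trg (Gi f x) (\<lambda>i k. X i k x))" if "\<And>i k. decays p (X i k)" for p X
    unfolding trg_eq_up by (intro decays_sum decays_up that)
  have R: "decays (2 * t + 2) (Ric f j l)" for j l
    unfolding Ric_eq[abs_def] by (intro trg decays_Rm)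
  have S: "decays (2 * t + 2) (Scal f)"
    unfolding Scal_eq[abs_def] by (intro trg R)
  have Ru: "decays (2 * t + 2) (Ricup f j l)" for j l
    unfolding Ricup_eq[abs_def] up2_def by (intro decays_up R)
  have Rmu: "decays (2 * t + 2) (Rmup f i j k l)"
    unfolding Rmup_eq[abs_def] up4_def by (intro decays_up decays_Rm)
  have mg: "decays p (\<lambda>x. u x * gi f a b x)" if "decays p u" for u p a b
    using decays_mult[OF that decays_gi] by simp
  have "decays (0 + 0) (\<lambda>x. gi f i k x * gi f j l x - gi f i l x * gi f j k x)"
    by (intro decays_diff decays_mult decays_gi)
  then have "decays ((2 * t + 2) + 0) (\<lambda>x. (1/2 * Scal f x) * (gi f i k x * gi f j l x - gi f i l x * gi f j k x))"
    by (intro decays_mult decays_cmult S) simp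
  then show ?thesis
    unfolding Ptens_def[abs_def] Let_def
    by (intro decays_add decays_diff mg Ru Rmu) simp
qed

text \<open>\<open>Tt\<close> contains two first and two second derivatives, hence the rate
  \<open>4 * t + 2\<close>; with \<open>2 * t + 2\<close> from P the total is 3 tau + 4 for tau =
  2t.\<close>

lemma decays_L2perp: "decays (6 * t + 4) (L2perp f)"
proof -
  have T: "decays (4 * t + 2) (Tt f i j k l)" for i j k l
    unfolding Tt_eq[abs_def]
  proof (intro decays_sum decays_diff)
    fix s
    have "decays ((2 * t + 1) + ((t + 1) + t)) (\<lambda>x. Gam f s j s x * (D2 f i l x \<bullet> D1 f k x))"
      "decays ((2 * t + 1) + ((t + 1) + t)) (\<lambda>x. Gam f s i l x * (D2 f j s x \<bullet> D1 f k x))"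
      by (intro decays_mult decays_Gam decays_inner decays_D)+
    then show "decays (4 * t + 2) (\<lambda>x. Gam f s j s x * (D2 f i l x \<bullet> D1 f k x))"
      "decays (4 * t + 2) (\<lambda>x. Gam f s i l x * (D2 f j s x \<bullet> D1 f k x))"
      by (simp_all add: algebra_simps)
  qed
  have "decays ((2 * t + 2) + (4 * t + 2)) (L2perp f)"
    unfolding L2perp_def[abs_def] by (intro decays_cmult decays_sum decays_mult decays_Ptens T)
  then show ?thesis by (simp add: algebra_simps)
qed

end

lemma smooth_L2: "smooth_fun (L2 f)" "smooth_fun (L2perp f)"
  unfolding L2_def[abs_def] L2perp_def[abs_def] Tt_eq[abs_def] by (intro smooth_intros)+

lemma L2perp_absolutely_integrable:
  assumes AF: "asymp_flat f \<tau>" and tau: "\<tau> > (real CARD('n) - 4) / 3" and n: "CARD('n) \<ge> 5"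
  shows "L2perp f absolutely_integrable_on UNIV"
proof (rule continuous_decays_absolutely_integrable)
  \<comment> \<open>In dimension at least 5 the lower bound on tau is positive, as the decay
    estimates require.\<close>
  have "real CARD('n) \<ge> 5" using n by simp
  then have "\<tau> / 2 > 0" using tau by simp
  moreover have "asymp_flat f (2 * (\<tau> / 2))" using AF by simp
  ultimately have "decays (6 * (\<tau> / 2) + 4) (L2perp f)" by (intro decays_L2perp)
  then show "decays (3 * \<tau> + 4) (L2perp f)" by simp
  show "3 * \<tau> + 4 > real CARD('n)" using tau by (simp add: field_simps)
  show "continuous_on UNIV (L2perp f)" by (intro smooth_fun_continuous_on smooth_L2)
qed

lemma L2_absolutely_integrable:
  assumes "M_integrable f (L2 f)"
  shows "L2 f absolutely_integrable_on UNIV"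
proof (rule measurable_bounded_by_integrable_imp_absolutely_integrable)
  let ?c = "sqrt (1 / fact CARD('n))"
  have c: "?c > 0" by simp
  have "(\<lambda>x. \<bar>L2 f x * sqrt (Gdet f x)\<bar>) integrable_on UNIV"
    using assms unfolding M_integrable_def absolutely_integrable_on_def by simp
  then show "(\<lambda>x. inverse ?c * \<bar>L2 f x * sqrt (Gdet f x)\<bar>) integrable_on UNIV"
    by (rule integrable_on_mult_right)
  show "norm (L2 f x) \<le> inverse ?c * \<bar>L2 f x * sqrt (Gdet f x)\<bar>" for x
  proof -
    have "?c * \<bar>L2 f x\<bar> \<le> \<bar>sqrt (Gdet f x)\<bar> * \<bar>L2 f x\<bar>"
      by (intro mult_right_mono abs_sqrt_Gdet_ge) simp
    then have "inverse ?c * (?c * \<bar>L2 f x\<bar>) \<le> inverse ?c * (\<bar>sqrt (Gdet f x)\<bar> * \<bar>L2 f x\<bar>)"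
      using c by (intro mult_left_mono) auto
    moreover have "inverse ?c * (?c * \<bar>L2 f x\<bar>) = \<bar>L2 f x\<bar>" using c by (simp only: mult.assoc[symmetric]) simp
    ultimately show ?thesis by (simp only: real_norm_def abs_mult mult.commute[of "\<bar>L2 f x\<bar>"])
  qed
  show "L2 f \<in> borel_measurable (lebesgue_on UNIV)"
    using smooth_fun_continuous_on[OF smooth_L2(1), of UNIV]
    by (rule continuous_imp_measurable_on_sets_lebesgue) simp
qed simp

lemma mass_flux_eq:
  assumes "r > 0"
  shows "mass_flux f r = integral (ball 0 r) (\<lambda>x. 1/2 * (L2 f x + L2perp f x))"
proof -
  have "mass_flux f r = sphere_int r (\<lambda>x. \<Sum>i\<in>UNIV. flux_field f i x * (x $ i / r))"
    unfolding mass_flux_def flux_field_def by (simp only: sum_distrib_right)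
  also have "\<dots> = integral (ball 0 r) (\<lambda>x. \<Sum>i\<in>UNIV. pd i (flux_field f i) x)"
    by (rule divergence_theorem_ball[OF smooth_flux_field assms])
  finally show ?thesis unfolding divergence_flux_field .
qed

end

lemma integral_ball_tendsto_at_top:
  fixes h :: "'a::euclidean_space \<Rightarrow> real"
  assumes h: "h absolutely_integrable_on UNIV"
  shows "((\<lambda>r. integral (ball 0 r) h) \<longlongrightarrow> integral UNIV h) at_top"
proof -
  have hb: "h absolutely_integrable_on ball 0 r" for r
    by (rule set_integrable_subset[OF h]) auto
  have hi: "integrable lebesgue h" using h by (simp add: set_integrable_def)
  have "((\<lambda>r. LINT x|lebesgue. indicator (ball 0 r) x *\<^sub>R h x) \<longlongrightarrow> (LINT x|lebesgue. h x)) at_top"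
  proof (rule integral_dominated_convergence_at_top[where w = "\<lambda>x. \<bar>h x\<bar>"])
    show "\<forall>\<^sub>F r in at_top. AE x in lebesgue. norm (indicat_real (ball 0 r) x *\<^sub>R h x) \<le> \<bar>h x\<bar>"
      by (intro always_eventually allI AE_I2) (auto simp: indicator_def)
    show "AE x in lebesgue. ((\<lambda>r. indicat_real (ball 0 r) x *\<^sub>R h x) \<longlongrightarrow> h x) at_top"
    proof (rule AE_I2, rule tendsto_eventually)
      fix x
      show "\<forall>\<^sub>F r in at_top. indicat_real (ball 0 r) x *\<^sub>R h x = h x"
        using eventually_gt_at_top[of "norm x"] by eventually_elim (simp add: indicator_def)
    qed
    show "(\<lambda>x. indicat_real (ball 0 r) x *\<^sub>R h x) \<in> borel_measurable lebesgue" for r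
      using hb[of r] unfolding set_integrable_def by (rule borel_measurable_integrable)
  qed (use hi in auto)
  moreover have "(LINT x|lebesgue. indicator (ball 0 r) x *\<^sub>R h x) = integral (ball 0 r) h" for r
    using set_lebesgue_integral_eq_integral(2)[OF hb] unfolding set_lebesgue_integral_def .
  moreover have "(LINT x|lebesgue. h x) = integral UNIV h"
    using integral_lebesgue[OF hi] by simp
  ultimately show ?thesis by simp
qed

text \<open>Dimension 3 is harmless: the factor \<open>n - 3\<close> is zero there and division by
  zero gives 0.\<close>

lemma c2_nonneg:
  assumes "CARD('n::finite) \<ge> 3"
  shows "c2 TYPE('n) \<ge> 0"
proof -
  have "real CARD('n) \<ge> 3" using assms by simp
  moreover have "omega TYPE('n) \<ge> 0"
  proof -
    have "0 \<le> integral (ball (0::real^'n) 1) (\<lambda>_. 1::real)"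
      unfolding lmeasure_integral[OF lmeasurable_ball, symmetric] by (rule measure_nonneg)
    then show ?thesis unfolding omega_def sphere_int_def by simp
  qed
  ultimately show ?thesis unfolding c2_def by simp
qed

text \<open>Integrability is part of the claim because \<open>integral\<close> is 0 by convention
  for a function that is not integrable. The mass enters as the limit of the scaled flux, so its
  existence is proved as well, and the sign statement is about the value of that limit.\<close>

theorem theorem1p4:
  fixes f :: "real^'n::finite \<Rightarrow> real^'m::finite" and \<tau> :: real
  assumes n5: "CARD('n) \<ge> 5"
    and smooth: "\<forall>a. smooth_fun (coordf f a)"
    and tau: "\<tau> > (real CARD('n) - 4) / 3"
    and AF: "asymp_flat f \<tau>"
    and L2_int: "M_integrable f (L2 f)"
  shows "M_integrable f (\<lambda>x. (L2 f x + L2perp f x) / sqrt (Gdet f x))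
    \<and> ((\<lambda>r. c2 TYPE('n) * mass_flux f r) \<longlongrightarrow>
          1/2 * c2 TYPE('n) * M_integral f (\<lambda>x. (L2 f x + L2perp f x) / sqrt (Gdet f x))) at_top
    \<and> (flat_normal_bundle f \<longrightarrow> (\<forall>x. L2perp f x = 0))
    \<and> (flat_normal_bundle f \<and> (\<forall>x. L2 f x \<ge> 0) \<longrightarrow>
          1/2 * c2 TYPE('n) * M_integral f (\<lambda>x. (L2 f x + L2perp f x) / sqrt (Gdet f x)) \<ge> 0)"
proof -
  interpret smooth_graph f by unfold_locales (use smooth in blast)
  let ?h = "\<lambda>x. L2 f x + L2perp f x"
  \<comment> \<open>The weight \<open>1 / sqrt G\<close> cancels the density of the measure on M and
    leaves a plain Lebesgue integral of \<open>?h\<close>.\<close>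
  have cancel: "(\<lambda>x. ?h x / sqrt (Gdet f x) * sqrt (Gdet f x)) = ?h"
    using sqrt_Gdet_nonzero by (simp add: fun_eq_iff)
  have h: "?h absolutely_integrable_on UNIV"
    by (intro set_integral_add L2_absolutely_integrable L2_int L2perp_absolutely_integrable[OF AF tau n5])
  have Mi: "M_integral f (\<lambda>x. ?h x / sqrt (Gdet f x)) = integral UNIV ?h"
    unfolding M_integral_def cancel ..
  have "((\<lambda>r. c2 TYPE('n) * (1/2 * integral (ball 0 r) ?h)) \<longlongrightarrow> c2 TYPE('n) * (1/2 * integral UNIV ?h)) at_top"
    by (intro tendsto_mult tendsto_const integral_ball_tendsto_at_top h)
  moreover have "\<forall>\<^sub>F r in at_top. c2 TYPE('n) * (1/2 * integral (ball 0 r) ?h) = c2 TYPE('n) * mass_flux f r"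
    using eventually_gt_at_top[of 0] by eventually_elim (simp only: mass_flux_eq integral_mult_right)
  ultimately have lim: "((\<lambda>r. c2 TYPE('n) * mass_flux f r) \<longlongrightarrow> c2 TYPE('n) * (1/2 * integral UNIV ?h)) at_top"
    by (rule Lim_transform_eventually)
  have pos: "integral UNIV ?h \<ge> 0" if "flat_normal_bundle f" "\<forall>x. L2 f x \<ge> 0"
    using h L2perp_flat[OF that(1)] that(2)
    by (intro Henstock_Kurzweil_Integration.integral_nonneg) (auto simp: absolutely_integrable_on_def)
  show ?thesis
    unfolding Mi
  proof (intro conjI impI allI)
    show "M_integrable f (\<lambda>x. ?h x / sqrt (Gdet f x))"
      unfolding M_integrable_def cancel by (rule h)
    show "((\<lambda>r. c2 TYPE('n) * mass_flux f r) \<longlongrightarrow> 1/2 * c2 TYPE('n) * integral UNIV ?h) at_top"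
      using lim by (simp add: mult_ac)
    show "L2perp f x = 0" if "flat_normal_bundle f" for x by (rule L2perp_flat[OF that])
    show "1/2 * c2 TYPE('n) * integral UNIV ?h \<ge> 0"
      if "flat_normal_bundle f \<and> (\<forall>x. L2 f x \<ge> 0)"
      using pos c2_nonneg[where 'n = 'n] n5 that by simp
  qed
qed

end
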